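(* Let $\mathbb F$ and $\mathbb F'$ be finite fields with $|\mathbb F'|$ odd. Then $\mathcal{SC}(\mathrm{USL}_\bullet,\mathbb F)$ and $\mathcal{SC}(\mathrm{UO}_\bullet,\mathbb F')$ are isomorphic (graded) Hopf algebras if and only if $|\mathbb F|=2|\mathbb F'|-1$.
   Context: $\mathbb K$ is a field of characteristic zero; $[n]=\{1,\dots,n\}$, $[\pm n]=\{-n,\dots,-1\}\cup\{1,\dots,n\}$. Hopf algebras are graded connected over $\mathbb K$, and morphisms are graded. **Superclass functions.** $\mathrm{USL}_n(\mathbb F)$ is the group of upper triangular $n\times n$ matrices over $\mathbb F$ with ones on the diagonal. Its superclasses are the orbits of the action of $\mathrm{USL}_n(\mathbb F)\times\mathrm{USL}_n(\mathbb F)$ given by $(g,h):x\mapsto1+g(x-1)h^{-1}$. For a square matrix $X$, $X^\dagger$ denotes its reflection about the anti-diagonal. For $|\mathbb F'|$ odd, $\mathrm{UO}_{2n}(\mathbb F')=\{g\in\mathrm{USL}_{2n}(\mathbb F'):g^{-1}=g^\dagger\}$; its superclasses are the nonempty intersections of the group with superclasses of $\mathrm{USL}_{2n}(\mathbb F')$. $\mathcal{SC}(\mathrm{USL}_n,\mathbb F)$ and $\mathcal{SC}(\mathrm{UO}_{2n},\mathbb F')$ are the spaces of $\mathbb K$-valued functions constant on superclasses, and $\mathcal{SC}(\mathrm{USL}_\bullet,\mathbb F)=\bigoplus_{n\ge0}\mathcal{SC}(\mathrm{USL}_n,\mathbb F)$, $\mathcal{SC}(\mathrm{UO}_\bullet,\mathbb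 F')=\bigoplus_{n\ge0}\mathcal{SC}(\mathrm{UO}_{2n},\mathbb F')$, the $n$th summand having degree $n$. **Hopf algebra structure on $\mathcal{SC}(\mathrm{USL}_\bullet,\mathbb F)$ (Aguiar et al.).** The product of $\varphi\in\mathcal{SC}(\mathrm{USL}_m,\mathbb F)$ and $\psi\in\mathcal{SC}(\mathrm{USL}_n,\mathbb F)$ is the inflation $u\mapsto\varphi(u_{[m]})\psi(u_{[m+1,m+n]})$ on $\mathrm{USL}_{m+n}(\mathbb F)$, where $u_A$ is the submatrix of $u$ with rows and columns in $A$. The coproduct of $\psi\in\mathcal{SC}(\mathrm{USL}_n,\mathbb F)$ is the sum over all $A\subset[n]$ of the element of $\mathcal{SC}(\mathrm{USL}_{|A|},\mathbb F)\otimes\mathcal{SC}(\mathrm{USL}_{n-|A|},\mathbb F)$ obtained by restricting $\psi$ to the subgroup $\{u\in\mathrm{USL}_n(\mathbb F):u_{ij}=0\text{ for }i<j\text{ unless }i,j\in A\text{ or }i,j\in A^c\}$, identified with $\mathrm{USL}_{|A|}(\mathbb F)\times\mathrm{USL}_{n-|A|}(\mathbb F)$ via $u\mapsto(u_A,u_{A^c})$. **Hopf algebra structure on $\mathcal{SC}(\mathrm{UO}_\bullet,\mathbb F')$ (Benedetti; up to isomorphism).** For a partition $\Lambda$ of a finite set of integers, an arc is a pair $(i,j)$, $i<j$, of elements of a common block $B$ such that each $k\in B$ has $k\le i$ or $j\le k$. Let $D_n$ be the set of partitions $\Lambda$ of $[\pm n]$ with $\Lambda=\{-B:B\in\Lambda\}$,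 together with a labeling of the arcs by nonzero elements of $\mathbb F'$ such that if $(i,j)$ is an arc then $(-j,-i)$ is an arc with the same label and $i+j\neq0$. This set indexes the superclasses of $\mathrm{UO}_{2n}(\mathbb F')$, and the Hopf algebra has a basis $\{P_\Lambda:\Lambda\in D_n\}$ of its degree $n$ component, with $P_\Lambda P_{\Lambda'}=P_{\Lambda\sqcup\Lambda'^{\uparrow m}}$ for $\Lambda\in D_m$, $\Lambda'\in D_n$, where $\Lambda'^{\uparrow m}$ is obtained by replacing each $\pm i$ ($i>0$) by $\pm(i+m)$, and $\Delta(P_\Lambda)=\sum_AP_{\mathrm{st}(\Lambda_A)}\otimes P_{\mathrm{st}(\Lambda_{A^c})}$, summed over $A\subset[n]$ such that every block of $\Lambda$ is contained in $A\cup-A$ or in $A^c\cup-A^c$; here $\Lambda_A$ consists of the blocks contained in $A\cup-A$ with their labeled arcs, and $\mathrm{st}$ relabels $\pm a$ to $\pm\theta(a)$ with $\theta:A\to[|A|]$ order-preserving. *)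

theory Defs
  imports
    "HOL-Library.Function_Algebras"
    "HOL-Library.Disjoint_Sets"
    "HOL-Library.Cardinality"
    "Jordan_Normal_Form.DL_Submatrix"
begin

subsection \<open>Graded connected Hopf algebras of functions\<close>

text \<open>
  All vector spaces occurring here are spaces of functions, i.e. subspaces of \<open>'x \<Rightarrow> 'k\<close> over the
  field \<open>'k\<close>.  Sums of functions are pointwise; \<open>c *\<^sub>f f\<close> is the pointwise scalar multiple.
  For subspaces \<open>V\<close> and \<open>W\<close> the tensor product of \<open>V\<close> and \<open>W\<close> is realised, as usual for function
  spaces, inside \<open>'x \<times> 'y \<Rightarrow> 'k\<close>, the pure tensor of \<open>f\<close> and \<open>g\<close> being \<open>(x, y) \<mapsto> f x * g y\<close>.  This
  is a model of the algebraic tensor product, because the canonical linear map from the latter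
  to \<open>'x \<times> 'y \<Rightarrow> 'k\<close> is injective.
\<close>

definition fscale :: "'k::field \<Rightarrow> ('x \<Rightarrow> 'k) \<Rightarrow> 'x \<Rightarrow> 'k"  (infixr "*\<^sub>f" 75)
  where "c *\<^sub>f f = (\<lambda>x. c * f x)"

interpretation fun_vs: vector_space "fscale :: 'k::field \<Rightarrow> ('x \<Rightarrow> 'k) \<Rightarrow> 'x \<Rightarrow> 'k"
  by unfold_locales (auto simp: fscale_def fun_eq_iff algebra_simps)

definition tens :: "('x \<Rightarrow> 'k::field) \<Rightarrow> ('y \<Rightarrow> 'k) \<Rightarrow> 'x \<times> 'y \<Rightarrow> 'k"  (infixr "\<boxtimes>" 72)
  where "f \<boxtimes> g = (\<lambda>(x, y). f x * g y)"

definition tensor_space :: "('x \<Rightarrow> 'k::field) set \<Rightarrow> ('y \<Rightarrow> 'k) set \<Rightarrow> ('x \<times> 'y \<Rightarrow> 'k) set"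
  where "tensor_space V W = fun_vs.span {f \<boxtimes> g | f g. f \<in> V \<and> g \<in> W}"

text \<open>
  The data of a graded Hopf algebra.  The operations are total functions, but only their
  values on the total space \<open>hspace\<close> matter.
\<close>

record ('x, 'k) graded_hopf =
  hcomp :: "nat \<Rightarrow> ('x \<Rightarrow> 'k) set"
  hprod :: "('x \<Rightarrow> 'k) \<Rightarrow> ('x \<Rightarrow> 'k) \<Rightarrow> 'x \<Rightarrow> 'k"
  hone :: "'x \<Rightarrow> 'k"
  hcoprod :: "('x \<Rightarrow> 'k) \<Rightarrow> 'x \<times> 'x \<Rightarrow> 'k"
  hcounit :: "('x \<Rightarrow> 'k) \<Rightarrow> 'k"

definition hspace :: "('x, 'k::field) graded_hopf \<Rightarrow> ('x \<Rightarrow> 'k) set"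
  where "hspace H = fun_vs.span (\<Union>n. hcomp H n)"

text \<open>
  \<open>sweedler H f ps\<close> says that the list \<open>ps\<close> of pairs of elements represents the coproduct of \<open>f\<close>
  as a sum of pure tensors.  Multilinear operations are applied to a coproduct via such a
  representation; the results do not depend on its choice.
\<close>

definition sweedler ::
    "('x, 'k::field) graded_hopf \<Rightarrow> ('x \<Rightarrow> 'k) \<Rightarrow> (('x \<Rightarrow> 'k) \<times> ('x \<Rightarrow> 'k)) list \<Rightarrow> bool"
  where "sweedler H f ps \<longleftrightarrow>
    set ps \<subseteq> hspace H \<times> hspace H \<and> hcoprod H f = (\<Sum>(a, b)\<leftarrow>ps. a \<boxtimes> b)"

locale graded_connected_hopf_algebra =
  fixes H :: "('x, 'k::field) graded_hopf"
  assumes comp_subspace: "\<And>n. fun_vs.subspace (hcomp H n)"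
    and comp_direct: "\<And>F N i. (\<And>n. F n \<in> hcomp H n) \<Longrightarrow> (\<Sum>n<N. F n) = 0 \<Longrightarrow> i < N \<Longrightarrow> F i = 0"
    and connected: "hone H \<noteq> 0" "hcomp H 0 = fun_vs.span {hone H}"
    and prod_graded: "\<And>m n f g. f \<in> hcomp H m \<Longrightarrow> g \<in> hcomp H n \<Longrightarrow> hprod H f g \<in> hcomp H (m + n)"
    and prod_add_left: "\<And>f g h. f \<in> hspace H \<Longrightarrow> g \<in> hspace H \<Longrightarrow> h \<in> hspace H \<Longrightarrow>
          hprod H (f + g) h = hprod H f h + hprod H g h"
    and prod_add_right: "\<And>f g h. f \<in> hspace H \<Longrightarrow> g \<in> hspace H \<Longrightarrow> h \<in> hspace H \<Longrightarrow>
          hprod H f (g + h) = hprod H f g + hprod H f h"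
    and prod_scale_left: "\<And>c f g. f \<in> hspace H \<Longrightarrow> g \<in> hspace H \<Longrightarrow>
          hprod H (c *\<^sub>f f) g = c *\<^sub>f hprod H f g"
    and prod_scale_right: "\<And>c f g. f \<in> hspace H \<Longrightarrow> g \<in> hspace H \<Longrightarrow>
          hprod H f (c *\<^sub>f g) = c *\<^sub>f hprod H f g"
    and prod_assoc: "\<And>f g h. f \<in> hspace H \<Longrightarrow> g \<in> hspace H \<Longrightarrow> h \<in> hspace H \<Longrightarrow>
          hprod H (hprod H f g) h = hprod H f (hprod H g h)"
    and prod_one: "\<And>f. f \<in> hspace H \<Longrightarrow> hprod H (hone H) f = f"
          "\<And>f. f \<in> hspace H \<Longrightarrow> hprod H f (hone H) = f"
    and coprod_graded: "\<And>n f. f \<in> hcomp H n \<Longrightarrow>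
          hcoprod H f \<in> fun_vs.span (\<Union>i\<le>n. tensor_space (hcomp H i) (hcomp H (n - i)))"
    and coprod_add: "\<And>f g. f \<in> hspace H \<Longrightarrow> g \<in> hspace H \<Longrightarrow>
          hcoprod H (f + g) = hcoprod H f + hcoprod H g"
    and coprod_scale: "\<And>c f. f \<in> hspace H \<Longrightarrow> hcoprod H (c *\<^sub>f f) = c *\<^sub>f hcoprod H f"
    and coprod_coassoc: "\<And>f. f \<in> hspace H \<Longrightarrow> \<exists>ps. sweedler H f ps \<and>
          (\<forall>x y z. (\<Sum>(a, b)\<leftarrow>ps. hcoprod H a \<boxtimes> b) ((x, y), z) =
                   (\<Sum>(a, b)\<leftarrow>ps. a \<boxtimes> hcoprod H b) (x, (y, z)))"
    and counit_graded: "\<And>n f. f \<in> hcomp H n \<Longrightarrow> n \<noteq> 0 \<Longrightarrow> hcounit H f = 0"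
    and counit_add: "\<And>f g. f \<in> hspace H \<Longrightarrow> g \<in> hspace H \<Longrightarrow>
          hcounit H (f + g) = hcounit H f + hcounit H g"
    and counit_scale: "\<And>c f. f \<in> hspace H \<Longrightarrow> hcounit H (c *\<^sub>f f) = c * hcounit H f"
    and coprod_counit: "\<And>f. f \<in> hspace H \<Longrightarrow> \<exists>ps. sweedler H f ps \<and>
          (\<Sum>(a, b)\<leftarrow>ps. hcounit H a *\<^sub>f b) = f \<and> (\<Sum>(a, b)\<leftarrow>ps. hcounit H b *\<^sub>f a) = f"
    and coprod_one: "hcoprod H (hone H) = hone H \<boxtimes> hone H"
    and coprod_prod: "\<And>f g. f \<in> hspace H \<Longrightarrow> g \<in> hspace H \<Longrightarrow>
          \<exists>ps qs. sweedler H f ps \<and> sweedler H g qs \<and>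
            hcoprod H (hprod H f g) =
              (\<Sum>(a, b)\<leftarrow>ps. \<Sum>(c, d)\<leftarrow>qs. hprod H a c \<boxtimes> hprod H b d)"
    and counit_one: "hcounit H (hone H) = 1"
    and counit_prod: "\<And>f g. f \<in> hspace H \<Longrightarrow> g \<in> hspace H \<Longrightarrow>
          hcounit H (hprod H f g) = hcounit H f * hcounit H g"
    and antipode: "\<exists>S.
          (\<forall>f\<in>hspace H. S f \<in> hspace H) \<and>
          (\<forall>f\<in>hspace H. \<forall>g\<in>hspace H. S (f + g) = S f + S g) \<and>
          (\<forall>c. \<forall>f\<in>hspace H. S (c *\<^sub>f f) = c *\<^sub>f S f) \<and>
          (\<forall>f\<in>hspace H. \<exists>ps. sweedler H f ps \<and>
             (\<Sum>(a, b)\<leftarrow>ps. hprod H (S a) b) = hcounit H f *\<^sub>f hone H \<and>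
             (\<Sum>(a, b)\<leftarrow>ps. hprod H a (S b)) = hcounit H f *\<^sub>f hone H)"

text \<open>
  Isomorphisms of graded Hopf algebras.  Compatibility with the antipodes is automatic.
\<close>

definition graded_hopf_iso ::
    "('x, 'k::field) graded_hopf \<Rightarrow> ('y, 'k) graded_hopf \<Rightarrow> (('x \<Rightarrow> 'k) \<Rightarrow> 'y \<Rightarrow> 'k) \<Rightarrow> bool"
  where "graded_hopf_iso H H' \<phi> \<longleftrightarrow>
    bij_betw \<phi> (hspace H) (hspace H') \<and>
    (\<forall>f\<in>hspace H. \<forall>g\<in>hspace H. \<phi> (f + g) = \<phi> f + \<phi> g) \<and>
    (\<forall>c. \<forall>f\<in>hspace H. \<phi> (c *\<^sub>f f) = c *\<^sub>f \<phi> f) \<and>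
    (\<forall>n. \<phi> ` hcomp H n = hcomp H' n) \<and>
    \<phi> (hone H) = hone H' \<and>
    (\<forall>f\<in>hspace H. \<forall>g\<in>hspace H. \<phi> (hprod H f g) = hprod H' (\<phi> f) (\<phi> g)) \<and>
    (\<forall>f\<in>hspace H. hcounit H' (\<phi> f) = hcounit H f) \<and>
    (\<forall>f\<in>hspace H. \<exists>ps. sweedler H f ps \<and> hcoprod H' (\<phi> f) = (\<Sum>(a, b)\<leftarrow>ps. \<phi> a \<boxtimes> \<phi> b))"

definition graded_hopf_isomorphic ::
    "('x, 'k::field) graded_hopf \<Rightarrow> ('y, 'k) graded_hopf \<Rightarrow> bool"
  where "graded_hopf_isomorphic H H' \<longleftrightarrow> (\<exists>\<phi>. graded_hopf_iso H H' \<phi>)"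


subsection \<open>Superclasses and superclass functions\<close>

definition USL :: "nat \<Rightarrow> 'f::field mat set"
  where "USL n = {x \<in> carrier_mat n n. upper_triangular x \<and> (\<forall>i<n. x $$ (i, i) = 1)}"

definition superclass :: "nat \<Rightarrow> 'f::field mat \<Rightarrow> 'f mat set"
  where "superclass n x = {1\<^sub>m n + g * (x - 1\<^sub>m n) * h' | g h h'.
    g \<in> USL n \<and> h \<in> USL n \<and> inverts_mat h h' \<and> inverts_mat h' h}"

definition USL_superclasses :: "nat \<Rightarrow> 'f::field mat set set"
  where "USL_superclasses n = superclass n ` USL n"

definition antitranspose :: "'f mat \<Rightarrow> 'f mat"
  where "antitranspose x = mat (dim_col x) (dim_row x)
    (\<lambda>(i, j). x $$ (dim_row x - 1 - j, dim_col x - 1 - i))"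

text \<open>\<open>UO n\<close> is the group of \<open>2n \<times> 2n\<close> matrices, and the summand of degree \<open>n\<close>.\<close>

definition UO :: "nat \<Rightarrow> 'f::field mat set"
  where "UO n = {g \<in> USL (2 * n). inverts_mat g (antitranspose g) \<and> inverts_mat (antitranspose g) g}"

definition UO_superclasses :: "nat \<Rightarrow> 'f::field mat set set"
  where "UO_superclasses n = {UO n \<inter> C | C. C \<in> USL_superclasses (2 * n)} - {{}}"

text \<open>
  Functions on a group of matrices are extended by zero to the type of all matrices (of all
  sizes).  The direct sum over \<open>n\<close> thereby becomes the internal sum of subspaces of
  \<open>'f mat \<Rightarrow> 'k\<close>.
\<close>

definition class_functions :: "'a set set \<Rightarrow> ('a \<Rightarrow> 'k::field) set"
  where "class_functions \<C> = {\<phi>. (\<forall>x. x \<notin> \<Union>\<C> \<longrightarrow> \<phi> x = 0) \<and>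
    (\<forall>C\<in>\<C>. \<forall>x\<in>C. \<forall>y\<in>C. \<phi> x = \<phi> y)}"


subsection \<open>The Hopf algebra of superclass functions on the groups of unitriangular matrices\<close>

text \<open>
  Rows and columns are indexed from \<open>0\<close>.  Since \<open>\<phi>\<close> vanishes outside the matrices of its degree,
  the sum over \<open>m\<close> is the bilinear extension of inflation: for \<open>\<phi>\<close> of degree \<open>m\<^sub>0\<close> and \<open>\<psi>\<close> of degree
  \<open>n\<^sub>0\<close>, only the term \<open>m = m\<^sub>0\<close> can be nonzero, and only if \<open>u\<close> has size \<open>m\<^sub>0 + n\<^sub>0\<close>.
\<close>

definition USL_prod :: "('f::field mat \<Rightarrow> 'k::field) \<Rightarrow> ('f mat \<Rightarrow> 'k) \<Rightarrow> 'f mat \<Rightarrow> 'k"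
  where "USL_prod \<phi> \<psi> u = (let N = dim_row u in
    if u \<in> USL N
    then \<Sum>m\<le>N. \<phi> (submatrix u {..<m} {..<m}) * \<psi> (submatrix u {m..<N} {m..<N})
    else 0)"

definition USL_split_subgroup :: "nat \<Rightarrow> nat set \<Rightarrow> 'f::field mat set"
  where "USL_split_subgroup n A = {u \<in> USL n. \<forall>i j. i < j \<and> j < n \<longrightarrow>
    \<not> (i \<in> A \<and> j \<in> A) \<longrightarrow> \<not> (i \<notin> A \<and> j \<notin> A) \<longrightarrow> u $$ (i, j) = 0}"

text \<open>
  The value at \<open>(a, b)\<close>, with \<open>a\<close> and \<open>b\<close> of sizes \<open>p\<close> and \<open>q\<close>, only receives contributions from the
  sets \<open>A \<subseteq> {..<p + q}\<close> with \<open>p\<close> elements.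
\<close>

definition USL_coprod :: "('f::field mat \<Rightarrow> 'k::field) \<Rightarrow> 'f mat \<times> 'f mat \<Rightarrow> 'k"
  where "USL_coprod \<psi> = (\<lambda>(a, b). let p = dim_row a; q = dim_row b; N = p + q in
    if a \<in> USL p \<and> b \<in> USL q
    then \<Sum>A | A \<subseteq> {..<N} \<and> card A = p.
      \<psi> (the_inv_into (USL_split_subgroup N A)
          (\<lambda>u. (submatrix u A A, submatrix u ({..<N} - A) ({..<N} - A))) (a, b))
    else 0)"

definition SC_USL :: "('f::field mat, 'k::field) graded_hopf"
  where "SC_USL = \<lparr>
    hcomp = (\<lambda>n. class_functions (USL_superclasses n)),
    hprod = USL_prod,
    hone = (\<lambda>u. if u \<in> USL 0 then 1 else 0),
    hcoprod = USL_coprod,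
    hcounit = (\<lambda>\<psi>. \<psi> (1\<^sub>m 0)) \<rparr>"


subsection \<open>Labeled symmetric set partitions\<close>

definition arcs :: "int set set \<Rightarrow> (int \<times> int) set"
  where "arcs \<Lambda> = {(i, j). i < j \<and> (\<exists>B\<in>\<Lambda>. i \<in> B \<and> j \<in> B \<and> (\<forall>k\<in>B. k \<le> i \<or> j \<le> k))}"

text \<open>A partition together with its labeled arcs, an arc \<open>(i, j)\<close> with label \<open>c\<close> being the triple
  \<open>(i, j, c)\<close>.\<close>

type_synonym 'f labeled_partition = "int set set \<times> (int \<times> int \<times> 'f) set"

definition D :: "nat \<Rightarrow> 'f::field labeled_partition set"
  where "D n = {(\<Lambda>, L).
    partition_on ({- int n..-1} \<union> {1..int n}) \<Lambda> \<and>
    \<Lambda> = (\<lambda>B. uminus ` B) ` \<Lambda> \<and>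
    (\<forall>(i, j, c)\<in>L. (i, j) \<in> arcs \<Lambda> \<and> c \<noteq> 0) \<and>
    (\<forall>(i, j)\<in>arcs \<Lambda>. \<exists>!c. (i, j, c) \<in> L) \<and>
    (\<forall>(i, j, c)\<in>L. (- j, - i, c) \<in> L \<and> i + j \<noteq> 0)}"

definition relabel :: "(int \<Rightarrow> int) \<Rightarrow> 'f labeled_partition \<Rightarrow> 'f labeled_partition"
  where "relabel \<theta> = (\<lambda>(\<Lambda>, L). ((\<lambda>B. \<theta> ` B) ` \<Lambda>, (\<lambda>(i, j, c). (\<theta> i, \<theta> j, c)) ` L))"

definition shift :: "nat \<Rightarrow> 'f labeled_partition \<Rightarrow> 'f labeled_partition"
  where "shift m = relabel (\<lambda>i. i + sgn i * int m)"

definition lp_union :: "'f labeled_partition \<Rightarrow> 'f labeled_partition \<Rightarrow> 'f labeled_partition"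
  where "lp_union \<Lambda> \<Lambda>' = (fst \<Lambda> \<union> fst \<Lambda>', snd \<Lambda> \<union> snd \<Lambda>')"

definition lp_restrict :: "int set \<Rightarrow> 'f labeled_partition \<Rightarrow> 'f labeled_partition"
  where "lp_restrict A = (\<lambda>(\<Lambda>, L).
    let \<Lambda>\<^sub>A = {B \<in> \<Lambda>. B \<subseteq> A \<union> uminus ` A}
    in (\<Lambda>\<^sub>A, {(i, j, c) \<in> L. (i, j) \<in> arcs \<Lambda>\<^sub>A}))"

text \<open>For \<open>A\<close> a finite set of positive integers, \<open>\<plusminus>a\<close> is sent to \<open>\<plusminus>r\<close> for the \<open>r\<close>-th smallest
  element \<open>a\<close> of \<open>A\<close>.\<close>

definition standardize :: "int set \<Rightarrow> 'f labeled_partition \<Rightarrow> 'f labeled_partition"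
  where "standardize A = relabel (\<lambda>i. sgn i * int (card {b \<in> A. b \<le> \<bar>i\<bar>}))"


subsection \<open>The Hopf algebra of superclass functions on the even orthogonal groups\<close>

definition is_SC_UO_basis ::
    "('f::field mat, 'k::field) graded_hopf \<Rightarrow> ('f labeled_partition \<Rightarrow> 'f mat \<Rightarrow> 'k) \<Rightarrow> bool"
  where "is_SC_UO_basis H P \<longleftrightarrow>
    (\<forall>n. inj_on P (D n) \<and> fun_vs.independent (P ` D n) \<and> fun_vs.span (P ` D n) = hcomp H n) \<and>
    (\<forall>m n. \<forall>\<Lambda>\<in>D m. \<forall>\<Lambda>'\<in>D n. hprod H (P \<Lambda>) (P \<Lambda>') = P (lp_union \<Lambda> (shift m \<Lambda>'))) \<and>
    (\<forall>n. \<forall>\<Lambda>\<in>D n. hcoprod H (P \<Lambda>) =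
      (\<Sum>A | A \<subseteq> {1..int n} \<and> (\<forall>B\<in>fst \<Lambda>. B \<subseteq> A \<union> uminus ` A \<or>
                B \<subseteq> ({1..int n} - A) \<union> uminus ` ({1..int n} - A)).
         P (standardize A (lp_restrict A \<Lambda>)) \<boxtimes>
         P (standardize ({1..int n} - A) (lp_restrict ({1..int n} - A) \<Lambda>))))"

text \<open>
  The Hopf algebra structure on superclass functions of the groups \<open>UO n\<close> is described up to
  isomorphism only: it has some basis \<open>P\<close> in which the product and coproduct are as above.  These
  formulas leave open which superclass function \<open>P \<Lambda>\<close> is, so this is a predicate on structures
  with the given graded components.  All structures satisfying it are isomorphic.
\<close>

definition is_SC_UO :: "('f::field mat, 'k::field) graded_hopf \<Rightarrow> bool"
  where "is_SC_UO H \<longleftrightarrow>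
    graded_connected_hopf_algebra H \<and>
    (\<forall>n. hcomp H n = class_functions (UO_superclasses n)) \<and>
    (\<exists>P. is_SC_UO_basis H P)"

end

theory Submission
  imports Defs "Jordan_Normal_Form.Determinant"
begin

text \<open>
  Both Hopf algebras have a basis of the same combinatorial kind.  An \<^emph>\<open>arc diagram\<close> of size \<open>n\<close> with
  colours in a set \<open>C\<close> is a set of arcs \<open>i < j\<close> between vertices in \<open>{..<n}\<close>, each arc coloured by
  an element of \<open>C\<close>, such that every vertex starts at most one arc and ends at most one arc.  Diagrams
  can be juxtaposed, and the blocks of a diagram can be distributed over a set \<open>A\<close> and its
  complement.  If these two operations are the product and the coproduct of a graded Hopf algebra in
  some basis indexed by the arc diagrams, then the Hopf algebra is determined up to isomorphism by
  the number of colours, and it determines this number, because its component of degree \<open>2\<close> has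
  dimension \<open>1 + card C\<close> (\<open>diagram_hopf_algebras_isomorphic_iff\<close>).  It remains to find such bases.
  
  For \<open>USL\<close> the colours are the nonzero elements of the field, so their number is \<open>CARD('f) - 1\<close>.  By
  Gaussian elimination every superclass contains exactly one matrix \<open>1 + x\<close> for which \<open>x\<close> has at
  most one nonzero entry in each row and each column (\<open>canonical_form_exists\<close>,
  \<open>canonical_form_unique\<close>); the nonzero entries of \<open>x\<close> are an arc diagram, the \<open>arc_type\<close> of the
  superclass.  A product of indicator functions of superclasses is a sum over all ways to add arcs
  between the two parts.  The basis elements are therefore the functions \<open>upset_function n T\<close> that
  indicate whether the type of a matrix contains \<open>T\<close>.  They are multiplicative because passing to a
  diagonal window of a matrix restricts its type to the window (\<open>arc_type_window\<close>), and they have the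
  required coproduct because the type of a matrix in a split subgroup is the union of the types of
  its two parts (\<open>arc_type_shuffle\<close>).
  
  For \<open>UO\<close> a basis indexed by the symmetric labeled partitions is given.  Their blocks come in pairs
  \<open>B\<close>, \<open>- B\<close> with \<open>B \<noteq> - B\<close>, since the middle arc of a block \<open>B = - B\<close> would be of the excluded form
  \<open>(- i, i)\<close>.  Taking absolute values turns such a pair into one block of an arc diagram.  What is
  forgotten are the signs and the labels.  The signs of neighbours, in the order of absolute values,
  agree or not: one bit for each arc of the diagram.  The labels belong to arcs between neighbours in
  the order of \<open>B\<close> itself, but each such arc is determined by its endpoint of larger absolute value,
  and every element of \<open>B\<close> except the one of least absolute value occurs as such an endpoint.  So
  every arc of the diagram also receives one label, that of its endpoint.  This makes symmetric
  labeled partitions correspond to arc diagrams with colours in \<open>bool \<times> (- {0})\<close>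
  (\<open>bij_sym_arcs\<close>), compatibly with all operations, and the number of colours is \<open>2 * (CARD('g) - 1)\<close>.
\<close>

section \<open>Arc diagrams\<close>

text \<open>
  A set partition of \<open>{..<n}\<close> is encoded by the arcs between consecutive elements of its blocks.  A
  set of arcs arises in this way if and only if every vertex starts at most one arc and ends at most
  one arc.
\<close>

definition arc_diagrams :: "nat \<Rightarrow> 'c set \<Rightarrow> (nat \<times> nat \<times> 'c) set set"
  where "arc_diagrams n C = {T. \<forall>i j c. (i, j, c) \<in> T \<longrightarrow> i < j \<and> j < n \<and> c \<in> C \<and>
    (\<forall>j' c'. (i, j', c') \<in> T \<longrightarrow> j' = j \<and> c' = c) \<and> (\<forall>i' c'. (i', j, c') \<in> T \<longrightarrow> i' = i \<and> c' = c)}"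

definition relabel_arcs :: "(nat \<Rightarrow> nat) \<Rightarrow> (nat \<times> nat \<times> 'c) set \<Rightarrow> (nat \<times> nat \<times> 'c) set"
  where "relabel_arcs \<eta> T = (\<lambda>(i, j, c). (\<eta> i, \<eta> j, c)) ` T"

definition recolour :: "('c \<Rightarrow> 'd) \<Rightarrow> (nat \<times> nat \<times> 'c) set \<Rightarrow> (nat \<times> nat \<times> 'd) set"
  where "recolour e T = (\<lambda>(i, j, c). (i, j, e c)) ` T"

definition arcs_within :: "nat set \<Rightarrow> (nat \<times> nat \<times> 'c) set \<Rightarrow> (nat \<times> nat \<times> 'c) set"
  where "arcs_within A T = {(i, j, c) \<in> T. i \<in> A \<and> j \<in> A}"

text \<open>
  Arcs join consecutive elements of blocks, so this says that \<open>A\<close> is a union of blocks.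
\<close>

definition splits :: "nat set \<Rightarrow> (nat \<times> nat \<times> 'c) set \<Rightarrow> bool"
  where "splits A T \<longleftrightarrow> (\<forall>i j c. (i, j, c) \<in> T \<longrightarrow> (i \<in> A \<longleftrightarrow> j \<in> A))"

definition pos_in :: "nat set \<Rightarrow> nat \<Rightarrow> nat"
  where "pos_in A i = card {a \<in> A. a < i}"

text \<open>
  The restriction of a diagram to a union \<open>A\<close> of blocks, as a diagram of size \<open>card A\<close>.
\<close>

definition std_arcs :: "nat set \<Rightarrow> (nat \<times> nat \<times> 'c) set \<Rightarrow> (nat \<times> nat \<times> 'c) set"
  where "std_arcs A T = relabel_arcs (pos_in A) (arcs_within A T)"

lemma arc_diagramsD:
  assumes "T \<in> arc_diagrams n C" "(i, j, c) \<in> T"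
  shows "i < j" "j < n" "c \<in> C"
    "(i, j', c') \<in> T \<Longrightarrow> j' = j \<and> c' = c" "(i', j, c') \<in> T \<Longrightarrow> i' = i \<and> c' = c"
  using assms(1)[unfolded arc_diagrams_def mem_Collect_eq, rule_format, OF assms(2)] by blast+

lemma arc_diagramsI:
  assumes "\<And>i j c. (i, j, c) \<in> T \<Longrightarrow> i < j \<and> j < n \<and> c \<in> C"
    and "\<And>i j c j' c'. (i, j, c) \<in> T \<Longrightarrow> (i, j', c') \<in> T \<Longrightarrow> j = j' \<and> c = c'"
    and "\<And>i j c i' c'. (i, j, c) \<in> T \<Longrightarrow> (i', j, c') \<in> T \<Longrightarrow> i = i' \<and> c = c'"
  shows "T \<in> arc_diagrams n C"
  unfolding arc_diagrams_def mem_Collect_eq using assms by metis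

lemma arc_diagrams_subset: "T \<in> arc_diagrams n C \<Longrightarrow> S \<subseteq> T \<Longrightarrow> S \<in> arc_diagrams n C"
  unfolding arc_diagrams_def mem_Collect_eq by (meson subsetD)

lemma arc_diagrams_empty [simp]: "{} \<in> arc_diagrams n C"
  by (simp add: arc_diagrams_def)

lemma arc_diagrams_0: "arc_diagrams 0 C = {{}}"
proof -
  have "T = {}" if "T \<in> arc_diagrams 0 C" for T
    using arc_diagramsD(2)[OF that] by fast
  then show ?thesis by auto
qed

lemma finite_arc_diagrams:
  assumes "finite C"
  shows "finite (arc_diagrams n C)"
proof (rule finite_subset)
  show "arc_diagrams n C \<subseteq> Pow ({..<n} \<times> {..<n} \<times> C)"
  proof (intro subsetI PowI)
    fix T t assume T: "T \<in> arc_diagrams n C" and "t \<in> T"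
    then show "t \<in> {..<n} \<times> {..<n} \<times> C"
      using arc_diagramsD(1-3)[OF T] less_trans by (cases t) blast
  qed
qed (use assms in simp)

lemma arc_diagrams_2: "arc_diagrams 2 C = insert {} ((\<lambda>c. {(0, 1, c)}) ` C)"
proof (intro equalityI subsetI)
  fix T assume T: "T \<in> arc_diagrams 2 C"
  have *: "i = 0 \<and> j = 1 \<and> c \<in> C" if "(i, j, c) \<in> T" for i j c
    using arc_diagramsD(1-3)[OF T that] by auto
  show "T \<in> insert {} ((\<lambda>c. {(0, 1, c)}) ` C)"
  proof (cases "T = {}")
    case False
    then obtain i j c where "(i, j, c) \<in> T" by fastforce
    then have "(0, 1, c) \<in> T" "c \<in> C" using * by blast+
    moreover have "t = (0, 1, c)" if "t \<in> T" for t
      using * that arc_diagramsD(4)[OF T \<open>(0, 1, c) \<in> T\<close>] by (cases t) blast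
    ultimately show ?thesis by blast
  qed simp
qed (auto intro!: arc_diagramsI)

lemma card_arc_diagrams_2: "finite C \<Longrightarrow> card (arc_diagrams 2 C) = 1 + card C"
proof -
  assume "finite C"
  have "inj_on (\<lambda>c. {(0::nat, 1::nat, c)}) C" by (auto simp: inj_on_def)
  then have "card ((\<lambda>c. {(0::nat, 1::nat, c)}) ` C) = card C" by (rule card_image)
  moreover have "{} \<notin> (\<lambda>c. {(0::nat, 1::nat, c)}) ` C" by blast
  ultimately show ?thesis using \<open>finite C\<close> unfolding arc_diagrams_2 by simp
qed

lemma mem_relabel_arcs:
  "(i, j, c) \<in> relabel_arcs \<eta> T \<longleftrightarrow> (\<exists>i' j'. (i', j', c) \<in> T \<and> i = \<eta> i' \<and> j = \<eta> j')"
  unfolding relabel_arcs_def by force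

lemma mem_recolour: "(i, j, d) \<in> recolour e T \<longleftrightarrow> (\<exists>c. (i, j, c) \<in> T \<and> d = e c)"
  unfolding recolour_def by force

lemma mem_arcs_within: "(i, j, c) \<in> arcs_within A T \<longleftrightarrow> (i, j, c) \<in> T \<and> i \<in> A \<and> j \<in> A"
  by (simp add: arcs_within_def)

lemma relabel_arcs_diagram:
  assumes T: "T \<in> arc_diagrams n C" and A: "\<And>i j c. (i, j, c) \<in> T \<Longrightarrow> i \<in> A \<and> j \<in> A"
    and \<eta>: "strict_mono_on A \<eta>" "\<eta> ` A \<subseteq> {..<p}"
  shows "relabel_arcs \<eta> T \<in> arc_diagrams p C"
proof -
  have inj: "\<eta> i = \<eta> j \<longleftrightarrow> i = j" if "i \<in> A" "j \<in> A" for i j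
    using strict_mono_on_imp_inj_on[OF \<eta>(1)] that by (auto dest: inj_onD)
  show ?thesis
  proof (rule arc_diagramsI, goal_cases)
    case (1 i j c)
    then obtain i' j' where "(i', j', c) \<in> T" "i = \<eta> i'" "j = \<eta> j'" unfolding mem_relabel_arcs by blast
    moreover from this have "\<eta> i' < \<eta> j'" "\<eta> j' \<in> {..<p}"
      using A arc_diagramsD(1)[OF T] \<eta> by (blast intro: strict_mono_onD)+
    ultimately show ?case using arc_diagramsD(3)[OF T] by simp
  next
    case (2 i j c j' c')
    then show ?case using A inj arc_diagramsD(4)[OF T] unfolding mem_relabel_arcs by metis
  next
    case (3 i j c i' c')
    then show ?case using A inj arc_diagramsD(5)[OF T] unfolding mem_relabel_arcs by metis
  qed
qed

lemma recolour_diagram: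
  assumes e: "inj_on e C" "e ` C \<subseteq> C'" and T: "T \<in> arc_diagrams n C"
  shows "recolour e T \<in> arc_diagrams n C'"
proof (rule arc_diagramsI, goal_cases)
  case (1 i j c')
  then show ?case using e(2) arc_diagramsD(1-3)[OF T] by (auto simp: mem_recolour)
next
  case (2 i j c' j' c'')
  then show ?case using arc_diagramsD(4)[OF T] unfolding mem_recolour by metis
next
  case (3 i j c' i' c'')
  then show ?case using arc_diagramsD(5)[OF T] unfolding mem_recolour by metis
qed

lemma bij_recolour:
  assumes e: "bij_betw e C C'"
  shows "bij_betw (recolour e) (arc_diagrams n C) (arc_diagrams n C')"
proof -
  let ?e' = "inv_into C e"
  have e': "bij_betw ?e' C' C" using e by (rule bij_betw_inv_into)
  have inverse: "recolour g (recolour f T) = T"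
    if "T \<in> arc_diagrams n X" "\<And>c. c \<in> X \<Longrightarrow> g (f c) = c" for f :: "'x \<Rightarrow> 'y" and g T X
    using arc_diagramsD(3)[OF that(1)] that(2) unfolding set_eq_iff split_paired_All mem_recolour
    by metis
  have 1: "recolour ?e' (recolour e T) = T" if "T \<in> arc_diagrams n C" for T
    using inverse[OF that] bij_betw_inv_into_left[OF e] by blast
  have 2: "recolour e (recolour ?e' T) = T" if "T \<in> arc_diagrams n C'" for T
    using inverse[OF that] bij_betw_inv_into_right[OF e] by blast
  show ?thesis
    by (rule bij_betwI[where g = "recolour ?e'"])
      (use 1 2 recolour_diagram[of e C C'] recolour_diagram[of ?e' C' C] e e' in
        \<open>auto simp: bij_betw_def\<close>)
qed

lemma strict_mono_pos_in: "finite A \<Longrightarrow> strict_mono_on A (pos_in A)"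
  unfolding pos_in_def by (intro strict_mono_onI psubset_card_mono) auto

lemma pos_in_less: "finite A \<Longrightarrow> i \<in> A \<Longrightarrow> pos_in A i < card A"
  unfolding pos_in_def by (intro psubset_card_mono) auto

lemma bij_pos_in: "finite A \<Longrightarrow> bij_betw (pos_in A) A {..<card A}"
proof -
  assume A: "finite A"
  have inj: "inj_on (pos_in A) A" using strict_mono_on_imp_inj_on[OF strict_mono_pos_in[OF A]] .
  have "pos_in A ` A \<subseteq> {..<card A}" using pos_in_less[OF A] by blast
  then have "pos_in A ` A = {..<card A}"
    by (intro card_subset_eq) (auto simp: card_image[OF inj])
  with inj show ?thesis by (simp add: bij_betw_def)
qed

lemma std_arcs_diagram:
  assumes "T \<in> arc_diagrams n C" "finite A"
  shows "std_arcs A T \<in> arc_diagrams (card A) C"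
  unfolding std_arcs_def
  by (rule relabel_arcs_diagram[where A = A, OF arc_diagrams_subset[OF assms(1)]])
    (use assms(2) in \<open>auto simp: arcs_within_def pos_in_less strict_mono_pos_in\<close>)

lemma shift_arcs_diagram:
  assumes "T \<in> arc_diagrams n C"
  shows "relabel_arcs (\<lambda>i. i + m) T \<in> arc_diagrams (m + n) C"
  by (rule relabel_arcs_diagram[where A = "{..<n}", OF assms])
    (use arc_diagramsD(1,2)[OF assms] in \<open>force intro!: strict_mono_onI\<close>)+

lemma juxtapose_diagram:
  assumes S: "S \<in> arc_diagrams m C" and T: "T \<in> arc_diagrams n C"
  shows "S \<union> relabel_arcs (\<lambda>i. i + m) T \<in> arc_diagrams (m + n) C"
proof (rule arc_diagramsI, goal_cases)
  case (1 i j c)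
  then show ?case
  proof
    assume "(i, j, c) \<in> S"
    then show ?thesis using arc_diagramsD(1-3)[OF S] by (simp add: trans_less_add1)
  next
    assume "(i, j, c) \<in> relabel_arcs (\<lambda>i. i + m) T"
    then show ?thesis
      using arc_diagramsD(1-3)[OF shift_arcs_diagram[OF T, of m]] by blast
  qed
next
  case (2 i j c j' c')
  have "i < m" if "(i, j, c) \<in> S" for j c using arc_diagramsD(1,2)[OF S that] by simp
  with 2 show ?case using arc_diagramsD(4)[OF S] arc_diagramsD(4)[OF T]
    unfolding Un_iff mem_relabel_arcs by (metis add_right_cancel not_add_less2)
next
  case (3 i j c i' c')
  have "j < m" if "(i, j, c) \<in> S" for i c using arc_diagramsD(2)[OF S that] .
  with 3 show ?case using arc_diagramsD(5)[OF S] arc_diagramsD(5)[OF T]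
    unfolding Un_iff mem_relabel_arcs by (metis add_right_cancel not_add_less2)
qed

lemma splits_recolour: "splits A (recolour e T) \<longleftrightarrow> splits A T"
  unfolding splits_def mem_recolour by blast

lemma relabel_arcs_recolour: "relabel_arcs \<eta> (recolour e T) = recolour e (relabel_arcs \<eta> T)"
  by (simp add: relabel_arcs_def recolour_def image_image case_prod_beta)

lemma std_arcs_recolour: "std_arcs A (recolour e T) = recolour e (std_arcs A T)"
proof -
  have "arcs_within A (recolour e T) = recolour e (arcs_within A T)"
    unfolding recolour_def arcs_within_def by force
  then show ?thesis by (simp add: std_arcs_def relabel_arcs_recolour)
qed

lemma recolour_Un: "recolour e (S \<union> T) = recolour e S \<union> recolour e T"
  by (simp add: recolour_def image_Un)

section \<open>Hopf algebras with a basis of arc diagrams\<close>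

(* Vectors are functions here, and unification leaves them eta-expanded.  With pointwise simp rules
   for 0 and +, an eta-expanded zero vector would be rewritten to a constant abstraction, on which
   the linear algebra lemmas no longer match. *)
declare zero_fun_apply [simp del] plus_fun_apply [simp del]

text \<open>
  In a vanishing linear combination the part that belongs to \<open>B n\<close> lies in \<open>V n\<close>, so all these parts
  vanish separately.
\<close>

lemma independent_Union_direct:
  fixes V :: "nat \<Rightarrow> ('x \<Rightarrow> 'k::field) set"
  assumes V: "\<And>n. fun_vs.subspace (V n)" and B: "\<And>n. B n \<subseteq> V n" "\<And>n. fun_vs.independent (B n)"
    and direct: "\<And>F N i. (\<And>n. F n \<in> V n) \<Longrightarrow> (\<Sum>n<N. F n) = 0 \<Longrightarrow> i < N \<Longrightarrow> F i = 0"
  shows "fun_vs.independent (\<Union>n. B n)" "disjoint_family B"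
proof -
  show disj: "disjoint_family B"
  proof (rule ccontr)
    assume "\<not> disjoint_family B"
    then obtain m n v where mn: "m \<noteq> n" "v \<in> B m" "v \<in> B n"
      unfolding disjoint_family_on_def by blast
    define F where "F = (\<lambda>i. if i = m then v else if i = n then - v else 0)"
    have "F i \<in> V i" for i
      using mn B(1) V[of i] fun_vs.subspace_neg[OF V[of n]] fun_vs.subspace_0[OF V[of i]]
      by (auto simp: F_def)
    moreover have "(\<Sum>i<Suc (max m n). F i) = (\<Sum>i\<in>{m, n}. F i)"
      by (rule sum.mono_neutral_right) (auto simp: F_def)
    then have "(\<Sum>i<Suc (max m n). F i) = 0" using mn by (simp add: F_def)
    ultimately have "F m = 0" using direct[of F "Suc (max m n)" m] by simp
    then have "v = 0" by (simp add: F_def)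
    with mn(2) have "0 \<in> B m" by simp
    then show False using B(2)[of m] fun_vs.dependent_zero by blast
  qed
  show "fun_vs.independent (\<Union>n. B n)"
    unfolding fun_vs.independent_explicit_finite_subsets
  proof (intro allI impI ballI)
    fix S u w assume S: "S \<subseteq> (\<Union>n. B n)" "finite S" "(\<Sum>v\<in>S. u v *\<^sub>f v) = 0" and w: "w \<in> S"
    define F where "F = (\<lambda>n. \<Sum>v\<in>S \<inter> B n. u v *\<^sub>f v)"
    have FV: "F n \<in> V n" for n
      unfolding F_def using B(1)[of n] by (intro fun_vs.subspace_sum fun_vs.subspace_scale V) blast
    obtain d where d: "\<And>v. v \<in> S \<Longrightarrow> v \<in> B (d v)" using S(1) by (metis UN_E subsetD)
    define N where "N = Suc (Max (d ` S))"
    have dN: "d v < N" if "v \<in> S" for v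
      unfolding N_def using that S(2) by (simp add: le_imp_less_Suc)
    have "(\<Sum>n<N. F n) = (\<Sum>v\<in>(\<Union>n<N. S \<inter> B n). u v *\<^sub>f v)"
      unfolding F_def using disj S(2)
      by (intro sum.UNION_disjoint[symmetric]) (auto simp: disjoint_family_on_def)
    also have "(\<Union>n<N. S \<inter> B n) = S" using d dN by blast
    finally have "(\<Sum>n<N. F n) = 0" using S(3) by simp
    then have "F (d w) = 0" using direct[of F, OF FV] dN[OF w] by blast
    then have "(\<Sum>v\<in>S \<inter> B (d w). u v *\<^sub>f v) = 0" by (simp add: F_def)
    then show "u w = 0"
      using fun_vs.independentD[OF B(2)[of "d w"], of "S \<inter> B (d w)" u w] w d S(2) by blast
  qed
qed

text \<open>
  A graded Hopf algebra whose structure constants in the basis \<open>P\<close> are those of juxtaposition and of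
  the distribution of blocks over a set and its complement.  The linearity assumptions are restricted
  to \<open>hspace H\<close>, outside of which the operations of a \<open>graded_hopf\<close> are arbitrary.
\<close>

locale diagram_hopf_algebra =
  fixes H :: "('x, 'k::field) graded_hopf" and C :: "'c set"
    and P :: "nat \<Rightarrow> (nat \<times> nat \<times> 'c) set \<Rightarrow> 'x \<Rightarrow> 'k"
  assumes basis_inj: "\<And>n. inj_on (P n) (arc_diagrams n C)"
    and basis_independent: "\<And>n. fun_vs.independent (P n ` arc_diagrams n C)"
    and basis_span: "\<And>n. fun_vs.span (P n ` arc_diagrams n C) = hcomp H n"
    and comp_direct: "\<And>F N i. (\<And>n. F n \<in> hcomp H n) \<Longrightarrow> (\<Sum>n<N. F n) = 0 \<Longrightarrow> i < N \<Longrightarrow> F i = 0"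
    and prod_basis: "\<And>m n S T. S \<in> arc_diagrams m C \<Longrightarrow> T \<in> arc_diagrams n C \<Longrightarrow>
          hprod H (P m S) (P n T) = P (m + n) (S \<union> relabel_arcs (\<lambda>i. i + m) T)"
    and coprod_basis: "\<And>n T. T \<in> arc_diagrams n C \<Longrightarrow> hcoprod H (P n T) =
          (\<Sum>A | A \<subseteq> {..<n} \<and> splits A T.
            P (card A) (std_arcs A T) \<boxtimes> P (card ({..<n} - A)) (std_arcs ({..<n} - A) T))"
    and one_basis: "hone H = P 0 {}"
    and counit_basis: "\<And>n T. T \<in> arc_diagrams n C \<Longrightarrow> hcounit H (P n T) = (if n = 0 then 1 else 0)"
    and prod_add_left: "\<And>f g h. f \<in> hspace H \<Longrightarrow> g \<in> hspace H \<Longrightarrow> h \<in> hspace H \<Longrightarrow>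
          hprod H (f + g) h = hprod H f h + hprod H g h"
    and prod_add_right: "\<And>f g h. f \<in> hspace H \<Longrightarrow> g \<in> hspace H \<Longrightarrow> h \<in> hspace H \<Longrightarrow>
          hprod H f (g + h) = hprod H f g + hprod H f h"
    and prod_scale_left: "\<And>c f g. f \<in> hspace H \<Longrightarrow> g \<in> hspace H \<Longrightarrow>
          hprod H (c *\<^sub>f f) g = c *\<^sub>f hprod H f g"
    and prod_scale_right: "\<And>c f g. f \<in> hspace H \<Longrightarrow> g \<in> hspace H \<Longrightarrow>
          hprod H f (c *\<^sub>f g) = c *\<^sub>f hprod H f g"
    and coprod_add: "\<And>f g. f \<in> hspace H \<Longrightarrow> g \<in> hspace H \<Longrightarrow>
          hcoprod H (f + g) = hcoprod H f + hcoprod H g"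
    and coprod_scale: "\<And>c f. f \<in> hspace H \<Longrightarrow> hcoprod H (c *\<^sub>f f) = c *\<^sub>f hcoprod H f"
    and counit_add: "\<And>f g. f \<in> hspace H \<Longrightarrow> g \<in> hspace H \<Longrightarrow>
          hcounit H (f + g) = hcounit H f + hcounit H g"
    and counit_scale: "\<And>c f. f \<in> hspace H \<Longrightarrow> hcounit H (c *\<^sub>f f) = c * hcounit H f"
begin

definition basis :: "('x \<Rightarrow> 'k) set"
  where "basis = (\<Union>n. P n ` arc_diagrams n C)"

lemma subspace_comp: "fun_vs.subspace (hcomp H n)"
  unfolding basis_span[symmetric] by simp

lemma basis_in_comp: "T \<in> arc_diagrams n C \<Longrightarrow> P n T \<in> hcomp H n"
  unfolding basis_span[symmetric] by (simp add: fun_vs.span_base)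

lemma independent_basis: "fun_vs.independent basis"
  and disjoint_basis: "disjoint_family (\<lambda>n. P n ` arc_diagrams n C)"
proof -
  have sub: "P n ` arc_diagrams n C \<subseteq> hcomp H n" for n using basis_in_comp by blast
  show "fun_vs.independent basis" unfolding basis_def
  proof (rule independent_Union_direct(1)[where V = "hcomp H"])
    fix F :: "nat \<Rightarrow> 'x \<Rightarrow> 'k" and N i
    assume "\<And>n. F n \<in> hcomp H n" "(\<Sum>n<N. F n) = 0" "i < N"
    then show "F i = 0" by (rule comp_direct)
  qed (rule subspace_comp sub basis_independent)+
  show "disjoint_family (\<lambda>n. P n ` arc_diagrams n C)"
  proof (rule independent_Union_direct(2)[where V = "hcomp H"])
    fix F :: "nat \<Rightarrow> 'x \<Rightarrow> 'k" and N i
    assume "\<And>n. F n \<in> hcomp H n" "(\<Sum>n<N. F n) = 0" "i < N"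
    then show "F i = 0" by (rule comp_direct)
  qed (rule subspace_comp sub basis_independent)+
qed

lemma span_basis: "fun_vs.span basis = hspace H"
proof (rule antisym)
  show "fun_vs.span basis \<subseteq> hspace H"
    unfolding hspace_def basis_def using basis_in_comp by (intro fun_vs.span_mono) blast
  have "hcomp H n \<subseteq> fun_vs.span basis" for n
    unfolding basis_span[symmetric] basis_def by (intro fun_vs.span_mono) blast
  then show "hspace H \<subseteq> fun_vs.span basis"
    unfolding hspace_def by (intro fun_vs.span_minimal) auto
qed

lemma subspace_hspace: "fun_vs.subspace (hspace H)"
  unfolding hspace_def by simp

lemma basis_in_hspace: "T \<in> arc_diagrams n C \<Longrightarrow> P n T \<in> hspace H"
  unfolding span_basis[symmetric] basis_def by (intro fun_vs.span_base) blast

lemma hspace_induct [consumes 1, case_names zero step]: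
  assumes "f \<in> hspace H" and "Q 0"
    and "\<And>c n T f. T \<in> arc_diagrams n C \<Longrightarrow> f \<in> hspace H \<Longrightarrow> Q f \<Longrightarrow> Q (c *\<^sub>f P n T + f)"
  shows "Q f"
proof -
  have "f \<in> fun_vs.span basis" using assms(1) by (simp add: span_basis)
  then have "f \<in> hspace H \<and> Q f"
  proof (induction rule: fun_vs.span_induct_alt)
    case base
    then show ?case using assms(2) fun_vs.subspace_0[OF subspace_hspace] by simp
  next
    case (step c x y)
    then obtain n T where "T \<in> arc_diagrams n C" "x = P n T" by (auto simp: basis_def)
    with step assms(3) basis_in_hspace show ?case
      by (auto intro!: fun_vs.subspace_add fun_vs.subspace_scale subspace_hspace)
  qed
  then show ?thesis by simp
qed

lemma zero_in_hspace: "0 \<in> hspace H" by (rule fun_vs.subspace_0[OF subspace_hspace])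

lemma hspace_add: "f \<in> hspace H \<Longrightarrow> g \<in> hspace H \<Longrightarrow> f + g \<in> hspace H"
  by (rule fun_vs.subspace_add[OF subspace_hspace])

lemma hspace_scale: "f \<in> hspace H \<Longrightarrow> c *\<^sub>f f \<in> hspace H"
  by (rule fun_vs.subspace_scale[OF subspace_hspace])

lemma prod_zero: assumes "f \<in> hspace H" shows "hprod H 0 f = 0" "hprod H f 0 = 0"
  using prod_scale_left[OF zero_in_hspace assms, of 0] prod_scale_right[OF assms zero_in_hspace, of 0]
  by simp_all

lemma coprod_zero: "hcoprod H 0 = 0"
  using coprod_scale[OF zero_in_hspace, of 0] by simp

lemma counit_zero: "hcounit H 0 = 0"
  using counit_scale[OF zero_in_hspace, of 0] by simp

lemma prod_in_hspace:
  assumes "f \<in> hspace H" "g \<in> hspace H" shows "hprod H f g \<in> hspace H"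
  using assms(1)
proof (induction rule: hspace_induct)
  case zero
  show ?case by (simp add: prod_zero assms zero_in_hspace)
next
  case (step c m S f)
  have "hprod H (P m S) g \<in> hspace H"
    using assms(2)
  proof (induction rule: hspace_induct)
    case zero
    show ?case by (simp add: prod_zero step basis_in_hspace zero_in_hspace)
  next
    case (step d n T g)
    then show ?case using \<open>S \<in> arc_diagrams m C\<close>
      by (simp add: prod_add_right prod_scale_right prod_basis basis_in_hspace hspace_add hspace_scale
          juxtapose_diagram)
  qed
  then show ?case using step assms(2)
    by (simp add: prod_add_left prod_scale_left basis_in_hspace hspace_add hspace_scale)
qed

text \<open>
  Juxtaposition and distribution of blocks do not look at the colours.
\<close>

lemma recoloured:
  assumes e: "bij_betw e C' C"
  shows "diagram_hopf_algebra H C' (\<lambda>n T. P n (recolour e T))"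
proof -
  have im: "recolour e ` arc_diagrams n C' = arc_diagrams n C" for n
    using bij_recolour[OF e] by (simp add: bij_betw_def)
  have P_im: "(\<lambda>T. P n (recolour e T)) ` arc_diagrams n C' = P n ` arc_diagrams n C" for n
    by (simp add: image_image[symmetric] im)
  have mem: "T \<in> arc_diagrams n C' \<Longrightarrow> recolour e T \<in> arc_diagrams n C" for n T
    using im by blast
  have inj: "inj_on (\<lambda>T. P n (recolour e T)) (arc_diagrams n C')" for n
    using comp_inj_on[of "recolour e" "arc_diagrams n C'" "P n"] bij_recolour[OF e, of n] basis_inj[of n]
    by (simp add: bij_betw_def comp_def)
  show ?thesis
  proof unfold_locales
    fix m n S T assume S: "S \<in> arc_diagrams m C'" and T: "T \<in> arc_diagrams n C'"
    show "hprod H (P m (recolour e S)) (P n (recolour e T)) =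
      P (m + n) (recolour e (S \<union> relabel_arcs (\<lambda>i. i + m) T))"
      unfolding recolour_Un relabel_arcs_recolour[symmetric] by (rule prod_basis[OF mem[OF S] mem[OF T]])
  next
    fix n T assume T: "T \<in> arc_diagrams n C'"
    show "hcoprod H (P n (recolour e T)) = (\<Sum>A | A \<subseteq> {..<n} \<and> splits A T.
        P (card A) (recolour e (std_arcs A T)) \<boxtimes>
        P (card ({..<n} - A)) (recolour e (std_arcs ({..<n} - A) T)))"
      using coprod_basis[OF mem[OF T]] unfolding splits_recolour std_arcs_recolour .
    show "hcounit H (P n (recolour e T)) = (if n = 0 then 1 else 0)"
      by (rule counit_basis[OF mem[OF T]])
  next
    fix F :: "nat \<Rightarrow> 'x \<Rightarrow> 'k" and N i
    assume "\<And>n. F n \<in> hcomp H n" "(\<Sum>n<N. F n) = 0" "i < N"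
    then show "F i = 0" by (rule comp_direct)
  next
    show "hone H = P 0 (recolour e {})" by (simp add: one_basis recolour_def)
  qed (unfold P_im, (rule inj basis_independent basis_span prod_add_left prod_add_right
        prod_scale_left prod_scale_right coprod_add coprod_scale counit_add counit_scale; assumption)+)
qed

end

lemma tens_scale_left: "(c *\<^sub>f f) \<boxtimes> h = c *\<^sub>f (f \<boxtimes> h)"
  by (auto simp: tens_def fscale_def fun_eq_iff algebra_simps)

lemma scale_sum_tens:
  "c *\<^sub>f (\<Sum>(a, b)\<leftarrow>ps. a \<boxtimes> b) = (\<Sum>(a, b)\<leftarrow>map (\<lambda>(a, b). (c *\<^sub>f a, b)) ps. a \<boxtimes> b)"
  by (induction ps) (auto simp: tens_scale_left fun_vs.scale_right_distrib)

lemma vector_space_pair_fun: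
  "vector_space_pair (fscale :: 'k::field \<Rightarrow> ('x \<Rightarrow> 'k) \<Rightarrow> _) (fscale :: 'k \<Rightarrow> ('y \<Rightarrow> 'k) \<Rightarrow> _)"
  by unfold_locales

text \<open>
  The linear map that matches the two bases respects products, coproducts, unit and counit on basis
  elements, because the structure constants are the same; both sides are (bi)linear.
\<close>

theorem diagram_hopf_algebras_isomorphic:
  fixes H :: "('x, 'k::field) graded_hopf" and H' :: "('y, 'k) graded_hopf" and C :: "'c set"
  assumes "diagram_hopf_algebra H C P" "diagram_hopf_algebra H' C P'"
  shows "graded_hopf_isomorphic H H'"
proof -
  interpret A: diagram_hopf_algebra H C P by fact
  interpret B: diagram_hopf_algebra H' C P' by fact
  define I where "I = (SIGMA n:UNIV. arc_diagrams n C)"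
  have inj: "inj_on (\<lambda>(n, T). P n T) I"
    using A.basis_inj A.disjoint_basis unfolding I_def inj_on_def disjoint_family_on_def by fast
  have inj': "inj_on (\<lambda>(n, T). P' n T) I"
    using B.basis_inj B.disjoint_basis unfolding I_def inj_on_def disjoint_family_on_def by fast
  have im: "(\<lambda>(n, T). P n T) ` I = A.basis" "(\<lambda>(n, T). P' n T) ` I = B.basis"
    unfolding I_def A.basis_def B.basis_def by force+
  \<comment> \<open>the index of a basis vector is recovered by inverting the injective enumeration of the basis\<close>
  define \<phi> where "\<phi> = vector_space_pair.construct fscale fscale A.basis (\<lambda>v. case inv_into I (\<lambda>(n, T). P n T) v of (n, T) \<Rightarrow> P' n T)"
  have lin: "Vector_Spaces.linear fscale fscale \<phi>"
    unfolding \<phi>_def by (rule vector_space_pair.linear_construct[OF vector_space_pair_fun A.independent_basis])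
  then interpret \<phi>: Vector_Spaces.linear fscale fscale \<phi> .
  have \<phi>P: "\<phi> (P n T) = P' n T" if "T \<in> arc_diagrams n C" for n T
  proof -
    have mem: "(n, T) \<in> I" using that by (simp add: I_def)
    then have "P n T \<in> A.basis" using im(1) by force
    then show ?thesis
      unfolding \<phi>_def using inv_into_f_f[OF inj mem]
      by (simp add: vector_space_pair.construct_basis[OF vector_space_pair_fun A.independent_basis])
  qed
  have \<phi>_im: "\<phi> ` A.basis = B.basis"
    unfolding A.basis_def B.basis_def image_UN image_image by (simp add: \<phi>P)
  have \<phi>_inj: "inj_on \<phi> A.basis"
  proof (rule inj_onI)
    fix v w assume "v \<in> A.basis" "w \<in> A.basis" and eq: "\<phi> v = \<phi> w"
    then obtain i j where ij: "i \<in> I" "v = (\<lambda>(n, T). P n T) i" "j \<in> I" "w = (\<lambda>(n, T). P n T) j"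
      unfolding im(1)[symmetric] by blast
    with eq \<phi>P have "(\<lambda>(n, T). P' n T) i = (\<lambda>(n, T). P' n T) j" by (auto simp: I_def)
    then show "v = w" using inj_onD[OF inj' _ ij(1,3)] ij by simp
  qed
  have bij: "bij_betw \<phi> (hspace H) (hspace H')"
    unfolding A.span_basis[symmetric] B.span_basis[symmetric] bij_betw_def
    using \<phi>.inj_on_span_independent_image[of A.basis] B.independent_basis \<phi>_im \<phi>_inj
      \<phi>.span_image[of A.basis] by simp
  have comp: "\<phi> ` hcomp H n = hcomp H' n" for n
    unfolding A.basis_span[symmetric] B.basis_span[symmetric] \<phi>.span_image[symmetric] image_image
    by (simp add: \<phi>P)
  have \<phi>H: "\<phi> f \<in> hspace H'" if "f \<in> hspace H" for f
    using bij that by (auto simp: bij_betw_def)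
  note simps = \<phi>.add \<phi>.scale \<phi>P A.basis_in_hspace B.basis_in_hspace A.hspace_add A.hspace_scale
    B.hspace_add B.hspace_scale \<phi>H A.prod_in_hspace B.prod_in_hspace
  have prod_basis: "\<phi> (hprod H (P m S) g) = hprod H' (P' m S) (\<phi> g)"
    if S: "S \<in> arc_diagrams m C" and g: "g \<in> hspace H" for m S g
    using g
  proof (induction rule: A.hspace_induct)
    case zero
    show ?case using S by (simp add: A.prod_zero B.prod_zero simps)
  next
    case (step c n T g)
    then show ?case using S
      by (simp add: A.prod_add_right B.prod_add_right A.prod_scale_right B.prod_scale_right
          simps A.prod_basis B.prod_basis juxtapose_diagram)
  qed
  have prod: "\<phi> (hprod H f g) = hprod H' (\<phi> f) (\<phi> g)" if f: "f \<in> hspace H" and g: "g \<in> hspace H" for f g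
    using f
  proof (induction rule: A.hspace_induct)
    case zero
    show ?case using g by (simp add: A.prod_zero B.prod_zero simps)
  next
    case (step c n T f)
    then show ?case using g
      by (simp add: A.prod_add_left B.prod_add_left A.prod_scale_left B.prod_scale_left
          simps prod_basis)
  qed
  have counit: "hcounit H' (\<phi> f) = hcounit H f" if "f \<in> hspace H" for f
    using that
  proof (induction rule: A.hspace_induct)
    case zero
    show ?case by (simp add: A.counit_zero B.counit_zero)
  next
    case (step c n T f)
    then show ?case
      by (simp add: A.counit_add B.counit_add A.counit_scale B.counit_scale simps A.counit_basis B.counit_basis)
  qed
  have coprod: "\<exists>ps. sweedler H f ps \<and> hcoprod H' (\<phi> f) = (\<Sum>(a, b)\<leftarrow>ps. \<phi> a \<boxtimes> \<phi> b)"
    if "f \<in> hspace H" for f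
    using that
  proof (induction rule: A.hspace_induct)
    case zero
    show ?case by (rule exI[of _ "[]"]) (simp add: sweedler_def A.coprod_zero B.coprod_zero)
  next
    case (step c n T f)
    then obtain qs where qs: "sweedler H f qs" "hcoprod H' (\<phi> f) = (\<Sum>(a, b)\<leftarrow>qs. \<phi> a \<boxtimes> \<phi> b)" by blast
    let ?\<A> = "{A. A \<subseteq> {..<n} \<and> splits A T}"
    have "finite ?\<A>" by (rule finite_subset[of _ "Pow {..<n}"]) auto
    then obtain As where As: "set As = ?\<A>" "distinct As" using finite_distinct_list by blast
    define ps where "ps = map (\<lambda>A. (P (card A) (std_arcs A T),
      P (card ({..<n} - A)) (std_arcs ({..<n} - A) T))) As"
    define rs where "rs = map (\<lambda>(a, b). (c *\<^sub>f a, b)) ps @ qs"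
    have std: "std_arcs A T \<in> arc_diagrams (card A) C" if "A \<subseteq> {..<n}" for A
      using std_arcs_diagram[OF step(1)] that finite_subset by blast
    have ps_hspace: "set ps \<subseteq> hspace H \<times> hspace H"
      unfolding ps_def using As(1) std by (auto intro!: A.basis_in_hspace)
    have 1: "hcoprod H (P n T) = (\<Sum>(a, b)\<leftarrow>ps. a \<boxtimes> b)"
      unfolding ps_def A.coprod_basis[OF step(1)] As(1)[symmetric]
      by (simp add: sum.distinct_set_conv_list[OF As(2)] comp_def)
    have 2: "hcoprod H' (P' n T) = (\<Sum>(a, b)\<leftarrow>ps. \<phi> a \<boxtimes> \<phi> b)"
    proof -
      have "hcoprod H' (P' n T) = (\<Sum>A\<leftarrow>As. P' (card A) (std_arcs A T) \<boxtimes>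
          P' (card ({..<n} - A)) (std_arcs ({..<n} - A) T))"
        unfolding B.coprod_basis[OF step(1)] As(1)[symmetric]
        by (simp add: sum.distinct_set_conv_list[OF As(2)])
      also have "\<dots> = (\<Sum>(a, b)\<leftarrow>ps. \<phi> a \<boxtimes> \<phi> b)"
        unfolding ps_def map_map using As(1) std
        by (intro arg_cong[of _ _ sum_list] map_cong) (auto simp: \<phi>P)
      finally show ?thesis .
    qed
    have "sweedler H (c *\<^sub>f P n T + f) rs"
      using qs(1) ps_hspace step(1,2) unfolding sweedler_def rs_def
      by (auto simp: A.coprod_add A.coprod_scale simps 1 scale_sum_tens)
    moreover have "hcoprod H' (\<phi> (c *\<^sub>f P n T + f)) = c *\<^sub>f (\<Sum>(a, b)\<leftarrow>ps. \<phi> a \<boxtimes> \<phi> b) + (\<Sum>(a, b)\<leftarrow>qs. \<phi> a \<boxtimes> \<phi> b)"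
      using step(1,2) by (simp add: B.coprod_add B.coprod_scale simps 2 qs(2))
    moreover have "c *\<^sub>f (\<Sum>(a, b)\<leftarrow>ps. \<phi> a \<boxtimes> \<phi> b) = (\<Sum>(a, b)\<leftarrow>map (\<lambda>(a, b). (c *\<^sub>f a, b)) ps. \<phi> a \<boxtimes> \<phi> b)"
      by (induction ps) (auto simp: tens_scale_left fun_vs.scale_right_distrib \<phi>.scale)
    ultimately show ?case by (intro exI[of _ rs]) (simp add: rs_def)
  qed
  have "\<phi> (hone H) = hone H'" by (simp add: A.one_basis B.one_basis \<phi>P)
  with bij comp prod counit coprod have "graded_hopf_iso H H' \<phi>"
    unfolding graded_hopf_iso_def by (simp add: \<phi>.add \<phi>.scale)
  then show ?thesis unfolding graded_hopf_isomorphic_def by blast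
qed

text \<open>
  The diagrams of size \<open>2\<close> are the empty one and one single arc for each colour, so the dimension of
  the component of degree \<open>2\<close> determines the number of colours.
\<close>

theorem isomorphic_diagram_hopf_algebras_card:
  fixes H :: "('x, 'k::field) graded_hopf" and H' :: "('y, 'k) graded_hopf"
    and C :: "'c set" and C' :: "'d set"
  assumes "diagram_hopf_algebra H C P" "diagram_hopf_algebra H' C' P'"
    and "finite C" "finite C'" and "graded_hopf_isomorphic H H'"
  shows "card C = card C'"
proof -
  interpret A: diagram_hopf_algebra H C P by fact
  interpret B: diagram_hopf_algebra H' C' P' by fact
  obtain \<phi> where \<phi>: "graded_hopf_iso H H' \<phi>" using assms(5) unfolding graded_hopf_isomorphic_def ..
  let ?B = "P 2 ` arc_diagrams 2 C" and ?B' = "P' 2 ` arc_diagrams 2 C'"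
  have sub: "hcomp H 2 \<subseteq> hspace H" unfolding hspace_def by (meson UN_upper UNIV_I fun_vs.span_superset subset_trans)
  have add: "\<phi> (f + g) = \<phi> f + \<phi> g" if "f \<in> hspace H" "g \<in> hspace H" for f g
    using \<phi> that unfolding graded_hopf_iso_def by blast
  have scale: "\<phi> (c *\<^sub>f f) = c *\<^sub>f \<phi> f" if "f \<in> hspace H" for c f
    using \<phi> that unfolding graded_hopf_iso_def by blast
  \<comment> \<open>\<open>\<phi>\<close> is linear only on \<open>hspace H\<close>; dimensions are compared through an everywhere linear map that agrees with \<open>\<phi>\<close> in degree \<open>2\<close>\<close>
  define \<psi> where "\<psi> = vector_space_pair.construct fscale fscale ?B \<phi>"
  have lin: "Vector_Spaces.linear fscale fscale \<psi>"
    unfolding \<psi>_def by (rule vector_space_pair.linear_construct[OF vector_space_pair_fun A.basis_independent])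
  then interpret \<psi>: Vector_Spaces.linear fscale fscale \<psi> .
  have eq: "\<psi> f = \<phi> f" if "f \<in> hcomp H 2" for f
  proof -
    have "f \<in> fun_vs.span ?B" using that by (simp add: A.basis_span)
    then have "f \<in> hspace H \<and> \<psi> f = \<phi> f"
    proof (induction rule: fun_vs.span_induct_alt)
      case base
      show ?case using A.zero_in_hspace scale[of 0 0] by simp
    next
      case (step c x y)
      have "\<psi> x = \<phi> x" unfolding \<psi>_def using step(1) by (rule vector_space_pair.construct_basis[OF vector_space_pair_fun A.basis_independent])
      moreover have "x \<in> hspace H" using step(1) A.basis_in_hspace by blast
      ultimately show ?case
        using step by (simp add: \<psi>.add \<psi>.scale add scale A.hspace_add A.hspace_scale)
    qed
    then show ?thesis ..
  qed
  have im: "\<psi> ` hcomp H 2 = hcomp H' 2" using \<phi> eq unfolding graded_hopf_iso_def by auto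
  have "inj_on \<phi> (hcomp H 2)"
    using \<phi> sub unfolding graded_hopf_iso_def bij_betw_def by (blast intro: inj_on_subset)
  then have inj: "inj_on \<psi> (fun_vs.span ?B)"
    unfolding A.basis_span using eq by (simp add: inj_on_cong[of "hcomp H 2" \<psi> \<phi>])
  have "fun_vs.independent (\<psi> ` ?B)"
    by (rule \<psi>.independent_injective_image[OF A.basis_independent inj])
  moreover have "fun_vs.span (\<psi> ` ?B) = fun_vs.span (hcomp H' 2)"
    unfolding \<psi>.span_image A.basis_span im by (rule fun_vs.span_eq_iff[THEN iffD2, OF B.subspace_comp, symmetric])
  ultimately have "fun_vs.dim (hcomp H' 2) = card (\<psi> ` ?B)" by (rule fun_vs.dim_eq_card[rotated])
  also have "\<dots> = card ?B"
    by (rule card_image[OF inj_on_subset[OF inj fun_vs.span_superset]])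
  finally have "fun_vs.dim (hcomp H' 2) = card ?B" .
  moreover have "fun_vs.dim (hcomp H' 2) = card ?B'"
    using fun_vs.dim_span_eq_card_independent[OF B.basis_independent[of 2]] by (simp add: B.basis_span)
  moreover have "card ?B = 1 + card C"
    using A.basis_inj[of 2] by (simp add: card_image card_arc_diagrams_2 assms(3))
  moreover have "card ?B' = 1 + card C'"
    using B.basis_inj[of 2] by (simp add: card_image card_arc_diagrams_2 assms(4))
  ultimately show ?thesis by simp
qed

theorem diagram_hopf_algebras_isomorphic_iff:
  fixes H :: "('x, 'k::field) graded_hopf" and H' :: "('y, 'k) graded_hopf"
    and C :: "'c set" and C' :: "'d set"
  assumes H: "diagram_hopf_algebra H C P" "diagram_hopf_algebra H' C' P'"
    and C: "finite C" "finite C'"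
  shows "graded_hopf_isomorphic H H' \<longleftrightarrow> card C = card C'"
proof
  assume "card C = card C'"
  then obtain e where "bij_betw e C' C" using C finite_same_card_bij by metis
  from diagram_hopf_algebra.recoloured[OF H(1) this] H(2)
  show "graded_hopf_isomorphic H H'" by (rule diagram_hopf_algebras_isomorphic)
qed (rule isomorphic_diagram_hopf_algebras_card[OF assms])

section \<open>Unitriangular equivalence of strictly upper triangular matrices\<close>

definition strictly_upper :: "nat \<Rightarrow> 'f::field mat set"
  where "strictly_upper n = {x \<in> carrier_mat n n. \<forall>i<n. \<forall>j\<le>i. x $$ (i, j) = 0}"

text \<open>
  For \<open>x = u - 1\<close> and \<open>y = v - 1\<close> this is the relation \<open>v = 1 + g (u - 1) h\<^sup>-\<^sup>1\<close> that defines
  superclasses, written without inverses.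
\<close>

definition unitri_equiv :: "nat \<Rightarrow> 'f::field mat \<Rightarrow> 'f mat \<Rightarrow> bool"
  where "unitri_equiv n x y \<longleftrightarrow> (\<exists>g\<in>USL n. \<exists>h\<in>USL n. g * x = y * h)"

lemma USL_I:
  assumes "g \<in> carrier_mat n n" "\<And>i j. j < i \<Longrightarrow> i < n \<Longrightarrow> g $$ (i, j) = 0" "\<And>i. i < n \<Longrightarrow> g $$ (i, i) = 1"
  shows "g \<in> USL n"
  using assms unfolding USL_def by auto

lemma USL_D:
  assumes "g \<in> USL n"
  shows "g \<in> carrier_mat n n" "j < i \<Longrightarrow> i < n \<Longrightarrow> g $$ (i, j) = 0" "i < n \<Longrightarrow> g $$ (i, i) = 1"
  using assms unfolding USL_def by auto

lemma strictly_upper_I: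
  assumes "x \<in> carrier_mat n n" "\<And>i j. j \<le> i \<Longrightarrow> i < n \<Longrightarrow> x $$ (i, j) = 0"
  shows "x \<in> strictly_upper n"
  using assms unfolding strictly_upper_def by auto

lemma strictly_upper_D:
  assumes "x \<in> strictly_upper n"
  shows "x \<in> carrier_mat n n" "j \<le> i \<Longrightarrow> i < n \<Longrightarrow> x $$ (i, j) = 0"
  using assms unfolding strictly_upper_def by auto

lemma mult_entry:
  assumes "A \<in> carrier_mat n n" "B \<in> carrier_mat n n" "i < n" "j < n"
  shows "(A * B) $$ (i, j) = (\<Sum>k<n. A $$ (i, k) * B $$ (k, j))"
  using assms by (simp add: scalar_prod_def atLeast0LessThan)

lemma one_USL [simp]: "1\<^sub>m n \<in> USL n"
  by (rule USL_I) auto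

lemma USL_mult:
  assumes g: "g \<in> USL n" and h: "h \<in> USL n"
  shows "g * h \<in> USL n"
proof (rule USL_I)
  show "g * h \<in> carrier_mat n n" using USL_D(1)[OF g] USL_D(1)[OF h] by simp
  fix i assume i: "i < n"
  have off: "g $$ (i, k) * h $$ (k, j) = 0" if "j \<le> i" "k < n" "k \<noteq> i" for j k
    using that i USL_D(2)[OF g, of k i] USL_D(2)[OF h, of j k] by (cases "k < i") auto
  show "(g * h) $$ (i, j) = 0" if "j < i" for j
  proof -
    have "g $$ (i, k) * h $$ (k, j) = 0" if "k < n" for k
      using off[of j k] \<open>j < i\<close> that i USL_D(2)[OF h, of j i] by (cases "k = i") auto
    then show ?thesis using that i
      by (auto simp: mult_entry[OF USL_D(1)[OF g] USL_D(1)[OF h]] intro!: sum.neutral)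
  qed
  have "(\<Sum>k<n. g $$ (i, k) * h $$ (k, i)) = (\<Sum>k\<in>{i}. g $$ (i, k) * h $$ (k, i))"
    using off[of i] i by (intro sum.mono_neutral_right) auto
  then show "(g * h) $$ (i, i) = 1"
    using i USL_D(3)[OF g i] USL_D(3)[OF h i] by (simp add: mult_entry[OF USL_D(1)[OF g] USL_D(1)[OF h]])
qed

lemma strictly_upper_mult_left:
  assumes g: "g \<in> USL n" and x: "x \<in> strictly_upper n"
  shows "g * x \<in> strictly_upper n"
proof (rule strictly_upper_I)
  show "g * x \<in> carrier_mat n n" using USL_D(1)[OF g] strictly_upper_D(1)[OF x] by simp
  fix i j assume "j \<le> i" "i < n"
  moreover have "g $$ (i, k) * x $$ (k, j) = 0" if "k < n" for k
    using calculation that USL_D(2)[OF g, of k i] strictly_upper_D(2)[OF x, of j k] by (cases "k < i") auto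
  ultimately show "(g * x) $$ (i, j) = 0"
    by (auto simp: mult_entry[OF USL_D(1)[OF g] strictly_upper_D(1)[OF x]] intro!: sum.neutral)
qed

lemma strictly_upper_mult_right:
  assumes g: "g \<in> USL n" and x: "x \<in> strictly_upper n"
  shows "x * g \<in> strictly_upper n"
proof (rule strictly_upper_I)
  show "x * g \<in> carrier_mat n n" using USL_D(1)[OF g] strictly_upper_D(1)[OF x] by simp
  fix i j assume "j \<le> i" "i < n"
  moreover have "x $$ (i, k) * g $$ (k, j) = 0" if "k < n" for k
    using calculation that USL_D(2)[OF g, of j k] strictly_upper_D(2)[OF x, of k i] by (cases "k \<le> i") auto
  ultimately show "(x * g) $$ (i, j) = 0"
    by (auto simp: mult_entry[OF strictly_upper_D(1)[OF x] USL_D(1)[OF g]] intro!: sum.neutral)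
qed

lemma minus_one_strictly_upper:
  assumes "u \<in> USL n"
  shows "u - 1\<^sub>m n \<in> strictly_upper n"
  using USL_D[OF assms] by (intro strictly_upper_I) (auto simp: le_less)

lemma one_plus_USL:
  assumes "x \<in> strictly_upper n"
  shows "1\<^sub>m n + x \<in> USL n"
  using strictly_upper_D[OF assms] by (intro USL_I) auto

lemma one_plus_minus_one: "x \<in> carrier_mat n n \<Longrightarrow> 1\<^sub>m n + x - 1\<^sub>m n = (x :: 'f::field mat)"
  "x \<in> carrier_mat n n \<Longrightarrow> 1\<^sub>m n + (x - 1\<^sub>m n) = (x :: 'f::field mat)"
  by (auto intro!: eq_matI)

text \<open>
  The determinant is \<open>1\<close>, so there is an inverse \<open>g'\<close>.  Reading \<open>g' * g = 1\<close> column by column shows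
  that \<open>g'\<close> is again unitriangular: once the earlier columns of \<open>g'\<close> vanish below the diagonal, the
  entry \<open>(i, j)\<close> of the product is the entry \<open>(i, j)\<close> of \<open>g'\<close>.
\<close>

lemma USL_inverse:
  fixes g :: "'f::field mat"
  assumes g: "g \<in> USL n"
  obtains g' where "g' \<in> USL n" "g * g' = 1\<^sub>m n" "g' * g = 1\<^sub>m n"
proof -
  note gc = USL_D(1)[OF g]
  have "diag_mat g = replicate n 1"
    using gc USL_D(3)[OF g] unfolding diag_mat_def by (intro nth_equalityI) auto
  moreover have "prod_list (replicate n (1 :: 'f)) = 1" by (induction n) auto
  ultimately have "prod_list (diag_mat g) = 1" by simp
  moreover have "upper_triangular g" using g by (simp add: USL_def)
  ultimately have "det g \<noteq> 0" using det_upper_triangular[OF _ gc] by simp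
  from det_non_zero_imp_unit[OF gc this, of "()"]
  obtain g' where g': "g' \<in> carrier_mat n n" "g' * g = 1\<^sub>m n" "g * g' = 1\<^sub>m n"
    unfolding Units_def ring_mat_def by auto
  have entry: "j < n \<Longrightarrow> j \<le> i \<Longrightarrow> i < n \<Longrightarrow> g' $$ (i, j) = (if i = j then 1 else 0)" for i j
  proof (induction j arbitrary: i rule: less_induct)
    case (less j)
    have "g' $$ (i, k) * g $$ (k, j) = 0" if "k < n" "k \<noteq> j" for k
      using less that USL_D(2)[OF g, of j k] by (cases "k < j") auto
    then have "(\<Sum>k<n. g' $$ (i, k) * g $$ (k, j)) = (\<Sum>k\<in>{j}. g' $$ (i, k) * g $$ (k, j))"
      using less by (intro sum.mono_neutral_right) auto
    also have "\<dots> = g' $$ (i, j)" using USL_D(3)[OF g less(2)] by simp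
    finally have "(g' * g) $$ (i, j) = g' $$ (i, j)"
      using less by (simp add: mult_entry[OF g'(1) gc])
    then show ?case using less g'(2) by simp
  qed
  have "g' \<in> USL n" using entry g'(1) by (intro USL_I) (auto simp: less_imp_le)
  with g' that show ?thesis by blast
qed

lemma unitri_equiv_refl: "x \<in> carrier_mat n n \<Longrightarrow> unitri_equiv n x x"
  unfolding unitri_equiv_def by (intro bexI[of _ "1\<^sub>m n"]) auto

lemma unitri_equiv_sym:
  assumes "unitri_equiv n x y" and c: "x \<in> carrier_mat n n" "y \<in> carrier_mat n n"
  shows "unitri_equiv n y x"
proof -
  obtain g h where gh: "g \<in> USL n" "h \<in> USL n" "g * x = y * h"
    using assms(1) unfolding unitri_equiv_def by blast
  obtain g' where g': "g' \<in> USL n" "g' * g = 1\<^sub>m n" using USL_inverse[OF gh(1)] by metis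
  obtain h' where h': "h' \<in> USL n" "h * h' = 1\<^sub>m n" using USL_inverse[OF gh(2)] by metis
  note [simp] = mult_carrier_mat[of _ n n _ n] right_mult_one_mat[of _ n n] left_mult_one_mat[of _ n n] USL_D(1)[OF gh(1)] USL_D(1)[OF gh(2)] USL_D(1)[OF g'(1)] USL_D(1)[OF h'(1)] c
  have "g' * y = g' * (y * (h * h'))" by (simp add: h')
  also have "\<dots> = g' * ((y * h) * h')" by (simp add: assoc_mult_mat[of _ n n _ n _ n])
  also have "\<dots> = (g' * g) * x * h'" by (simp add: gh(3)[symmetric] assoc_mult_mat[of _ n n _ n _ n])
  also have "\<dots> = x * h'" by (simp add: g')
  finally show ?thesis using g' h' unfolding unitri_equiv_def by blast
qed

lemma unitri_equiv_trans:
  assumes "unitri_equiv n x y" "unitri_equiv n y z"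
    and c: "x \<in> carrier_mat n n" "y \<in> carrier_mat n n" "z \<in> carrier_mat n n"
  shows "unitri_equiv n x z"
proof -
  obtain g h where gh: "g \<in> USL n" "h \<in> USL n" "g * x = y * h"
    using assms(1) unfolding unitri_equiv_def by blast
  obtain g' h' where gh': "g' \<in> USL n" "h' \<in> USL n" "g' * y = z * h'"
    using assms(2) unfolding unitri_equiv_def by blast
  note [simp] = mult_carrier_mat[of _ n n _ n] right_mult_one_mat[of _ n n] left_mult_one_mat[of _ n n] USL_D(1)[OF gh(1)] USL_D(1)[OF gh(2)] USL_D(1)[OF gh'(1)] USL_D(1)[OF gh'(2)] c
  have "(g' * g) * x = g' * y * h" by (simp add: gh(3) assoc_mult_mat[of _ n n _ n _ n])
  also have "\<dots> = z * (h' * h)" by (simp add: gh'(3) assoc_mult_mat[of _ n n _ n _ n])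
  finally show ?thesis using USL_mult gh gh' unfolding unitri_equiv_def by blast
qed

text \<open>
  In the definition of a superclass the inverse of \<open>h\<close> is an arbitrary matrix; uniqueness of inverses
  identifies it with the unitriangular one.
\<close>

lemma mem_superclass_iff:
  fixes x :: "'f::field mat"
  assumes x: "x \<in> USL n"
  shows "y \<in> superclass n x \<longleftrightarrow> y \<in> USL n \<and> unitri_equiv n (x - 1\<^sub>m n) (y - 1\<^sub>m n)"
proof -
  note xs = minus_one_strictly_upper[OF x]
  note [simp] = mult_carrier_mat[of _ n n _ n] right_mult_one_mat[of _ n n] left_mult_one_mat[of _ n n]
    strictly_upper_D(1)[OF xs]
  show ?thesis
  proof
    assume "y \<in> superclass n x"
    then obtain g h h' where gh: "g \<in> USL n" "h \<in> USL n" "inverts_mat h h'" "inverts_mat h' h"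
      and y: "y = 1\<^sub>m n + g * (x - 1\<^sub>m n) * h'" unfolding superclass_def by blast
    note [simp] = mult_carrier_mat[of _ n n _ n] right_mult_one_mat[of _ n n] left_mult_one_mat[of _ n n] USL_D(1)[OF gh(1)] USL_D(1)[OF gh(2)]
    have hh': "h * h' = 1\<^sub>m n" "h' * h = 1\<^sub>m (dim_row h')"
      using gh(3,4) by (simp_all add: inverts_mat_def carrier_matD[OF USL_D(1)[OF gh(2)]])
    from arg_cong[OF hh'(1), of dim_col] arg_cong[OF hh'(2), of dim_col]
    have h'c [simp]: "h' \<in> carrier_mat n n"
      using carrier_matD[OF USL_D(1)[OF gh(2)]] by (auto intro!: carrier_matI)
    then have h'h: "h' * h = 1\<^sub>m n" using hh'(2) carrier_matD(1)[OF h'c] by simp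
    obtain h'' where h'': "h'' \<in> USL n" "h'' * h = 1\<^sub>m n" using USL_inverse[OF gh(2)] by metis
    note [simp] = mult_carrier_mat[of _ n n _ n] right_mult_one_mat[of _ n n] left_mult_one_mat[of _ n n] USL_D(1)[OF h''(1)]
    have "h'' = h'' * (h * h')" by (simp add: hh'(1))
    also have "\<dots> = h''* h * h'" by (simp add: assoc_mult_mat[of _ n n _ n _ n])
    also have "\<dots> = h'" by (simp add: h'')
    finally have h'U: "h' \<in> USL n" using h'' by simp
    have s: "g * (x - 1\<^sub>m n) * h' \<in> strictly_upper n"
      by (intro strictly_upper_mult_right strictly_upper_mult_left gh h'U xs)
    have y1: "y - 1\<^sub>m n = g * (x - 1\<^sub>m n) * h'"
      unfolding y using one_plus_minus_one(1)[OF strictly_upper_D(1)[OF s]] .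
    have "(y - 1\<^sub>m n) * h = g * (x - 1\<^sub>m n)"
      unfolding y1 by (simp add: assoc_mult_mat[of _ n n _ n _ n] h'h)
    then show "y \<in> USL n \<and> unitri_equiv n (x - 1\<^sub>m n) (y - 1\<^sub>m n)"
      using one_plus_USL[OF s] gh unfolding unitri_equiv_def y[symmetric] by metis
  next
    assume "y \<in> USL n \<and> unitri_equiv n (x - 1\<^sub>m n) (y - 1\<^sub>m n)"
    then obtain g h where y: "y \<in> USL n" and gh: "g \<in> USL n" "h \<in> USL n"
      and eq: "g * (x - 1\<^sub>m n) = (y - 1\<^sub>m n) * h" unfolding unitri_equiv_def by blast
    obtain h' where h': "h' \<in> USL n" "h * h' = 1\<^sub>m n" "h' * h = 1\<^sub>m n" using USL_inverse[OF gh(2)] .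
    note [simp] = mult_carrier_mat[of _ n n _ n] right_mult_one_mat[of _ n n] left_mult_one_mat[of _ n n] USL_D(1)[OF gh(1)] USL_D(1)[OF gh(2)] USL_D(1)[OF y] USL_D(1)[OF h'(1)]
      strictly_upper_D(1)[OF minus_one_strictly_upper[OF y]]
    have "y = 1\<^sub>m n + (y - 1\<^sub>m n)" using one_plus_minus_one(2)[OF USL_D(1)[OF y]] by simp
    also have "y - 1\<^sub>m n = g * (x - 1\<^sub>m n) * h'"
      unfolding eq by (simp add: assoc_mult_mat[of _ n n _ n _ n] h')
    finally have "y = 1\<^sub>m n + g * (x - 1\<^sub>m n) * h'" .
    moreover have "inverts_mat h h'" "inverts_mat h' h"
      using h' carrier_matD[OF USL_D(1)[OF gh(2)]] carrier_matD[OF USL_D(1)[OF h'(1)]]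
      by (simp_all add: inverts_mat_def)
    ultimately show "y \<in> superclass n x" unfolding superclass_def using gh by blast
  qed
qed

section \<open>Canonical forms\<close>

definition monomial_below :: "nat \<Rightarrow> nat \<Rightarrow> 'f::field mat \<Rightarrow> bool"
  where "monomial_below n k y \<longleftrightarrow> (\<forall>i<n. \<forall>j<k. y $$ (i, j) \<noteq> 0 \<longrightarrow>
    (\<forall>i'<n. y $$ (i', j) \<noteq> 0 \<longrightarrow> i' = i) \<and> (\<forall>j'<k. y $$ (i, j') \<noteq> 0 \<longrightarrow> j' = j))"

lemma monomial_belowD:
  assumes "monomial_below n k y" "i < n" "j < k" "y $$ (i, j) \<noteq> 0"
  shows "i' < n \<Longrightarrow> y $$ (i', j) \<noteq> 0 \<Longrightarrow> i' = i" "j' < k \<Longrightarrow> y $$ (i, j') \<noteq> 0 \<Longrightarrow> j' = j"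
  using assms unfolding monomial_below_def by blast+

text \<open>
  If row \<open>r\<close> has a nonzero entry in an earlier column \<open>a\<close>, this is the only nonzero entry of column
  \<open>a\<close>, and subtracting a multiple of column \<open>a\<close> from column \<open>k\<close> clears the entry \<open>(r, k)\<close> without
  changing any other row.  All these column operations are collected in the matrix \<open>h\<close>.
\<close>

lemma eliminate_column:
  fixes y :: "'f::field mat"
  assumes y: "y \<in> strictly_upper n" and m: "monomial_below n k y" and k: "k < n"
  obtains z where "z \<in> strictly_upper n" "unitri_equiv n y z"
    "\<And>r s. r < n \<Longrightarrow> s < k \<Longrightarrow> z $$ (r, s) = y $$ (r, s)"
    "\<And>r s. r < n \<Longrightarrow> s < k \<Longrightarrow> y $$ (r, s) \<noteq> 0 \<Longrightarrow> z $$ (r, k) = 0"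
proof -
  define piv where "piv = (\<lambda>a. SOME i. i < n \<and> y $$ (i, a) \<noteq> 0)"
  have piv: "piv a = i" if "i < n" "a < k" "y $$ (i, a) \<noteq> 0" for i a
    unfolding piv_def using someI[of "\<lambda>i. i < n \<and> y $$ (i, a) \<noteq> 0" i] monomial_belowD(1)[OF m that] that
    by blast
  define h where "h = mat n n (\<lambda>(a, b). if a = b then 1 else if b = k \<and> a < k
    then - (y $$ (piv a, k) / y $$ (piv a, a)) else 0)"
  have hc: "h \<in> carrier_mat n n" by (simp add: h_def)
  have h: "h \<in> USL n" by (rule USL_I) (auto simp: h_def)
  note yc = strictly_upper_D(1)[OF y]
  define z where "z = y * h"
  have zs: "z \<in> strictly_upper n" unfolding z_def by (rule strictly_upper_mult_right[OF h y])
  have "unitri_equiv n z y"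
    unfolding unitri_equiv_def using h left_mult_one_mat[OF strictly_upper_D(1)[OF zs]]
    by (intro bexI[of _ "1\<^sub>m n"] bexI[of _ h]) (auto simp: z_def)
  then have "unitri_equiv n y z" using unitri_equiv_sym strictly_upper_D(1)[OF zs] yc by blast
  moreover have "z $$ (r, s) = y $$ (r, s)" if "r < n" "s < k" for r s
  proof -
    have "(\<Sum>a<n. y $$ (r, a) * h $$ (a, s)) = (\<Sum>a\<in>{s}. y $$ (r, a) * h $$ (a, s))"
      using that k by (intro sum.mono_neutral_right) (auto simp: h_def)
    then show ?thesis using that k by (simp add: z_def mult_entry[OF yc hc]) (simp add: h_def)
  qed
  moreover have "z $$ (r, k) = 0" if "r < n" "s < k" "y $$ (r, s) \<noteq> 0" for r s
  proof -
    have "y $$ (r, a) * h $$ (a, k) = 0" if "a < n" "a \<notin> {s, k}" for a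
      using monomial_belowD(2)[OF m \<open>r < n\<close> \<open>s < k\<close> \<open>y $$ (r, s) \<noteq> 0\<close>, of a] that k
      by (auto simp: h_def)
    then have "(\<Sum>a<n. y $$ (r, a) * h $$ (a, k)) = (\<Sum>a\<in>{s, k}. y $$ (r, a) * h $$ (a, k))"
      using that k by (intro sum.mono_neutral_right) auto
    also have "\<dots> = 0" using that k piv[OF that] by (simp add: h_def)
    finally show ?thesis using that k by (simp add: z_def mult_entry[OF yc hc])
  qed
  ultimately show ?thesis using that zs by blast
qed

text \<open>
  The lowest nonzero entry of column \<open>k\<close> clears the entries above it by row operations.  Its row
  vanishes in the earlier columns, which are therefore unchanged.
\<close>

lemma eliminate_above_pivot:
  fixes z :: "'f::field mat"
  assumes z: "z \<in> strictly_upper n" and p: "p < n" "z $$ (p, k) \<noteq> 0" and k: "k < n"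
    and below: "\<And>r. p < r \<Longrightarrow> r < n \<Longrightarrow> z $$ (r, k) = 0"
    and row: "\<And>s. s < k \<Longrightarrow> z $$ (p, s) = 0"
  obtains w where "w \<in> strictly_upper n" "unitri_equiv n z w"
    "\<And>r s. r < n \<Longrightarrow> s < k \<Longrightarrow> w $$ (r, s) = z $$ (r, s)"
    "\<And>r. r < n \<Longrightarrow> w $$ (r, k) \<noteq> 0 \<Longrightarrow> r = p"
proof -
  define g where "g = mat n n (\<lambda>(a, b). if a = b then 1 else if b = p \<and> a < p
    then - (z $$ (a, k) / z $$ (p, k)) else 0)"
  have gc: "g \<in> carrier_mat n n" by (simp add: g_def)
  have g: "g \<in> USL n" by (rule USL_I) (auto simp: g_def)
  note zc = strictly_upper_D(1)[OF z]
  define w where "w = g * z"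
  have ws: "w \<in> strictly_upper n" unfolding w_def by (rule strictly_upper_mult_left[OF g z])
  have "unitri_equiv n z w"
    unfolding unitri_equiv_def using g right_mult_one_mat[OF strictly_upper_D(1)[OF ws]]
    by (intro bexI[of _ g] bexI[of _ "1\<^sub>m n"]) (auto simp: w_def)
  moreover have entry: "w $$ (r, s) = z $$ (r, s) - (if r < p then z $$ (r, k) / z $$ (p, k) * z $$ (p, s) else 0)"
    if "r < n" "s < n" for r s
  proof -
    have "(\<Sum>a<n. g $$ (r, a) * z $$ (a, s)) = (\<Sum>a\<in>{r, p}. g $$ (r, a) * z $$ (a, s))"
      using that p by (intro sum.mono_neutral_right) (auto simp: g_def)
    also have "\<dots> = z $$ (r, s) - (if r < p then z $$ (r, k) / z $$ (p, k) * z $$ (p, s) else 0)"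
      using that p by (cases "r = p") (auto simp: g_def)
    finally show ?thesis using that by (simp add: w_def mult_entry[OF gc zc])
  qed
  moreover have "w $$ (r, s) = z $$ (r, s)" if "r < n" "s < k" for r s
    using entry[of r s] row[of s] that k by simp
  moreover have "r = p" if "r < n" "w $$ (r, k) \<noteq> 0" for r
    using entry[of r k] that k p(2) below[of r] by (cases r p rule: linorder_cases) auto
  ultimately show ?thesis using that ws by blast
qed

text \<open>
  Gaussian elimination, one column after the other from left to right.
\<close>

lemma monomial_form_exists:
  fixes x :: "'f::field mat"
  assumes x: "x \<in> strictly_upper n" and "k \<le> n"
  shows "\<exists>y\<in>strictly_upper n. unitri_equiv n x y \<and> monomial_below n k y"
  using assms(2)
proof (induction k)
  case 0
  show ?case using x unitri_equiv_refl[OF strictly_upper_D(1)[OF x]] by (auto simp: monomial_below_def)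
next
  case (Suc k)
  then obtain y where y: "y \<in> strictly_upper n" "unitri_equiv n x y" and m: "monomial_below n k y" by auto
  from Suc have k: "k < n" by simp
  obtain z where z: "z \<in> strictly_upper n" "unitri_equiv n y z"
    and zy: "\<And>r s. r < n \<Longrightarrow> s < k \<Longrightarrow> z $$ (r, s) = y $$ (r, s)"
    and zk: "\<And>r s. r < n \<Longrightarrow> s < k \<Longrightarrow> y $$ (r, s) \<noteq> 0 \<Longrightarrow> z $$ (r, k) = 0"
    using eliminate_column[OF y(1) m k] by blast
  have xz: "unitri_equiv n x z"
    using unitri_equiv_trans[OF y(2) z(2)] x y z strictly_upper_D(1) by blast
  let ?R = "{r. r < n \<and> z $$ (r, k) \<noteq> 0}"
  show ?case
  proof (cases "?R = {}")
    case True
    then have "monomial_below n (Suc k) z"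
      using m unfolding monomial_below_def by (auto simp: zy less_Suc_eq)
    then show ?thesis using z xz by blast
  next
    case False
    define p where "p = Max ?R"
    have "finite ?R" by simp
    with False have p: "p < n" "z $$ (p, k) \<noteq> 0" unfolding p_def using Max_in[of ?R] by auto
    have below: "z $$ (r, k) = 0" if "p < r" "r < n" for r
    proof (rule ccontr)
      assume "z $$ (r, k) \<noteq> 0"
      then have "r \<le> p" unfolding p_def using that by (intro Max_ge) auto
      with that show False by simp
    qed
    have row: "z $$ (p, s) = 0" if "s < k" for s using zk[OF p(1) that] zy[OF p(1) that] p(2) by auto
    obtain w where w: "w \<in> strictly_upper n" "unitri_equiv n z w"
      and wz: "\<And>r s. r < n \<Longrightarrow> s < k \<Longrightarrow> w $$ (r, s) = z $$ (r, s)"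
      and wk: "\<And>r. r < n \<Longrightarrow> w $$ (r, k) \<noteq> 0 \<Longrightarrow> r = p"
      using eliminate_above_pivot[OF z(1) p k below row] by blast
    have wy: "w $$ (r, s) = y $$ (r, s)" if "r < n" "s < k" for r s using wz zy that by simp
    have "monomial_below n (Suc k) w"
      unfolding monomial_below_def
    proof (intro allI impI conjI)
      fix i j i' assume i: "i < n" and j: "j < Suc k" and nz: "w $$ (i, j) \<noteq> 0"
        and i': "i' < n" and nz': "w $$ (i', j) \<noteq> 0"
      show "i' = i"
      proof (cases "j = k")
        case True
        then show ?thesis using wk i i' nz nz' by blast
      next
        case False
        then have "j < k" using j by simp
        then show ?thesis using monomial_belowD(1)[OF m i] i' nz nz' wy i by auto
      qed
    next
      fix i j j' assume i: "i < n" and j: "j < Suc k" and nz: "w $$ (i, j) \<noteq> 0"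
        and j': "j' < Suc k" and nz': "w $$ (i, j') \<noteq> 0"
      have mixed: False if "s < k" "w $$ (i, s) \<noteq> 0" "w $$ (i, k) \<noteq> 0" for s
        using wk[OF i that(3)] row[OF that(1)] wz[OF i that(1)] that(2) by simp
      show "j' = j"
      proof (cases "j < k \<and> j' < k")
        case True
        then show ?thesis using monomial_belowD(2)[OF m i] nz nz' wy i by auto
      next
        case False
        then show ?thesis using mixed nz nz' j j' by (metis less_antisym)
      qed
    qed
    moreover have "unitri_equiv n x w"
      using unitri_equiv_trans[OF xz w(2)] x z w strictly_upper_D(1) by blast
    ultimately show ?thesis using w(1) by blast
  qed
qed

definition diagram_matrix :: "nat \<Rightarrow> (nat \<times> nat \<times> 'f) set \<Rightarrow> 'f::field mat"
  where "diagram_matrix n T =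
    mat n n (\<lambda>(i, j). if \<exists>c. (i, j, c) \<in> T then THE c. (i, j, c) \<in> T else 0)"

lemma diagram_matrix_carrier [simp]: "diagram_matrix n T \<in> carrier_mat n n"
  by (simp add: diagram_matrix_def)

lemma diagram_matrix_nonzero:
  assumes T: "T \<in> arc_diagrams n (- {0})" and ij: "i < n" "j < n"
  shows "diagram_matrix n T $$ (i, j) = c \<and> c \<noteq> 0 \<longleftrightarrow> (i, j, c) \<in> T"
proof (cases "\<exists>d. (i, j, d) \<in> T")
  case True
  then obtain d where d: "(i, j, d) \<in> T" ..
  have "(THE c. (i, j, c) \<in> T) = d" using d arc_diagramsD(4)[OF T d] by (intro the_equality) blast+
  then have "diagram_matrix n T $$ (i, j) = d" using ij d by (auto simp: diagram_matrix_def)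
  moreover have "(i, j, c) \<in> T \<longleftrightarrow> c = d" using d arc_diagramsD(4)[OF T d] by blast
  ultimately show ?thesis using arc_diagramsD(3)[OF T d] by auto
next
  case False
  then have "diagram_matrix n T $$ (i, j) = 0" using ij by (simp add: diagram_matrix_def)
  with False show ?thesis by auto
qed

lemma diagram_matrix_arc:
  assumes "T \<in> arc_diagrams n (- {0})" "(i, j, c) \<in> T"
  shows "diagram_matrix n T $$ (i, j) = c"
proof -
  have "i < n" "j < n" using arc_diagramsD(1,2)[OF assms] by auto
  from diagram_matrix_nonzero[OF assms(1) this, of c] assms(2) show ?thesis by simp
qed

lemma diagram_matrix_no_arc:
  assumes "T \<in> arc_diagrams n (- {0})" "i < n" "j < n" "\<And>c. (i, j, c) \<notin> T"
  shows "diagram_matrix n T $$ (i, j) = 0"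
  using diagram_matrix_nonzero[OF assms(1-3), of "diagram_matrix n T $$ (i, j)"] assms(4) by auto

lemma diagram_matrix_strictly_upper:
  assumes T: "T \<in> arc_diagrams n (- {0})"
  shows "diagram_matrix n T \<in> strictly_upper n"
proof (rule strictly_upper_I)
  fix i j assume ji: "j \<le> i" "i < n"
  have "(i, j, c) \<notin> T" for c using arc_diagramsD(1)[OF T, of i j c] ji by auto
  then show "diagram_matrix n T $$ (i, j) = 0" using ji by (intro diagram_matrix_no_arc[OF T]) auto
qed simp

lemma diagram_matrix_eqI:
  assumes T: "T \<in> arc_diagrams n (- {0})" and y: "y \<in> carrier_mat n n"
    and eq: "\<And>i j c. i < n \<Longrightarrow> j < n \<Longrightarrow> (i, j, c) \<in> T \<longleftrightarrow> y $$ (i, j) = c \<and> c \<noteq> 0"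
  shows "diagram_matrix n T = y"
proof (rule eq_matI)
  fix i j assume "i < dim_row y" "j < dim_col y"
  then have ij: "i < n" "j < n" using y by auto
  let ?d = "diagram_matrix n T $$ (i, j)"
  show "?d = y $$ (i, j)"
    using diagram_matrix_nonzero[OF T ij, of ?d] eq[OF ij, of ?d]
      diagram_matrix_nonzero[OF T ij, of "y $$ (i, j)"] eq[OF ij, of "y $$ (i, j)"] by auto
qed (use y in \<open>auto simp: diagram_matrix_def\<close>)

lemma canonical_form_exists:
  fixes x :: "'f::field mat"
  assumes x: "x \<in> strictly_upper n"
  shows "\<exists>T\<in>arc_diagrams n (- {0}). unitri_equiv n x (diagram_matrix n T)"
proof -
  obtain y where y: "y \<in> strictly_upper n" "unitri_equiv n x y" and m: "monomial_below n n y"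
    using monomial_form_exists[OF x order_refl] by blast
  define T where "T = {(i, j, c). i < n \<and> j < n \<and> y $$ (i, j) = c \<and> c \<noteq> 0}"
  have T: "T \<in> arc_diagrams n (- {0})"
  proof (rule arc_diagramsI)
    fix i j c assume "(i, j, c) \<in> T"
    then have ijc: "i < n" "j < n" "y $$ (i, j) = c" "c \<noteq> 0" by (simp_all add: T_def)
    then have "\<not> j \<le> i" using strictly_upper_D(2)[OF y(1), of j i] by blast
    with ijc show "i < j \<and> j < n \<and> c \<in> - {0}" by simp
    show "j = j' \<and> c = c'" if "(i, j', c') \<in> T" for j' c'
    proof -
      from that have "j' < n" "y $$ (i, j') = c'" "c' \<noteq> 0" by (simp_all add: T_def)
      with ijc monomial_belowD(2)[OF m, of i j j'] have "j' = j" by simp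
      with \<open>y $$ (i, j') = c'\<close> ijc(3) show ?thesis by simp
    qed
    show "i = i' \<and> c = c'" if "(i', j, c') \<in> T" for i' c'
    proof -
      from that have "i' < n" "y $$ (i', j) = c'" "c' \<noteq> 0" by (simp_all add: T_def)
      with ijc monomial_belowD(1)[OF m, of i j i'] have "i' = i" by simp
      with \<open>y $$ (i', j) = c'\<close> ijc(3) show ?thesis by simp
    qed
  qed
  moreover have "diagram_matrix n T = y"
    by (rule diagram_matrix_eqI[OF T strictly_upper_D(1)[OF y(1)]]) (simp add: T_def)
  ultimately show ?thesis using y(2) by blast
qed

text \<open>
  Compare the entries \<open>(i, j)\<close> of the two products.  On the left it is \<open>g $$ (i, i) * c = c\<close>.  On the
  right it can only be nonzero if \<open>S\<close> has an arc \<open>(i, j', c')\<close>, and then it is \<open>c' * h $$ (j', j)\<close>,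
  which vanishes for \<open>j < j'\<close>.
\<close>

lemma canonical_form_pivot:
  fixes T S :: "(nat \<times> nat \<times> 'f::field) set"
  assumes T: "T \<in> arc_diagrams n (- {0})" and S: "S \<in> arc_diagrams n (- {0})"
    and gh: "g \<in> USL n" "h \<in> USL n" "g * diagram_matrix n T = diagram_matrix n S * h"
    and arc: "(i, j, c) \<in> T"
  shows "\<exists>j'\<le>j. \<exists>c'. (i, j', c') \<in> S \<and> (j' = j \<longrightarrow> c' = c)"
proof -
  have ij: "i < n" "j < n" "c \<noteq> 0" using arc_diagramsD(1-3)[OF T arc] by auto
  have "diagram_matrix n T $$ (k, j) = 0" if "k < n" "k \<noteq> i" for k
  proof (rule diagram_matrix_no_arc[OF T that(1) ij(2)])
    show "(k, j, c') \<notin> T" for c' using arc_diagramsD(5)[OF T arc, of k c'] that(2) by blast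
  qed
  then have "(\<Sum>k<n. g $$ (i, k) * diagram_matrix n T $$ (k, j)) =
    (\<Sum>k\<in>{i}. g $$ (i, k) * diagram_matrix n T $$ (k, j))"
    using ij by (intro sum.mono_neutral_right) auto
  also have "\<dots> = c" using USL_D(3)[OF gh(1) ij(1)] diagram_matrix_arc[OF T arc] by simp
  finally have "(g * diagram_matrix n T) $$ (i, j) = c"
    unfolding mult_entry[OF USL_D(1)[OF gh(1)] diagram_matrix_carrier ij(1,2)] .
  then have c: "(\<Sum>k<n. diagram_matrix n S $$ (i, k) * h $$ (k, j)) = c"
    unfolding gh(3) mult_entry[OF diagram_matrix_carrier USL_D(1)[OF gh(2)] ij(1,2)] .
  have "\<exists>k<n. diagram_matrix n S $$ (i, k) \<noteq> 0"
  proof (rule ccontr)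
    assume "\<not> ?thesis"
    then have "(\<Sum>k<n. diagram_matrix n S $$ (i, k) * h $$ (k, j)) = 0" by (intro sum.neutral) simp
    with c ij(3) show False by simp
  qed
  then obtain k where k: "k < n" "diagram_matrix n S $$ (i, k) \<noteq> 0" by blast
  have "\<exists>c'. (i, k, c') \<in> S"
  proof (rule ccontr)
    assume "\<not> ?thesis"
    then have "diagram_matrix n S $$ (i, k) = 0" by (intro diagram_matrix_no_arc[OF S ij(1) k(1)]) simp
    with k(2) show False by simp
  qed
  then obtain c' where arc': "(i, k, c') \<in> S" by blast
  have "diagram_matrix n S $$ (i, l) = 0" if "l < n" "l \<noteq> k" for l
  proof (rule diagram_matrix_no_arc[OF S ij(1) that(1)])
    show "(i, l, d) \<notin> S" for d using arc_diagramsD(4)[OF S arc', of l d] that(2) by blast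
  qed
  then have "(\<Sum>l<n. diagram_matrix n S $$ (i, l) * h $$ (l, j)) =
    (\<Sum>l\<in>{k}. diagram_matrix n S $$ (i, l) * h $$ (l, j))"
    using k(1) by (intro sum.mono_neutral_right) auto
  with c have c': "c' * h $$ (k, j) = c" using diagram_matrix_arc[OF S arc'] by simp
  then have "h $$ (k, j) \<noteq> 0" using ij(3) by auto
  then have "k \<le> j" using USL_D(2)[OF gh(2) _ k(1), of j] not_le by blast
  moreover have "k = j \<longrightarrow> c' = c" using c' USL_D(3)[OF gh(2) ij(2)] by auto
  ultimately show ?thesis using arc' by blast
qed

text \<open>
  Applying \<open>canonical_form_pivot\<close> in both directions, the arcs of \<open>T\<close> and \<open>S\<close> that start at \<open>i\<close> have
  the same end, and then the same colour.
\<close>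

lemma canonical_form_unique:
  fixes T S :: "(nat \<times> nat \<times> 'f::field) set"
  assumes T: "T \<in> arc_diagrams n (- {0})" and S: "S \<in> arc_diagrams n (- {0})"
    and eq: "unitri_equiv n (diagram_matrix n T) (diagram_matrix n S)"
  shows "T = S"
proof -
  have sub: "T \<subseteq> S" if T: "T \<in> arc_diagrams n (- {0})" and S: "S \<in> arc_diagrams n (- {0})"
    and eq: "unitri_equiv n (diagram_matrix n T) (diagram_matrix n S)"
  for T S :: "(nat \<times> nat \<times> 'f::field) set"
  proof
    fix t assume "t \<in> T"
    then obtain i j c where t: "t = (i, j, c)" "(i, j, c) \<in> T" by (cases t) auto
    obtain g h where gh: "g \<in> USL n" "h \<in> USL n" "g * diagram_matrix n T = diagram_matrix n S * h"
      using eq unfolding unitri_equiv_def by blast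
    obtain g' h' where gh': "g' \<in> USL n" "h' \<in> USL n" "g' * diagram_matrix n S = diagram_matrix n T * h'"
      using unitri_equiv_sym[OF eq diagram_matrix_carrier diagram_matrix_carrier]
      unfolding unitri_equiv_def by blast
    obtain j' c' where 1: "j' \<le> j" "(i, j', c') \<in> S" "j' = j \<longrightarrow> c' = c"
      using canonical_form_pivot[OF T S gh t(2)] by blast
    obtain j'' c'' where 2: "j'' \<le> j'" "(i, j'', c'') \<in> T"
      using canonical_form_pivot[OF S T gh' 1(2)] by blast
    from arc_diagramsD(4)[OF T t(2) 2(2)] have "j'' = j" ..
    with 1(1) 2(1) have "j' = j" by simp
    with 1 t show "t \<in> S" by simp
  qed
  show ?thesis
    by (rule antisym[OF sub[OF T S eq]
      sub[OF S T unitri_equiv_sym[OF eq diagram_matrix_carrier diagram_matrix_carrier]]])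
qed

definition arc_type :: "nat \<Rightarrow> 'f::field mat \<Rightarrow> (nat \<times> nat \<times> 'f) set"
  where "arc_type n u = (THE T. T \<in> arc_diagrams n (- {0}) \<and>
    unitri_equiv n (u - 1\<^sub>m n) (diagram_matrix n T))"

lemma arc_type_eqI:
  fixes u :: "'f::field mat"
  assumes u: "u \<in> USL n" and T: "T \<in> arc_diagrams n (- {0})"
    and eq: "unitri_equiv n (u - 1\<^sub>m n) (diagram_matrix n T)"
  shows "arc_type n u = T"
  unfolding arc_type_def
proof (rule the_equality)
  fix S assume S: "S \<in> arc_diagrams n (- {0}) \<and> unitri_equiv n (u - 1\<^sub>m n) (diagram_matrix n S)"
  note c = strictly_upper_D(1)[OF minus_one_strictly_upper[OF u]]
  have "unitri_equiv n (diagram_matrix n S) (diagram_matrix n T)"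
    using unitri_equiv_trans[OF unitri_equiv_sym[of n "u - 1\<^sub>m n" "diagram_matrix n S"] eq] S c by simp
  then show "S = T" using canonical_form_unique S T by blast
qed (use T eq in simp)

lemma arc_type:
  fixes u :: "'f::field mat"
  assumes "u \<in> USL n"
  shows "arc_type n u \<in> arc_diagrams n (- {0})"
    "unitri_equiv n (u - 1\<^sub>m n) (diagram_matrix n (arc_type n u))"
proof -
  obtain T where T: "T \<in> arc_diagrams n (- {0})" "unitri_equiv n (u - 1\<^sub>m n) (diagram_matrix n T)"
    using canonical_form_exists[OF minus_one_strictly_upper[OF assms]] ..
  moreover have "arc_type n u = T" by (rule arc_type_eqI[OF assms T])
  ultimately show "arc_type n u \<in> arc_diagrams n (- {0})"
    "unitri_equiv n (u - 1\<^sub>m n) (diagram_matrix n (arc_type n u))" by simp_all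
qed

lemma arc_type_diagram_matrix:
  assumes "T \<in> arc_diagrams n (- {0})"
  shows "1\<^sub>m n + diagram_matrix n T \<in> USL n" "arc_type n (1\<^sub>m n + diagram_matrix n T) = T"
proof -
  show U: "1\<^sub>m n + diagram_matrix n T \<in> USL n"
    by (rule one_plus_USL[OF diagram_matrix_strictly_upper[OF assms]])
  show "arc_type n (1\<^sub>m n + diagram_matrix n T) = T"
    by (rule arc_type_eqI[OF U assms]) (simp add: one_plus_minus_one unitri_equiv_refl)
qed

lemma unitri_equiv_iff_arc_type:
  fixes u v :: "'f::field mat"
  assumes u: "u \<in> USL n" and v: "v \<in> USL n"
  shows "unitri_equiv n (u - 1\<^sub>m n) (v - 1\<^sub>m n) \<longleftrightarrow> arc_type n u = arc_type n v"
proof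
  note c = strictly_upper_D(1)[OF minus_one_strictly_upper[OF u]]
    strictly_upper_D(1)[OF minus_one_strictly_upper[OF v]]
  show "arc_type n u = arc_type n v" if "unitri_equiv n (u - 1\<^sub>m n) (v - 1\<^sub>m n)"
    using unitri_equiv_trans[OF that arc_type(2)[OF v]] c arc_type(1)[OF v] by (intro arc_type_eqI[OF u]) auto
  show "unitri_equiv n (u - 1\<^sub>m n) (v - 1\<^sub>m n)" if "arc_type n u = arc_type n v"
    using unitri_equiv_trans[OF arc_type(2)[OF u, unfolded that] unitri_equiv_sym[OF arc_type(2)[OF v]]] c
    by simp
qed

section \<open>Diagonal windows and shuffles of unitriangular matrices\<close>

text \<open>
  The windows at \<open>0\<close> and at \<open>m\<close> are the two diagonal blocks that enter the inflation product.
\<close>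

definition window :: "nat \<Rightarrow> nat \<Rightarrow> 'f mat \<Rightarrow> 'f mat"
  where "window m p x = mat p p (\<lambda>(i, j). x $$ (m + i, m + j))"

definition window_arcs :: "nat \<Rightarrow> nat \<Rightarrow> (nat \<times> nat \<times> 'c) set \<Rightarrow> (nat \<times> nat \<times> 'c) set"
  where "window_arcs m p T = {(i, j, c). j < p \<and> (m + i, m + j, c) \<in> T}"

lemma window_carrier [simp]: "window m p x \<in> carrier_mat p p"
  by (simp add: window_def)

lemma window_index [simp]: "i < p \<Longrightarrow> j < p \<Longrightarrow> window m p x $$ (i, j) = x $$ (m + i, m + j)"
  by (simp add: window_def)

text \<open>
  The entry \<open>(i, j)\<close> of a product of upper triangular matrices only involves indices between \<open>i\<close> and
  \<open>j\<close>, and a window is an interval of indices.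
\<close>

lemma window_mult:
  fixes x y :: "'f::field mat"
  assumes x: "x \<in> carrier_mat n n" "\<And>i j. j < i \<Longrightarrow> i < n \<Longrightarrow> x $$ (i, j) = 0"
    and y: "y \<in> carrier_mat n n" "\<And>i j. j < i \<Longrightarrow> i < n \<Longrightarrow> y $$ (i, j) = 0"
    and mp: "m + p \<le> n"
  shows "window m p (x * y) = window m p x * window m p y"
proof (rule eq_matI)
  fix i j assume "i < dim_row (window m p x * window m p y)" "j < dim_col (window m p x * window m p y)"
  then have ij: "i < p" "j < p" by (simp_all add: window_def)
  let ?f = "\<lambda>k. x $$ (m + i, k) * y $$ (k, m + j)"
  have "?f k = 0" if "k < n" "k \<notin> {m..<m + p}" for k
  proof (cases "k < m")
    case True
    then show ?thesis using x(2)[of k "m + i"] ij mp by simp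
  next
    case False
    then show ?thesis using y(2)[of "m + j" k] ij that by simp
  qed
  then have "(\<Sum>k<n. ?f k) = (\<Sum>k\<in>{m..<m + p}. ?f k)"
    using mp by (intro sum.mono_neutral_right) auto
  also have "\<dots> = (\<Sum>k<p. ?f (m + k))"
    by (rule sum.reindex_bij_betw[symmetric], rule bij_betwI[where g = "\<lambda>k. k - m"]) auto
  also have "\<dots> = (\<Sum>k<p. window m p x $$ (i, k) * window m p y $$ (k, j))"
    using ij by (intro sum.cong) auto
  finally show "window m p (x * y) $$ (i, j) = (window m p x * window m p y) $$ (i, j)"
    using ij mp by (simp add: mult_entry[OF window_carrier window_carrier] mult_entry[OF x(1) y(1)] del: index_mult_mat(1))
qed (simp_all add: window_def)

lemma window_USL:
  assumes u: "u \<in> USL n" and mp: "m + p \<le> n"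
  shows "window m p u \<in> USL p"
  using USL_D[OF u] mp by (intro USL_I) auto

lemma window_minus_one:
  assumes u: "u \<in> USL n" and mp: "m + p \<le> n"
  shows "window m p (u - 1\<^sub>m n) = window m p u - 1\<^sub>m p"
  using USL_D(1)[OF u] mp by (intro eq_matI) (auto simp: window_def)

lemma window_unitri_equiv:
  assumes "unitri_equiv n x y" and x: "x \<in> strictly_upper n" and y: "y \<in> strictly_upper n"
    and mp: "m + p \<le> n"
  shows "unitri_equiv p (window m p x) (window m p y)"
proof -
  obtain g h where gh: "g \<in> USL n" "h \<in> USL n" "g * x = y * h"
    using assms(1) unfolding unitri_equiv_def by blast
  have "window m p g * window m p x = window m p (g * x)"
    by (rule window_mult[symmetric, OF _ _ _ _ mp])
      (use USL_D[OF gh(1)] strictly_upper_D[OF x] in auto)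
  also have "\<dots> = window m p (y * h)" by (simp only: gh(3))
  also have "\<dots> = window m p y * window m p h"
    by (rule window_mult[OF _ _ _ _ mp])
      (use USL_D[OF gh(2)] strictly_upper_D[OF y] in auto)
  finally show ?thesis
    using window_USL[OF gh(1) mp] window_USL[OF gh(2) mp] unfolding unitri_equiv_def by blast
qed

lemma window_arcs_diagram:
  assumes T: "T \<in> arc_diagrams n C"
  shows "window_arcs m p T \<in> arc_diagrams p C"
proof (rule arc_diagramsI)
  fix i j c assume "(i, j, c) \<in> window_arcs m p T"
  then have ijc: "(m + i, m + j, c) \<in> T" "j < p" by (simp_all add: window_arcs_def)
  show "i < j \<and> j < p \<and> c \<in> C" using arc_diagramsD(1,3)[OF T ijc(1)] ijc(2) by simp
  show "j = j' \<and> c = c'" if "(i, j', c') \<in> window_arcs m p T" for j' c'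
    using arc_diagramsD(4)[OF T ijc(1), of "m + j'" c'] that by (simp add: window_arcs_def)
  show "i = i' \<and> c = c'" if "(i', j, c') \<in> window_arcs m p T" for i' c'
    using arc_diagramsD(5)[OF T ijc(1), of "m + i'" c'] that by (simp add: window_arcs_def)
qed

lemma window_diagram_matrix:
  assumes T: "T \<in> arc_diagrams n (- {0})" and mp: "m + p \<le> n"
  shows "diagram_matrix p (window_arcs m p T) = window m p (diagram_matrix n T)"
proof (rule diagram_matrix_eqI[OF window_arcs_diagram[OF T] window_carrier])
  fix i j c assume ij: "i < p" "j < p"
  then have "m + i < n" "m + j < n" using mp by auto
  from diagram_matrix_nonzero[OF T this, of c] ij
  show "(i, j, c) \<in> window_arcs m p T \<longleftrightarrow> window m p (diagram_matrix n T) $$ (i, j) = c \<and> c \<noteq> 0"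
    by (simp add: window_arcs_def)
qed

lemma arc_type_window:
  assumes u: "u \<in> USL n" and mp: "m + p \<le> n"
  shows "arc_type p (window m p u) = window_arcs m p (arc_type n u)"
proof (rule arc_type_eqI[OF window_USL[OF u mp] window_arcs_diagram[OF arc_type(1)[OF u]]])
  show "unitri_equiv p (window m p u - 1\<^sub>m p) (diagram_matrix p (window_arcs m p (arc_type n u)))"
    unfolding window_minus_one[OF u mp, symmetric] window_diagram_matrix[OF arc_type(1)[OF u] mp]
    by (rule window_unitri_equiv[OF arc_type(2)[OF u] minus_one_strictly_upper[OF u]
      diagram_matrix_strictly_upper[OF arc_type(1)[OF u]] mp])
qed

text \<open>
  Arcs of \<open>R\<close> between the two windows are not constrained on either side.  This is what makes the
  functions \<open>upset_function\<close> multiplicative.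
\<close>

lemma juxtapose_subset_iff:
  assumes S: "S \<in> arc_diagrams m C" and T: "T \<in> arc_diagrams n C"
  shows "S \<union> relabel_arcs (\<lambda>i. i + m) T \<subseteq> R \<longleftrightarrow> S \<subseteq> window_arcs 0 m R \<and> T \<subseteq> window_arcs m n R"
proof -
  have "S \<subseteq> R \<longleftrightarrow> S \<subseteq> window_arcs 0 m R"
  proof -
    have "(i, j, c) \<in> R \<longleftrightarrow> (i, j, c) \<in> window_arcs 0 m R" if "(i, j, c) \<in> S" for i j c
      using arc_diagramsD(2)[OF S that] by (simp add: window_arcs_def)
    then show ?thesis unfolding subset_iff split_paired_All by blast
  qed
  moreover have "relabel_arcs (\<lambda>i. i + m) T \<subseteq> R \<longleftrightarrow> T \<subseteq> window_arcs m n R"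
  proof -
    have "(i + m, j + m, c) \<in> R \<longleftrightarrow> (i, j, c) \<in> window_arcs m n R" if "(i, j, c) \<in> T" for i j c
      using arc_diagramsD(2)[OF T that] by (simp add: window_arcs_def add.commute)
    moreover have "relabel_arcs (\<lambda>i. i + m) T \<subseteq> R \<longleftrightarrow> (\<forall>i j c. (i, j, c) \<in> T \<longrightarrow> (i + m, j + m, c) \<in> R)"
      unfolding relabel_arcs_def by auto
    ultimately show ?thesis unfolding subset_iff split_paired_All by blast
  qed
  ultimately show ?thesis by simp
qed

text \<open>
  The matrix \<open>u\<close> in the split subgroup of \<open>A\<close> with \<open>u\<^sub>A = a\<close> and with \<open>b\<close> on the complement of \<open>A\<close>.
\<close>

definition shuffle_mat :: "nat \<Rightarrow> nat set \<Rightarrow> 'f::zero mat \<Rightarrow> 'f mat \<Rightarrow> 'f mat"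
  where "shuffle_mat N A a b = mat N N (\<lambda>(i, j).
    if i \<in> A \<and> j \<in> A then a $$ (pos_in A i, pos_in A j)
    else if i \<notin> A \<and> j \<notin> A then b $$ (pos_in ({..<N} - A) i, pos_in ({..<N} - A) j)
    else 0)"

definition unstd_arcs :: "nat set \<Rightarrow> (nat \<times> nat \<times> 'c) set \<Rightarrow> (nat \<times> nat \<times> 'c) set"
  where "unstd_arcs A T = {(i, j, c). i \<in> A \<and> j \<in> A \<and> (pos_in A i, pos_in A j, c) \<in> T}"

lemma pos_in_eq_iff: "finite A \<Longrightarrow> i \<in> A \<Longrightarrow> j \<in> A \<Longrightarrow> pos_in A i = pos_in A j \<longleftrightarrow> i = j"
  using bij_pos_in[of A] by (auto simp: bij_betw_def dest: inj_onD)

lemma pos_in_less_iff: "finite A \<Longrightarrow> i \<in> A \<Longrightarrow> j \<in> A \<Longrightarrow> pos_in A i < pos_in A j \<longleftrightarrow> i < j"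
  using strict_mono_on_less[OF strict_mono_pos_in] by blast

lemma pos_in_surj: "finite A \<Longrightarrow> r < card A \<Longrightarrow> \<exists>i\<in>A. pos_in A i = r"
  using bij_pos_in[of A] unfolding bij_betw_def by (metis imageE lessThan_iff)

locale shuffle =
  fixes N p q :: nat and A B :: "nat set"
  assumes A: "A \<subseteq> {..<N}" "card A = p" and B_def: "B = {..<N} - A" and q: "card B = q"
begin

lemma finite_A: "finite A" and finite_B: "finite B"
  using A(1) finite_subset[OF A(1)] by (auto simp: B_def)

lemma B_iff: "i < N \<Longrightarrow> i \<in> B \<longleftrightarrow> i \<notin> A"
  by (simp add: B_def)

lemma shuffle_carrier [simp]: "shuffle_mat N A a b \<in> carrier_mat N N"
  by (simp add: shuffle_mat_def)

lemma pos_A: "i \<in> A \<Longrightarrow> pos_in A i < p"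
  using pos_in_less[OF finite_A] A(2) by simp

lemma pos_B: "i \<in> B \<Longrightarrow> pos_in B i < q"
  using pos_in_less[OF finite_B] q by simp

lemma shuffle_index:
  "i \<in> A \<Longrightarrow> j \<in> A \<Longrightarrow> shuffle_mat N A a b $$ (i, j) = a $$ (pos_in A i, pos_in A j)"
  "i \<in> B \<Longrightarrow> j \<in> B \<Longrightarrow> shuffle_mat N A a b $$ (i, j) = b $$ (pos_in B i, pos_in B j)"
  "i \<in> A \<Longrightarrow> j \<in> B \<Longrightarrow> shuffle_mat N A a b $$ (i, j) = 0"
  "i \<in> B \<Longrightarrow> j \<in> A \<Longrightarrow> shuffle_mat N A a b $$ (i, j) = 0"
proof -
  have "k \<in> A \<Longrightarrow> k < N" "k \<in> B \<longleftrightarrow> k < N \<and> k \<notin> A" for k using A(1) by (auto simp: B_def)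
  then show "i \<in> A \<Longrightarrow> j \<in> A \<Longrightarrow> shuffle_mat N A a b $$ (i, j) = a $$ (pos_in A i, pos_in A j)"
    "i \<in> B \<Longrightarrow> j \<in> B \<Longrightarrow> shuffle_mat N A a b $$ (i, j) = b $$ (pos_in B i, pos_in B j)"
    "i \<in> A \<Longrightarrow> j \<in> B \<Longrightarrow> shuffle_mat N A a b $$ (i, j) = 0"
    "i \<in> B \<Longrightarrow> j \<in> A \<Longrightarrow> shuffle_mat N A a b $$ (i, j) = 0"
    unfolding shuffle_mat_def B_def[symmetric] by simp_all
qed

lemma index_cases:
  assumes "i < N" "j < N"
  obtains "i \<in> A" "j \<in> A" | "i \<in> B" "j \<in> B" | "i \<in> A" "j \<in> B" | "i \<in> B" "j \<in> A"
  using assms by (auto simp: B_def)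

lemma shuffle_mult:
  fixes a b :: "'f::field mat"
  assumes a: "a \<in> carrier_mat p p" "a' \<in> carrier_mat p p" and b: "b \<in> carrier_mat q q" "b' \<in> carrier_mat q q"
  shows "shuffle_mat N A (a * a') (b * b') = shuffle_mat N A a b * shuffle_mat N A a' b'"
proof (rule eq_matI)
  let ?x = "shuffle_mat N A a b" and ?y = "shuffle_mat N A a' b'"
  fix i j assume "i < dim_row (?x * ?y)" "j < dim_col (?x * ?y)"
  then have ij: "i < N" "j < N" by (simp_all add: shuffle_mat_def)
  let ?f = "\<lambda>k. ?x $$ (i, k) * ?y $$ (k, j)"
  have "(?x * ?y) $$ (i, j) = (\<Sum>k<N. ?f k)"
    by (rule mult_entry[OF shuffle_carrier shuffle_carrier ij])
  also have "{..<N} = A \<union> B" using A(1) by (auto simp: B_def)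
  also have "(\<Sum>k\<in>A \<union> B. ?f k) = (\<Sum>k\<in>A. ?f k) + (\<Sum>k\<in>B. ?f k)"
    using finite_A finite_B by (intro sum.union_disjoint) (auto simp: B_def)
  also have "\<dots> = shuffle_mat N A (a * a') (b * b') $$ (i, j)"
  proof (cases rule: index_cases[OF ij])
    case 1
    have "(\<Sum>k\<in>A. ?f k) = (\<Sum>k\<in>A. a $$ (pos_in A i, pos_in A k) * a' $$ (pos_in A k, pos_in A j))"
      using 1 by (intro sum.cong) (simp_all add: shuffle_index)
    also have "\<dots> = (\<Sum>k<p. a $$ (pos_in A i, k) * a' $$ (k, pos_in A j))"
      using sum.reindex_bij_betw[OF bij_pos_in[OF finite_A], of "\<lambda>k. a $$ (pos_in A i, k) * a' $$ (k, pos_in A j)"]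
      by (simp add: A(2))
    also have "\<dots> = (a * a') $$ (pos_in A i, pos_in A j)"
      by (rule mult_entry[OF a pos_A[OF 1(1)] pos_A[OF 1(2)], symmetric])
    finally show ?thesis using 1 by (simp add: shuffle_index)
  next
    case 2
    have "(\<Sum>k\<in>B. ?f k) = (\<Sum>k\<in>B. b $$ (pos_in B i, pos_in B k) * b' $$ (pos_in B k, pos_in B j))"
      using 2 by (intro sum.cong) (simp_all add: shuffle_index)
    also have "\<dots> = (\<Sum>k<q. b $$ (pos_in B i, k) * b' $$ (k, pos_in B j))"
      using sum.reindex_bij_betw[OF bij_pos_in[OF finite_B], of "\<lambda>k. b $$ (pos_in B i, k) * b' $$ (k, pos_in B j)"]
      by (simp add: q)
    also have "\<dots> = (b * b') $$ (pos_in B i, pos_in B j)"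
      by (rule mult_entry[OF b pos_B[OF 2(1)] pos_B[OF 2(2)], symmetric])
    finally show ?thesis using 2 by (simp add: shuffle_index)
  qed (simp_all add: shuffle_index)
  finally show "shuffle_mat N A (a * a') (b * b') $$ (i, j) = (?x * ?y) $$ (i, j)" ..
qed (simp_all add: shuffle_mat_def)

lemma shuffle_USL:
  assumes a: "a \<in> USL p" and b: "b \<in> USL q"
  shows "shuffle_mat N A a b \<in> USL N"
proof (rule USL_I[OF shuffle_carrier])
  show "shuffle_mat N A a b $$ (i, j) = 0" if "j < i" "i < N" for i j
  proof (cases rule: index_cases[OF that(2) less_trans[OF that]])
    case 1
    then show ?thesis
      using USL_D(2)[OF a _ pos_A[OF 1(1)], of "pos_in A j"] pos_in_less_iff[OF finite_A 1(2,1)] that(1)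
      by (simp add: shuffle_index)
  next
    case 2
    then show ?thesis
      using USL_D(2)[OF b _ pos_B[OF 2(1)], of "pos_in B j"] pos_in_less_iff[OF finite_B 2(2,1)] that(1)
      by (simp add: shuffle_index)
  qed (simp_all add: shuffle_index)
  show "shuffle_mat N A a b $$ (i, i) = 1" if "i < N" for i
    using USL_D(3)[OF a pos_A, of i] USL_D(3)[OF b pos_B, of i] B_iff[OF that]
    by (cases "i \<in> A") (simp_all add: shuffle_index)
qed

lemma shuffle_minus_one:
  fixes a b :: "'f::field mat"
  assumes a: "a \<in> carrier_mat p p" and b: "b \<in> carrier_mat q q"
  shows "shuffle_mat N A a b - 1\<^sub>m N = shuffle_mat N A (a - 1\<^sub>m p) (b - 1\<^sub>m q)"
proof (rule eq_matI)
  fix i j assume "i < dim_row (shuffle_mat N A (a - 1\<^sub>m p) (b - 1\<^sub>m q))"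
    "j < dim_col (shuffle_mat N A (a - 1\<^sub>m p) (b - 1\<^sub>m q))"
  then have ij: "i < N" "j < N" by (simp_all add: shuffle_mat_def)
  have "(shuffle_mat N A a b - 1\<^sub>m N) $$ (i, j) = shuffle_mat N A a b $$ (i, j) - (if i = j then 1 else 0)"
    using ij by simp
  also have "\<dots> = shuffle_mat N A (a - 1\<^sub>m p) (b - 1\<^sub>m q) $$ (i, j)"
  proof (cases rule: index_cases[OF ij])
    case 1
    then show ?thesis using pos_A a pos_in_eq_iff[OF finite_A] by (simp add: shuffle_index)
  next
    case 2
    then show ?thesis using pos_B b pos_in_eq_iff[OF finite_B] by (simp add: shuffle_index)
  next
    case 3
    then have "i \<noteq> j" by (auto simp: B_def)
    with 3 show ?thesis by (simp add: shuffle_index)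
  next
    case 4
    then have "i \<noteq> j" by (auto simp: B_def)
    with 4 show ?thesis by (simp add: shuffle_index)
  qed
  finally show "(shuffle_mat N A a b - 1\<^sub>m N) $$ (i, j) = shuffle_mat N A (a - 1\<^sub>m p) (b - 1\<^sub>m q) $$ (i, j)" .
qed (simp_all add: shuffle_mat_def)

lemma shuffle_unitri_equiv:
  assumes "unitri_equiv p a a'" "unitri_equiv q b b'"
    and a: "a \<in> carrier_mat p p" "a' \<in> carrier_mat p p" and b: "b \<in> carrier_mat q q" "b' \<in> carrier_mat q q"
  shows "unitri_equiv N (shuffle_mat N A a b) (shuffle_mat N A a' b')"
proof -
  obtain g h where gh: "g \<in> USL p" "h \<in> USL p" "g * a = a' * h"
    using assms(1) unfolding unitri_equiv_def by blast
  obtain g' h' where gh': "g' \<in> USL q" "h' \<in> USL q" "g' * b = b' * h'"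
    using assms(2) unfolding unitri_equiv_def by blast
  have "shuffle_mat N A g g' * shuffle_mat N A a b = shuffle_mat N A a' b' * shuffle_mat N A h h'"
    using gh(3) gh'(3)
      shuffle_mult[OF USL_D(1)[OF gh(1)] a(1) USL_D(1)[OF gh'(1)] b(1)]
      shuffle_mult[OF a(2) USL_D(1)[OF gh(2)] b(2) USL_D(1)[OF gh'(2)]] by simp
  then show ?thesis
    using shuffle_USL[OF gh(1) gh'(1)] shuffle_USL[OF gh(2) gh'(2)] unfolding unitri_equiv_def by blast
qed

lemma unstd_arcs_A: "(i, j, c) \<in> unstd_arcs A S \<Longrightarrow> i \<in> A \<and> j \<in> A \<and> (pos_in A i, pos_in A j, c) \<in> S"
  and unstd_arcs_B: "(i, j, c) \<in> unstd_arcs B T \<Longrightarrow> i \<in> B \<and> j \<in> B \<and> (pos_in B i, pos_in B j, c) \<in> T"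
  by (simp_all add: unstd_arcs_def)

lemma shuffle_arcs_diagram:
  assumes S: "S \<in> arc_diagrams p C" and T: "T \<in> arc_diagrams q C"
  shows "unstd_arcs A S \<union> unstd_arcs B T \<in> arc_diagrams N C"
proof (rule arc_diagramsI)
  fix i j c assume "(i, j, c) \<in> unstd_arcs A S \<union> unstd_arcs B T"
  then consider (left) "(i, j, c) \<in> unstd_arcs A S" | (right) "(i, j, c) \<in> unstd_arcs B T" by blast
  then show "i < j \<and> j < N \<and> c \<in> C"
  proof cases
    case left
    note * = unstd_arcs_A[OF left]
    then have "pos_in A i < pos_in A j" "c \<in> C"
      using arc_diagramsD(1)[OF S, of "pos_in A i" "pos_in A j" c]
        arc_diagramsD(3)[OF S, of "pos_in A i" "pos_in A j" c] by simp_all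
    with * show ?thesis using pos_in_less_iff[OF finite_A, of i j] A(1) by auto
  next
    case right
    note * = unstd_arcs_B[OF right]
    then have "pos_in B i < pos_in B j" "c \<in> C"
      using arc_diagramsD(1)[OF T, of "pos_in B i" "pos_in B j" c]
        arc_diagramsD(3)[OF T, of "pos_in B i" "pos_in B j" c] by simp_all
    with * show ?thesis using pos_in_less_iff[OF finite_B, of i j] by (auto simp: B_def)
  qed
next
  fix i j c j' c'
  assume 1: "(i, j, c) \<in> unstd_arcs A S \<union> unstd_arcs B T" and 2: "(i, j', c') \<in> unstd_arcs A S \<union> unstd_arcs B T"
  show "j = j' \<and> c = c'"
  proof (cases "i \<in> A")
    case True
    then have *: "(i, j, c) \<in> unstd_arcs A S" "(i, j', c') \<in> unstd_arcs A S"
      using 1 2 unstd_arcs_B[of i _ _ T] by (auto simp: B_def)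
    show ?thesis
      using unstd_arcs_A[OF *(1)] unstd_arcs_A[OF *(2)] pos_in_eq_iff[OF finite_A, of j' j]
        arc_diagramsD(4)[OF S, of "pos_in A i" "pos_in A j" c "pos_in A j'" c'] by simp
  next
    case False
    then have *: "(i, j, c) \<in> unstd_arcs B T" "(i, j', c') \<in> unstd_arcs B T"
      using 1 2 unstd_arcs_A[of i _ _ S] by auto
    show ?thesis
      using unstd_arcs_B[OF *(1)] unstd_arcs_B[OF *(2)] pos_in_eq_iff[OF finite_B, of j' j]
        arc_diagramsD(4)[OF T, of "pos_in B i" "pos_in B j" c "pos_in B j'" c'] by simp
  qed
next
  fix i j c i' c'
  assume 1: "(i, j, c) \<in> unstd_arcs A S \<union> unstd_arcs B T" and 2: "(i', j, c') \<in> unstd_arcs A S \<union> unstd_arcs B T"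
  show "i = i' \<and> c = c'"
  proof (cases "j \<in> A")
    case True
    then have *: "(i, j, c) \<in> unstd_arcs A S" "(i', j, c') \<in> unstd_arcs A S"
      using 1 2 unstd_arcs_B[of _ j _ T] by (auto simp: B_def)
    show ?thesis
      using unstd_arcs_A[OF *(1)] unstd_arcs_A[OF *(2)] pos_in_eq_iff[OF finite_A, of i' i]
        arc_diagramsD(5)[OF S, of "pos_in A i" "pos_in A j" c "pos_in A i'" c'] by simp
  next
    case False
    then have *: "(i, j, c) \<in> unstd_arcs B T" "(i', j, c') \<in> unstd_arcs B T"
      using 1 2 unstd_arcs_A[of _ j _ S] by auto
    show ?thesis
      using unstd_arcs_B[OF *(1)] unstd_arcs_B[OF *(2)] pos_in_eq_iff[OF finite_B, of i' i]
        arc_diagramsD(5)[OF T, of "pos_in B i" "pos_in B j" c "pos_in B i'" c'] by simp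
  qed
qed

lemma shuffle_diagram_matrix:
  assumes S: "S \<in> arc_diagrams p (- {0})" and T: "T \<in> arc_diagrams q (- {0})"
  shows "diagram_matrix N (unstd_arcs A S \<union> unstd_arcs B T) =
    shuffle_mat N A (diagram_matrix p S) (diagram_matrix q T)"
proof (rule diagram_matrix_eqI[OF shuffle_arcs_diagram[OF S T] shuffle_carrier])
  fix i j c assume ij: "i < N" "j < N"
  have notB: "k \<in> A \<Longrightarrow> k \<notin> B" for k by (simp add: B_def)
  show "(i, j, c) \<in> unstd_arcs A S \<union> unstd_arcs B T \<longleftrightarrow>
    shuffle_mat N A (diagram_matrix p S) (diagram_matrix q T) $$ (i, j) = c \<and> c \<noteq> 0"
  proof (cases rule: index_cases[OF ij])
    case 1
    with diagram_matrix_nonzero[OF S pos_A[OF 1(1)] pos_A[OF 1(2)], of c] notB show ?thesis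
      by (simp add: shuffle_index unstd_arcs_def)
  next
    case 2
    with diagram_matrix_nonzero[OF T pos_B[OF 2(1)] pos_B[OF 2(2)], of c] show ?thesis
      by (simp add: shuffle_index unstd_arcs_def) (simp add: B_def)
  next
    case 3
    with notB show ?thesis by (auto simp add: shuffle_index unstd_arcs_def)
  next
    case 4
    with notB show ?thesis by (auto simp add: shuffle_index unstd_arcs_def)
  qed
qed

lemma arc_type_shuffle:
  assumes a: "a \<in> USL p" and b: "b \<in> USL q"
  shows "arc_type N (shuffle_mat N A a b) = unstd_arcs A (arc_type p a) \<union> unstd_arcs B (arc_type q b)"
proof (rule arc_type_eqI[OF shuffle_USL[OF a b] shuffle_arcs_diagram[OF arc_type(1)[OF a] arc_type(1)[OF b]]])
  show "unitri_equiv N (shuffle_mat N A a b - 1\<^sub>m N)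
    (diagram_matrix N (unstd_arcs A (arc_type p a) \<union> unstd_arcs B (arc_type q b)))"
    unfolding shuffle_minus_one[OF USL_D(1)[OF a] USL_D(1)[OF b]]
      shuffle_diagram_matrix[OF arc_type(1)[OF a] arc_type(1)[OF b]]
    by (rule shuffle_unitri_equiv[OF arc_type(2)[OF a] arc_type(2)[OF b]
      strictly_upper_D(1)[OF minus_one_strictly_upper[OF a]] diagram_matrix_carrier
      strictly_upper_D(1)[OF minus_one_strictly_upper[OF b]] diagram_matrix_carrier])
qed

text \<open>
  The diagram of a shuffle has no arc between \<open>A\<close> and \<open>B\<close>, so a diagram contained in it is split by
  \<open>A\<close>.
\<close>

lemma subset_shuffle_arcs_iff:
  assumes R: "R \<in> arc_diagrams N C"
  shows "R \<subseteq> unstd_arcs A S \<union> unstd_arcs B T \<longleftrightarrow>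
    splits A R \<and> std_arcs A R \<subseteq> S \<and> std_arcs B R \<subseteq> T"
proof
  assume sub: "R \<subseteq> unstd_arcs A S \<union> unstd_arcs B T"
  have notB: "k \<in> A \<Longrightarrow> k \<notin> B" for k by (simp add: B_def)
  have cases: "(i, j, c) \<in> unstd_arcs A S \<or> (i, j, c) \<in> unstd_arcs B T" if "(i, j, c) \<in> R" for i j c
    using subsetD[OF sub that] by simp
  have "i \<in> A \<longleftrightarrow> j \<in> A" if "(i, j, c) \<in> R" for i j c
    using cases[OF that] unstd_arcs_A[of i j c S] unstd_arcs_B[of i j c T] notB[of i] notB[of j] by blast
  then have "splits A R" unfolding splits_def by blast
  moreover have "(pos_in A i, pos_in A j, c) \<in> S" if "(i, j, c) \<in> R" "i \<in> A" "j \<in> A" for i j c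
    using cases[OF that(1)] that(2) unstd_arcs_A[of i j c S] unstd_arcs_B[of i j c T] notB[of i] by blast
  then have "std_arcs A R \<subseteq> S" unfolding std_arcs_def relabel_arcs_def arcs_within_def by auto
  moreover have "(pos_in B i, pos_in B j, c) \<in> T" if "(i, j, c) \<in> R" "i \<in> B" "j \<in> B" for i j c
    using cases[OF that(1)] that(2) unstd_arcs_A[of i j c S] unstd_arcs_B[of i j c T] notB[of i] by blast
  then have "std_arcs B R \<subseteq> T" unfolding std_arcs_def relabel_arcs_def arcs_within_def by auto
  ultimately show "splits A R \<and> std_arcs A R \<subseteq> S \<and> std_arcs B R \<subseteq> T" by blast
next
  assume *: "splits A R \<and> std_arcs A R \<subseteq> S \<and> std_arcs B R \<subseteq> T"
  show "R \<subseteq> unstd_arcs A S \<union> unstd_arcs B T"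
  proof
    fix t assume "t \<in> R"
    then obtain i j c where t: "t = (i, j, c)" "(i, j, c) \<in> R" by (cases t) auto
    have ij: "i < N" "j < N" using arc_diagramsD(1,2)[OF R t(2)] by auto
    from * have "splits A R" by simp
    from this[unfolded splits_def, rule_format, OF t(2)] have iff: "i \<in> A \<longleftrightarrow> j \<in> A" by simp
    show "t \<in> unstd_arcs A S \<union> unstd_arcs B T"
    proof (cases "i \<in> A")
      case True
      then have "(pos_in A i, pos_in A j, c) \<in> std_arcs A R"
        unfolding std_arcs_def mem_relabel_arcs mem_arcs_within using t iff by blast
      then have "(pos_in A i, pos_in A j, c) \<in> S" using * by blast
      then show ?thesis using True iff t(1) by (simp add: unstd_arcs_def)
    next
      case False
      then have "i \<in> B" "j \<in> B" using iff ij by (simp_all add: B_def)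
      then have "(pos_in B i, pos_in B j, c) \<in> std_arcs B R"
        unfolding std_arcs_def mem_relabel_arcs mem_arcs_within using t by blast
      then have "(pos_in B i, pos_in B j, c) \<in> T" using * by blast
      then show ?thesis using \<open>i \<in> B\<close> \<open>j \<in> B\<close> t(1) by (simp add: unstd_arcs_def)
    qed
  qed
qed

lemma submatrix_pos:
  assumes "u \<in> carrier_mat N N" "K \<subseteq> {..<N}" "i \<in> K" "j \<in> K"
  shows "submatrix u K K $$ (pos_in K i, pos_in K j) = u $$ (i, j)"
proof -
  have "i < dim_row u" "j < dim_col u" using assms by auto
  from submatrix_index_card[OF this assms(3,4)] show ?thesis unfolding pos_in_def .
qed

lemma submatrix_carrier:
  assumes "u \<in> carrier_mat N N" "K \<subseteq> {..<N}"
  shows "submatrix u K K \<in> carrier_mat (card K) (card K)"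
proof -
  have K: "{i. i < N \<and> i \<in> K} = K" using assms(2) by auto
  show ?thesis
    by (rule carrier_matI; unfold dim_submatrix carrier_matD[OF assms(1)] K) (rule refl)+
qed

lemma mat_eq_by_pos:
  assumes "finite K" "x \<in> carrier_mat (card K) (card K)" "y \<in> carrier_mat (card K) (card K)"
    and "\<And>i j. i \<in> K \<Longrightarrow> j \<in> K \<Longrightarrow> x $$ (pos_in K i, pos_in K j) = y $$ (pos_in K i, pos_in K j)"
  shows "x = y"
proof (rule eq_matI)
  fix r s assume "r < dim_row y" "s < dim_col y"
  then have "r < card K" "s < card K" using assms(3) by auto
  from pos_in_surj[OF assms(1) this(1)] pos_in_surj[OF assms(1) this(2)]
  obtain i j where "i \<in> K" "j \<in> K" "pos_in K i = r" "pos_in K j = s" by blast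
  then show "x $$ (r, s) = y $$ (r, s)" using assms(4)[of i j] by simp
qed (use assms(2,3) in auto)

lemma submatrix_shuffle:
  assumes a: "a \<in> carrier_mat p p" and b: "b \<in> carrier_mat q q"
  shows "submatrix (shuffle_mat N A a b) A A = a" "submatrix (shuffle_mat N A a b) B B = b"
proof -
  have B: "B \<subseteq> {..<N}" by (auto simp: B_def)
  show "submatrix (shuffle_mat N A a b) A A = a"
  proof (rule mat_eq_by_pos[OF finite_A submatrix_carrier[OF shuffle_carrier A(1)]])
    show "a \<in> carrier_mat (card A) (card A)" using a A(2) by simp
    show "submatrix (shuffle_mat N A a b) A A $$ (pos_in A i, pos_in A j) = a $$ (pos_in A i, pos_in A j)"
      if "i \<in> A" "j \<in> A" for i j
      unfolding submatrix_pos[OF shuffle_carrier A(1) that] by (rule shuffle_index(1)[OF that])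
  qed
  show "submatrix (shuffle_mat N A a b) B B = b"
  proof (rule mat_eq_by_pos[OF finite_B submatrix_carrier[OF shuffle_carrier B]])
    show "b \<in> carrier_mat (card B) (card B)" using b q by simp
    show "submatrix (shuffle_mat N A a b) B B $$ (pos_in B i, pos_in B j) = b $$ (pos_in B i, pos_in B j)"
      if "i \<in> B" "j \<in> B" for i j
      unfolding submatrix_pos[OF shuffle_carrier B that] by (rule shuffle_index(2)[OF that])
  qed
qed

lemma shuffle_submatrix:
  assumes u: "u \<in> USL_split_subgroup N A"
  shows "shuffle_mat N A (submatrix u A A) (submatrix u B B) = u"
proof -
  have U: "u \<in> USL N" and zero: "i < j \<Longrightarrow> j < N \<Longrightarrow> (i \<in> A) \<noteq> (j \<in> A) \<Longrightarrow> u $$ (i, j) = 0" for i j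
    using u unfolding USL_split_subgroup_def mem_Collect_eq by blast+
  note uc = USL_D(1)[OF U]
  have B: "B \<subseteq> {..<N}" by (auto simp: B_def)
  show ?thesis
  proof (rule eq_matI)
    fix i j assume "i < dim_row u" "j < dim_col u"
    then have ij: "i < N" "j < N" using uc by auto
    have zero': "u $$ (i, j) = 0" if "(i \<in> A) \<noteq> (j \<in> A)"
    proof (cases i j rule: linorder_cases)
      case less
      then show ?thesis using zero[OF less ij(2) that] by simp
    next
      case equal
      with that show ?thesis by simp
    next
      case greater
      then show ?thesis using USL_D(2)[OF U greater ij(1)] by simp
    qed
    show "shuffle_mat N A (submatrix u A A) (submatrix u B B) $$ (i, j) = u $$ (i, j)"
    proof (cases rule: index_cases[OF ij])
      case 1
      then show ?thesis by (simp add: shuffle_index submatrix_pos[OF uc A(1)])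
    next
      case 2
      then show ?thesis by (simp add: shuffle_index submatrix_pos[OF uc B])
    next
      case 3
      then show ?thesis using zero' B_iff[OF ij(2)] by (simp add: shuffle_index)
    next
      case 4
      then show ?thesis using zero' B_iff[OF ij(1)] by (simp add: shuffle_index)
    qed
  qed (use uc in \<open>simp_all add: shuffle_mat_def\<close>)
qed

lemma the_inv_into_split_subgroup:
  fixes a b :: "'f::field mat"
  assumes a: "a \<in> USL p" and b: "b \<in> USL q"
  shows "the_inv_into (USL_split_subgroup N A) (\<lambda>u. (submatrix u A A, submatrix u ({..<N} - A) ({..<N} - A))) (a, b)
    = shuffle_mat N A a b"
proof (rule the_inv_into_f_eq)
  show "inj_on (\<lambda>u :: 'f mat. (submatrix u A A, submatrix u ({..<N} - A) ({..<N} - A))) (USL_split_subgroup N A)"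
  proof (rule inj_onI)
    fix u v :: "'f mat"
    assume u: "u \<in> USL_split_subgroup N A" and v: "v \<in> USL_split_subgroup N A"
      and eq: "(submatrix u A A, submatrix u ({..<N} - A) ({..<N} - A)) =
        (submatrix v A A, submatrix v ({..<N} - A) ({..<N} - A))"
    have eqA: "submatrix u A A = submatrix v A A" using eq by (rule Pair_inject)
    have eqB: "submatrix u B B = submatrix v B B" unfolding B_def using eq by (rule Pair_inject)
    have "u = shuffle_mat N A (submatrix u A A) (submatrix u B B)" by (rule shuffle_submatrix[OF u, symmetric])
    also have "\<dots> = shuffle_mat N A (submatrix v A A) (submatrix v B B)" by (simp only: eqA eqB)
    also have "\<dots> = v" by (rule shuffle_submatrix[OF v])
    finally show "u = v" .
  qed
  show "(submatrix (shuffle_mat N A a b) A A, submatrix (shuffle_mat N A a b) ({..<N} - A) ({..<N} - A)) = (a, b)"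
    unfolding B_def[symmetric] submatrix_shuffle[OF USL_D(1)[OF a] USL_D(1)[OF b]] ..
  have "shuffle_mat N A a b $$ (i, j) = 0" if "i < j" "j < N" "(i \<in> A) \<noteq> (j \<in> A)" for i j
    using that A(1) by (auto simp: shuffle_mat_def)
  then show "shuffle_mat N A a b \<in> USL_split_subgroup N A"
    unfolding USL_split_subgroup_def using shuffle_USL[OF a b] by blast
qed

end

section \<open>Superclass functions on unitriangular groups\<close>

text \<open>
  The indicator function of the union of all superclasses whose type contains \<open>T\<close>.  In terms of the
  indicators of single superclasses, it is the sum over all diagrams that arise from \<open>T\<close> by adding
  arcs.
\<close>

definition upset_function :: "nat \<Rightarrow> (nat \<times> nat \<times> 'f) set \<Rightarrow> 'f::field mat \<Rightarrow> 'k::field"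
  where "upset_function n T u = (if u \<in> USL n \<and> T \<subseteq> arc_type n u then 1 else 0)"

lemma sum_fun_apply: "(\<Sum>i\<in>I. f i) x = (\<Sum>i\<in>I. f i x :: 'k::comm_monoid_add)"
  by (induction I rule: infinite_finite_induct) (simp_all add: zero_fun_def plus_fun_def)

lemma USL_size: "u \<in> USL m \<Longrightarrow> u \<in> USL n \<Longrightarrow> m = n"
  by (metis USL_D(1) carrier_matD(1))

lemma mem_class_functions_USL_iff:
  fixes \<phi> :: "'f::field mat \<Rightarrow> 'k::field"
  shows "\<phi> \<in> class_functions (USL_superclasses n) \<longleftrightarrow>
    (\<forall>u. u \<notin> USL n \<longrightarrow> \<phi> u = 0) \<and>
    (\<forall>u\<in>USL n. \<forall>v\<in>USL n. arc_type n u = arc_type n v \<longrightarrow> \<phi> u = \<phi> v)"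
proof -
  have mem: "v \<in> superclass n u \<longleftrightarrow> v \<in> USL n \<and> arc_type n u = arc_type n v"
    if "u \<in> USL n" for u v :: "'f mat"
    using mem_superclass_iff[OF that] unitri_equiv_iff_arc_type[OF that] by blast
  have un: "\<Union>(USL_superclasses n) = (USL n :: 'f mat set)"
    unfolding USL_superclasses_def using mem by blast
  have "(\<forall>C\<in>USL_superclasses n. \<forall>x\<in>C. \<forall>y\<in>C. \<phi> x = \<phi> y) \<longleftrightarrow>
    (\<forall>u\<in>USL n. \<forall>v\<in>USL n. arc_type n u = arc_type n v \<longrightarrow> \<phi> u = \<phi> v)" (is "?L \<longleftrightarrow> ?R")
  proof
    assume L: ?L
    show ?R
    proof (intro ballI impI)
      fix u v :: "'f mat" assume uv: "u \<in> USL n" "v \<in> USL n" "arc_type n u = arc_type n v"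
      have "superclass n u \<in> USL_superclasses n" using uv(1) unfolding USL_superclasses_def by blast
      moreover have "u \<in> superclass n u" "v \<in> superclass n u" using mem[OF uv(1)] uv by simp_all
      ultimately show "\<phi> u = \<phi> v" using L by blast
    qed
  next
    assume R: ?R
    show ?L
    proof (intro ballI)
      fix C and x y :: "'f mat" assume "C \<in> USL_superclasses n" and xy: "x \<in> C" "y \<in> C"
      then obtain u where u: "u \<in> USL n" "C = superclass n u" unfolding USL_superclasses_def by blast
      have "x \<in> USL n" "y \<in> USL n" "arc_type n x = arc_type n y" using xy mem[OF u(1)] u(2) by simp_all
      then show "\<phi> x = \<phi> y" using R by blast
    qed
  qed
  then show ?thesis unfolding class_functions_def mem_Collect_eq un by simp
qed

lemma subspace_class_functions: "fun_vs.subspace (class_functions \<C> :: ('a \<Rightarrow> 'k::field) set)"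
proof (rule fun_vs.subspaceI)
  show "0 \<in> class_functions \<C>" by (simp add: class_functions_def zero_fun_def)
next
  fix f g :: "'a \<Rightarrow> 'k" assume f: "f \<in> class_functions \<C>" and g: "g \<in> class_functions \<C>"
  have "(f + g) x = 0" if "x \<notin> \<Union>\<C>" for x
    using f g that unfolding class_functions_def plus_fun_def by simp
  moreover have "(f + g) x = (f + g) y" if "C \<in> \<C>" "x \<in> C" "y \<in> C" for C x y
  proof -
    have "f x = f y" "g x = g y" using f g that unfolding class_functions_def by blast+
    then show ?thesis by (simp only: plus_fun_def)
  qed
  ultimately show "f + g \<in> class_functions \<C>" unfolding class_functions_def by blast
next
  fix c and f :: "'a \<Rightarrow> 'k" assume f: "f \<in> class_functions \<C>"
  have "(c *\<^sub>f f) x = 0" if "x \<notin> \<Union>\<C>" for x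
    using f that unfolding class_functions_def fscale_def by simp
  moreover have "(c *\<^sub>f f) x = (c *\<^sub>f f) y" if "C \<in> \<C>" "x \<in> C" "y \<in> C" for C x y
  proof -
    have "f x = f y" using f that unfolding class_functions_def by blast
    then show ?thesis by (simp only: fscale_def)
  qed
  ultimately show "c *\<^sub>f f \<in> class_functions \<C>" unfolding class_functions_def by blast
qed

lemma upset_function_class: "upset_function n T \<in> class_functions (USL_superclasses n)"
  unfolding mem_class_functions_USL_iff upset_function_def by auto

lemma upset_function_diagram_matrix:
  assumes "S \<in> arc_diagrams n (- {0})"
  shows "upset_function n T (1\<^sub>m n + diagram_matrix n S) = (if T \<subseteq> S then 1 else 0)"
  using arc_type_diagram_matrix[OF assms] by (simp add: upset_function_def)

lemma inj_upset_function:
  "inj_on (upset_function n :: _ \<Rightarrow> 'f::field mat \<Rightarrow> 'k::field) (arc_diagrams n (- {0}))"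
proof (rule inj_onI)
  fix S T :: "(nat \<times> nat \<times> 'f) set"
  assume S: "S \<in> arc_diagrams n (- {0})" and T: "T \<in> arc_diagrams n (- {0})"
    and eq: "(upset_function n S :: _ \<Rightarrow> 'k) = upset_function n T"
  have "S \<subseteq> T"
  proof -
    have "(if S \<subseteq> T then 1 else 0) = (if T \<subseteq> T then 1 else (0 :: 'k))"
      using fun_cong[OF eq, of "1\<^sub>m n + diagram_matrix n T"]
      unfolding upset_function_diagram_matrix[OF T] .
    then show ?thesis by (simp split: if_splits)
  qed
  moreover have "T \<subseteq> S"
  proof -
    have "(if S \<subseteq> S then 1 else 0) = (if T \<subseteq> S then 1 else (0 :: 'k))"
      using fun_cong[OF eq, of "1\<^sub>m n + diagram_matrix n S"]
      unfolding upset_function_diagram_matrix[OF S] .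
    then show ?thesis by (simp split: if_splits)
  qed
  ultimately show "S = T" by simp
qed

lemma finite_diagrams: "finite (arc_diagrams n (- {0 :: 'f::{field,finite}}))"
  by (rule finite_arc_diagrams) simp

lemma finite_diagram:
  assumes "T \<in> arc_diagrams n (C :: 'c::finite set)"
  shows "finite T"
proof (rule finite_subset)
  show "T \<subseteq> {..<n} \<times> {..<n} \<times> UNIV"
  proof
    fix t assume "t \<in> T"
    then show "t \<in> {..<n} \<times> {..<n} \<times> UNIV"
      using arc_diagramsD(1,2)[OF assms, of "fst t" "fst (snd t)" "snd (snd t)"] by (cases t) simp
  qed
qed simp

text \<open>
  On the canonical matrices, \<open>upset_function n T\<close> takes the value \<open>1\<close> at \<open>S\<close> if \<open>T \<subseteq> S\<close> and \<open>0\<close>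
  otherwise: a system that is unitriangular with respect to inclusion.
\<close>

lemma independent_upset_functions:
  "fun_vs.independent ((upset_function n :: _ \<Rightarrow> 'f::{field,finite} mat \<Rightarrow> 'k::field) ` arc_diagrams n (- {0}))"
proof (rule fun_vs.independent_if_scalars_zero)
  let ?P = "upset_function n :: _ \<Rightarrow> 'f mat \<Rightarrow> 'k" and ?D = "arc_diagrams n (- {0 :: 'f})"
  fix a v assume sum0: "(\<Sum>v\<in>?P ` ?D. a v *\<^sub>f v) = 0" and v: "v \<in> ?P ` ?D"
  have sum0': "(\<Sum>T\<in>?D. a (?P T) *\<^sub>f ?P T) = 0"
    using sum0 unfolding sum.reindex[OF inj_upset_function] comp_def .
  have "a (?P S) = 0" if "S \<in> ?D" for S
    using finite_diagram[OF that] that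
  proof (induction S rule: finite_psubset_induct)
    case (psubset S)
    have "0 = (\<Sum>T\<in>?D. a (?P T) *\<^sub>f ?P T) (1\<^sub>m n + diagram_matrix n S)"
      by (simp add: sum0' zero_fun_def)
    also have "\<dots> = (\<Sum>T\<in>?D. if T \<subseteq> S then a (?P T) else 0)"
      unfolding sum_fun_apply fscale_def upset_function_diagram_matrix[OF psubset.prems]
      by (rule sum.cong) auto
    also have "\<dots> = (\<Sum>T\<in>{S}. if T \<subseteq> S then a (?P T) else 0)"
    proof (rule sum.mono_neutral_right[OF finite_diagrams])
      show "\<forall>T\<in>?D - {S}. (if T \<subseteq> S then a (?P T) else 0) = 0"
        using psubset.IH by auto
    qed (use psubset.prems in simp)
    finally show ?case by simp
  qed
  with v show "a v = 0" by blast
qed (simp add: finite_diagrams)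

text \<open>
  The indicator \<open>\<kappa> T\<close> of the superclass of type \<open>T\<close> is \<open>upset_function n T\<close> minus the sum of all \<open>\<kappa> S\<close>
  for diagrams \<open>S\<close> that properly contain \<open>T\<close>; this inverts the system by induction from the largest
  diagrams downwards.
\<close>

lemma span_upset_functions:
  "fun_vs.span ((upset_function n :: _ \<Rightarrow> 'f::{field,finite} mat \<Rightarrow> 'k::field) ` arc_diagrams n (- {0})) =
    class_functions (USL_superclasses n)"
proof (rule antisym)
  let ?P = "upset_function n :: _ \<Rightarrow> 'f mat \<Rightarrow> 'k" and ?D = "arc_diagrams n (- {0 :: 'f})"
  show "fun_vs.span (?P ` ?D) \<subseteq> class_functions (USL_superclasses n)"
    using upset_function_class by (intro fun_vs.span_minimal subspace_class_functions) blast
  define \<kappa> :: "(nat \<times> nat \<times> 'f) set \<Rightarrow> 'f mat \<Rightarrow> 'k"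
    where "\<kappa> = (\<lambda>T u. if u \<in> USL n \<and> arc_type n u = T then 1 else 0)"
  have span: "\<kappa> T \<in> fun_vs.span (?P ` ?D)" if "T \<in> ?D" for T
    using that
  proof (induction "card {S \<in> ?D. T \<subset> S}" arbitrary: T rule: less_induct)
    case less
    have "?P T = (\<Sum>S\<in>{S \<in> ?D. T \<subseteq> S}. \<kappa> S)"
    proof
      fix u
      show "?P T u = (\<Sum>S\<in>{S \<in> ?D. T \<subseteq> S}. \<kappa> S) u"
      proof (cases "u \<in> USL n")
        case True
        have "(\<Sum>S\<in>{S \<in> ?D. T \<subseteq> S}. \<kappa> S u) = (\<Sum>S\<in>{S \<in> ?D. T \<subseteq> S}. if S = arc_type n u then 1 else 0)"
          unfolding \<kappa>_def using True by (intro sum.cong) auto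
        also have "\<dots> = ?P T u"
          using True arc_type(1)[OF True] by (simp add: sum.delta finite_diagrams upset_function_def)
        finally show ?thesis unfolding sum_fun_apply ..
      next
        case False
        then show ?thesis unfolding sum_fun_apply by (simp add: \<kappa>_def upset_function_def)
      qed
    qed
    also have "{S \<in> ?D. T \<subseteq> S} = insert T {S \<in> ?D. T \<subset> S}" using less.prems by blast
    also have "(\<Sum>S\<in>insert T {S \<in> ?D. T \<subset> S}. \<kappa> S) = \<kappa> T + (\<Sum>S\<in>{S \<in> ?D. T \<subset> S}. \<kappa> S)"
      by (rule sum.insert) (simp_all add: finite_diagrams)
    finally have eq: "\<kappa> T = ?P T - (\<Sum>S\<in>{S \<in> ?D. T \<subset> S}. \<kappa> S)" by simp
    have "\<kappa> S \<in> fun_vs.span (?P ` ?D)" if S: "S \<in> ?D" "T \<subset> S" for S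
    proof (rule less.hyps[OF _ S(1)])
      show "card {R \<in> ?D. S \<subset> R} < card {R \<in> ?D. T \<subset> R}"
        using S by (intro psubset_card_mono) (auto simp: finite_diagrams)
    qed
    moreover have "?P T \<in> fun_vs.span (?P ` ?D)" using less.prems by (intro fun_vs.span_base) blast
    ultimately show ?case unfolding eq by (intro fun_vs.span_diff fun_vs.span_sum) blast+
  qed
  show "class_functions (USL_superclasses n) \<subseteq> fun_vs.span (?P ` ?D)"
  proof
    fix \<phi> :: "'f mat \<Rightarrow> 'k" assume "\<phi> \<in> class_functions (USL_superclasses n)"
    then have \<phi>: "u \<notin> USL n \<Longrightarrow> \<phi> u = 0"
      "u \<in> USL n \<Longrightarrow> v \<in> USL n \<Longrightarrow> arc_type n u = arc_type n v \<Longrightarrow> \<phi> u = \<phi> v" for u v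
      unfolding mem_class_functions_USL_iff by blast+
    have "\<phi> = (\<Sum>T\<in>?D. \<phi> (1\<^sub>m n + diagram_matrix n T) *\<^sub>f \<kappa> T)"
    proof
      fix u
      show "\<phi> u = (\<Sum>T\<in>?D. \<phi> (1\<^sub>m n + diagram_matrix n T) *\<^sub>f \<kappa> T) u"
      proof (cases "u \<in> USL n")
        case True
        have "(\<Sum>T\<in>?D. \<phi> (1\<^sub>m n + diagram_matrix n T) * \<kappa> T u) =
          (\<Sum>T\<in>{arc_type n u}. \<phi> (1\<^sub>m n + diagram_matrix n T) * \<kappa> T u)"
          using arc_type(1)[OF True] by (intro sum.mono_neutral_right finite_diagrams) (auto simp: \<kappa>_def)
        also have "\<dots> = \<phi> u"
          using \<phi>(2)[OF arc_type_diagram_matrix(1)[OF arc_type(1)[OF True]] True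
            arc_type_diagram_matrix(2)[OF arc_type(1)[OF True]]] True
          by (simp add: \<kappa>_def)
        finally show ?thesis unfolding sum_fun_apply fscale_def ..
      next
        case False
        then show ?thesis unfolding sum_fun_apply fscale_def by (simp add: \<kappa>_def \<phi>(1))
      qed
    qed
    also have "\<dots> \<in> fun_vs.span (?P ` ?D)"
      by (intro fun_vs.span_sum fun_vs.span_scale span)
    finally show "\<phi> \<in> fun_vs.span (?P ` ?D)" .
  qed
qed

text \<open>
  The degree of a function is the size of the matrices on which it lives.
\<close>

lemma class_functions_USL_direct:
  fixes F :: "nat \<Rightarrow> 'f::field mat \<Rightarrow> 'k::field"
  assumes F: "\<And>n. F n \<in> class_functions (USL_superclasses n)" and sum0: "(\<Sum>n<N. F n) = 0" and i: "i < N"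
  shows "F i = 0"
proof
  fix u
  have zero: "F n u = 0" if "u \<notin> USL n" for n u
    using F[of n] that unfolding mem_class_functions_USL_iff by blast
  show "F i u = 0 u"
  proof (cases "u \<in> USL i")
    case True
    have "0 = (\<Sum>n<N. F n) u" by (simp add: sum0 zero_fun_def)
    also have "\<dots> = (\<Sum>n\<in>{i}. F n u)"
    proof -
      have "F n u = 0" if "n \<noteq> i" for n using zero[of u n] USL_size[OF True, of n] that by blast
      then show ?thesis unfolding sum_fun_apply using i by (intro sum.mono_neutral_right) auto
    qed
    finally show ?thesis by (simp add: zero_fun_def)
  next
    case False
    then show ?thesis by (simp add: zero zero_fun_def)
  qed
qed

lemma submatrix_interval:
  assumes u: "u \<in> carrier_mat N N" and "m \<le> k" "k \<le> N"
  shows "submatrix u {m..<k} {m..<k} = window m (k - m) u"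
proof (rule eq_matI)
  have card: "card {i. i < N \<and> i \<in> {m..<k}} = k - m"
  proof -
    have "{i. i < N \<and> i \<in> {m..<k}} = {m..<k}" using assms by auto
    then show ?thesis by simp
  qed
  show "dim_row (submatrix u {m..<k} {m..<k}) = dim_row (window m (k - m) u)"
    "dim_col (submatrix u {m..<k} {m..<k}) = dim_col (window m (k - m) u)"
    unfolding dim_submatrix carrier_matD[OF u] card by (simp_all add: window_def)
  fix i j assume "i < dim_row (window m (k - m) u)" "j < dim_col (window m (k - m) u)"
  then have ij: "i < k - m" "j < k - m" by (simp_all add: window_def)
  have pos: "card {a \<in> {m..<k}. a < m + r} = r" if "r < k - m" for r
  proof -
    have "{a \<in> {m..<k}. a < m + r} = {m..<m + r}" using that by auto
    then show ?thesis by simp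
  qed
  have "submatrix u {m..<k} {m..<k} $$ (i, j) = u $$ (m + i, m + j)"
  proof -
    have "m + i < dim_row u" "m + j < dim_col u" "m + i \<in> {m..<k}" "m + j \<in> {m..<k}"
      using u ij assms(2,3) by auto
    from submatrix_index_card[OF this] show ?thesis unfolding pos[OF ij(1)] pos[OF ij(2)] .
  qed
  then show "submatrix u {m..<k} {m..<k} $$ (i, j) = window m (k - m) u $$ (i, j)" using ij by simp
qed

text \<open>
  Of the sum that defines \<open>USL_prod\<close> only the term with a window of size \<open>m\<close> survives, and it is
  evaluated by \<open>arc_type_window\<close> and \<open>juxtapose_subset_iff\<close>.
\<close>

lemma USL_prod_upset_functions:
  fixes S T :: "(nat \<times> nat \<times> 'f::field) set"
  assumes S: "S \<in> arc_diagrams m (- {0})" and T: "T \<in> arc_diagrams n (- {0})"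
  shows "USL_prod (upset_function m S) (upset_function n T) =
    (upset_function (m + n) (S \<union> relabel_arcs (\<lambda>i. i + m) T) :: 'f mat \<Rightarrow> 'k::field)"
proof
  fix u :: "'f mat"
  let ?N = "dim_row u"
  let ?R = "S \<union> relabel_arcs (\<lambda>i. i + m) T"
  show "USL_prod (upset_function m S) (upset_function n T) u = (upset_function (m + n) ?R u :: 'k)"
  proof (cases "u \<in> USL ?N")
    case False
    have "u \<notin> USL (m + n)"
    proof
      assume u: "u \<in> USL (m + n)"
      from carrier_matD(1)[OF USL_D(1)[OF u]] u have "u \<in> USL ?N" by simp
      with False show False ..
    qed
    then have "upset_function (m + n) ?R u = (0 :: 'k)" by (simp add: upset_function_def)
    moreover have "USL_prod (upset_function m S) (upset_function n T) u = (0 :: 'k)"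
      unfolding USL_prod_def Let_def by (rule if_not_P[OF False])
    ultimately show ?thesis by (simp only:)
  next
    case True
    note uc = USL_D(1)[OF True]
    have size: "k' = k" if "window l k u \<in> USL k'" for l k k'
      by (rule trans[OF carrier_matD(1)[OF USL_D(1)[OF that], symmetric] carrier_matD(1)[OF window_carrier]])
    have "USL_prod (upset_function m S) (upset_function n T) u =
      (\<Sum>k\<le>?N. upset_function m S (window 0 k u) * upset_function n T (window k (?N - k) u) :: 'k)"
    proof -
      have "USL_prod (upset_function m S) (upset_function n T) u =
        (\<Sum>k\<le>?N. upset_function m S (submatrix u {..<k} {..<k}) *
          (upset_function n T (submatrix u {k..<?N} {k..<?N}) :: 'k))"
        unfolding USL_prod_def Let_def if_P[OF True] ..
      also have "\<dots> = (\<Sum>k\<le>?N. upset_function m S (window 0 k u) * upset_function n T (window k (?N - k) u))"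
      proof (intro sum.cong refl)
        fix k assume "k \<in> {..?N}"
        then have k: "k \<le> ?N" by simp
        have "submatrix u {..<k} {..<k} = window 0 k u"
          using submatrix_interval[OF uc, of 0 k] k unfolding lessThan_atLeast0 by simp
        moreover have "submatrix u {k..<?N} {k..<?N} = window k (?N - k) u"
          by (rule submatrix_interval[OF uc k order_refl])
        ultimately show "upset_function m S (submatrix u {..<k} {..<k}) *
            upset_function n T (submatrix u {k..<?N} {k..<?N}) =
          (upset_function m S (window 0 k u) * upset_function n T (window k (?N - k) u) :: 'k)" by (simp only:)
      qed
      finally show ?thesis .
    qed
    also have "\<dots> = (\<Sum>k | k = m \<and> m + n = ?N.
        upset_function m S (window 0 k u) * upset_function n T (window k (?N - k) u))"
    proof (rule sum.mono_neutral_right)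
      show "\<forall>k\<in>{..?N} - {k. k = m \<and> m + n = ?N}.
        upset_function m S (window 0 k u) * upset_function n T (window k (?N - k) u) = (0 :: 'k)"
      proof
        fix k assume k: "k \<in> {..?N} - {k. k = m \<and> m + n = ?N}"
        show "upset_function m S (window 0 k u) * upset_function n T (window k (?N - k) u) = (0 :: 'k)"
        proof (cases "window 0 k u \<in> USL m \<and> window k (?N - k) u \<in> USL n")
          case True
          then have "m = k" "n = ?N - k" using size[of 0 k m] size[of k "?N - k" n] by simp_all
          moreover have "k \<le> ?N" using k by simp
          ultimately have "k = m \<and> m + n = ?N" by simp
          with k show ?thesis by blast
        next
          case False
          then consider "window 0 k u \<notin> USL m" | "window k (?N - k) u \<notin> USL n" by blast
          then show ?thesis by cases (simp_all add: upset_function_def)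
        qed
      qed
      show "{k. k = m \<and> m + n = ?N} \<subseteq> {..?N}" by force
    qed simp
    also have "\<dots> = upset_function (m + n) ?R u"
    proof (cases "m + n = ?N")
      case N: True
      have U: "u \<in> USL (m + n)" using True N by simp
      have "{k. k = m \<and> m + n = ?N} = {m}" using N by auto
      moreover have "?N - m = n" using N by simp
      moreover have "upset_function m S (window 0 m u) * upset_function n T (window m n u) =
        (upset_function (m + n) ?R u :: 'k)"
      proof -
        have "window 0 m u \<in> USL m" "window m n u \<in> USL n"
          using window_USL[OF U, of 0 m] window_USL[OF U, of m n] by simp_all
        moreover have "arc_type m (window 0 m u) = window_arcs 0 m (arc_type (m + n) u)"
          "arc_type n (window m n u) = window_arcs m n (arc_type (m + n) u)"
          using arc_type_window[OF U, of 0 m] arc_type_window[OF U, of m n] by simp_all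
        ultimately show ?thesis
          using U unfolding upset_function_def juxtapose_subset_iff[OF S T] by simp
      qed
      ultimately show ?thesis by simp
    next
      case False
      have "u \<notin> USL (m + n)"
      proof
        assume "u \<in> USL (m + n)"
        from USL_size[OF True this] False show False by simp
      qed
      with False show ?thesis by (simp add: upset_function_def)
    qed
    finally show ?thesis .
  qed
qed

text \<open>
  Both sides are sums over sets \<open>A\<close>.  At a pair \<open>(a, b)\<close> with \<open>a\<close> of size \<open>p\<close>, the left-hand side sums
  over the sets with \<open>p\<close> elements and the right-hand side over those that split \<open>R\<close>; the terms that
  belong to only one of the two ranges vanish, by \<open>subset_shuffle_arcs_iff\<close> and by comparing sizes.
\<close>

lemma USL_coprod_upset_function:
  fixes R :: "(nat \<times> nat \<times> 'f::field) set"
  assumes R: "R \<in> arc_diagrams n (- {0})"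
  shows "USL_coprod (upset_function n R) = (\<Sum>A | A \<subseteq> {..<n} \<and> splits A R.
    upset_function (card A) (std_arcs A R) \<boxtimes>
    (upset_function (card ({..<n} - A)) (std_arcs ({..<n} - A) R) :: 'f mat \<Rightarrow> 'k::field))"
proof
  fix ab :: "'f mat \<times> 'f mat"
  obtain a b where ab: "ab = (a, b)" by (cases ab)
  define p where "p = dim_row a"
  define q where "q = dim_row b"
  let ?\<A> = "{A. A \<subseteq> {..<n} \<and> splits A R}"
  let ?g = "\<lambda>A. upset_function (card A) (std_arcs A R) a *
    (upset_function (card ({..<n} - A)) (std_arcs ({..<n} - A) R) b :: 'k)"
  have rhs: "(\<Sum>A\<in>?\<A>. upset_function (card A) (std_arcs A R) \<boxtimes>
    upset_function (card ({..<n} - A)) (std_arcs ({..<n} - A) R)) ab = (\<Sum>A\<in>?\<A>. ?g A)"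
    unfolding sum_fun_apply tens_def ab by simp
  have fin: "finite {A. A \<subseteq> {..<n} \<and> Q A}" for Q
    by (rule finite_subset[of _ "Pow {..<n}"]) auto
  have g0: "?g A = 0" if "\<not> (a \<in> USL p \<and> b \<in> USL q \<and> card A = p \<and> card ({..<n} - A) = q)" for A
  proof (rule ccontr)
    assume "?g A \<noteq> 0"
    then have *: "a \<in> USL (card A)" "b \<in> USL (card ({..<n} - A))"
      unfolding upset_function_def by (auto split: if_splits)
    then have "p = card A" "q = card ({..<n} - A)"
      using USL_D(1)[OF *(1)] USL_D(1)[OF *(2)] by (simp_all add: p_def q_def)
    with * that show False by simp
  qed
  have lhs: "USL_coprod (upset_function n R) ab = (if a \<in> USL p \<and> b \<in> USL q
    then \<Sum>A | A \<subseteq> {..<p + q} \<and> card A = p. upset_function n R (the_inv_into (USL_split_subgroup (p + q) A)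
      (\<lambda>u. (submatrix u A A, submatrix u ({..<p + q} - A) ({..<p + q} - A))) (a, b)) else 0)"
    unfolding USL_coprod_def ab p_def q_def Let_def by simp
  have "USL_coprod (upset_function n R) ab = (\<Sum>A\<in>?\<A>. ?g A)"
  proof (cases "a \<in> USL p \<and> b \<in> USL q")
    case False
    then have "(\<Sum>A\<in>?\<A>. ?g A) = 0" by (intro sum.neutral ballI g0) blast
    then show ?thesis
      unfolding lhs if_not_P[OF False] by (rule sym)
  next
    case True
    then have a: "a \<in> USL p" and b: "b \<in> USL q" by auto
    have sh: "shuffle (p + q) p q A ({..<p + q} - A)" if "A \<subseteq> {..<p + q}" "card A = p" for A
      by unfold_locales (use that in \<open>simp_all add: card_Diff_subset[OF finite_subset[OF that(1) finite_lessThan]]\<close>)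
    have "USL_coprod (upset_function n R) ab = (\<Sum>A | A \<subseteq> {..<p + q} \<and> card A = p.
        upset_function n R (shuffle_mat (p + q) A a b) :: 'k)"
      unfolding lhs if_P[OF True]
    proof (intro sum.cong refl)
      fix A assume "A \<in> {A. A \<subseteq> {..<p + q} \<and> card A = p}"
      then have "A \<subseteq> {..<p + q}" "card A = p" by simp_all
      from shuffle.the_inv_into_split_subgroup[OF sh[OF this] a b]
      show "upset_function n R (the_inv_into (USL_split_subgroup (p + q) A)
        (\<lambda>u. (submatrix u A A, submatrix u ({..<p + q} - A) ({..<p + q} - A))) (a, b)) =
        (upset_function n R (shuffle_mat (p + q) A a b) :: 'k)" by (rule arg_cong)
    qed
    also have "\<dots> = (\<Sum>A\<in>?\<A>. ?g A)"
    proof (cases "p + q = n")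
      case pq: True
      let ?\<B> = "{A. A \<subseteq> {..<n} \<and> splits A R \<and> card A = p}"
      have val: "upset_function n R (shuffle_mat (p + q) A a b) = (if splits A R then ?g A else 0)"
        if A: "A \<subseteq> {..<n}" "card A = p" for A
      proof -
        have card: "card ({..<n} - A) = q"
          using A pq by (simp add: card_Diff_subset[OF finite_subset[OF A(1) finite_lessThan]])
        interpret shuffle n p q A "{..<n} - A" using sh[of A] A pq by simp
        show ?thesis
          using shuffle_USL[OF a b] arc_type_shuffle[OF a b] a b A(2) card
            subset_shuffle_arcs_iff[OF R, of "arc_type p a" "arc_type q b"]
          by (simp add: pq upset_function_def)
      qed
      have "(\<Sum>A | A \<subseteq> {..<p + q} \<and> card A = p. upset_function n R (shuffle_mat (p + q) A a b)) =
        (\<Sum>A\<in>?\<B>. ?g A)"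
        unfolding pq using val[unfolded pq] fin
        by (intro sum.mono_neutral_cong_right) auto
      also have "\<dots> = (\<Sum>A\<in>?\<A>. ?g A)"
      proof (rule sum.mono_neutral_left[OF fin])
        show "\<forall>A\<in>?\<A> - ?\<B>. ?g A = 0"
        proof
          fix A assume "A \<in> ?\<A> - ?\<B>"
          then have "card A \<noteq> p" by simp
          then show "?g A = 0" by (intro g0) simp
        qed
      qed blast
      finally show ?thesis .
    next
      case pq: False
      have "upset_function n R (shuffle_mat (p + q) A a b) = (0 :: 'k)" for A
      proof -
        have "shuffle_mat (p + q) A a b \<notin> USL n"
        proof
          assume "shuffle_mat (p + q) A a b \<in> USL n"
          from carrier_matD(1)[OF USL_D(1)[OF this]] pq show False by (simp add: shuffle_mat_def)
        qed
        then show ?thesis by (simp add: upset_function_def)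
      qed
      then have "(\<Sum>A | A \<subseteq> {..<p + q} \<and> card A = p. upset_function n R (shuffle_mat (p + q) A a b)) = (0 :: 'k)"
        by (intro sum.neutral ballI)
      moreover have "(\<Sum>A\<in>?\<A>. ?g A) = 0"
      proof (intro sum.neutral ballI g0 notI)
        fix A assume A: "A \<in> ?\<A>" and "a \<in> USL p \<and> b \<in> USL q \<and> card A = p \<and> card ({..<n} - A) = q"
        moreover have "card A + card ({..<n} - A) = n"
          using A card_Int_Diff[of "{..<n}" A] by (simp add: Int_absorb1)
        ultimately show False using pq by simp
      qed
      ultimately show ?thesis by (simp only:)
    qed
    finally show ?thesis .
  qed
  then show "USL_coprod (upset_function n R) ab = (\<Sum>A\<in>?\<A>. upset_function (card A) (std_arcs A R) \<boxtimes>
    (upset_function (card ({..<n} - A)) (std_arcs ({..<n} - A) R) :: 'f mat \<Rightarrow> 'k)) ab"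
    unfolding rhs .
qed

theorem diagram_hopf_algebra_SC_USL:
  "diagram_hopf_algebra (SC_USL :: ('f::{field,finite} mat, 'k::field) graded_hopf) (- {0}) upset_function"
proof unfold_locales
  let ?H = "SC_USL :: ('f mat, 'k) graded_hopf"
  have sel [simp]: "hcomp ?H = (\<lambda>n. class_functions (USL_superclasses n))" "hprod ?H = USL_prod"
    "hone ?H = (\<lambda>u. if u \<in> USL 0 then 1 else 0)" "hcoprod ?H = USL_coprod" "hcounit ?H = (\<lambda>\<psi>. \<psi> (1\<^sub>m 0))"
    by (simp_all add: SC_USL_def)
  show "inj_on (upset_function n :: _ \<Rightarrow> 'f mat \<Rightarrow> 'k) (arc_diagrams n (- {0}))" for n
    by (rule inj_upset_function)
  show "fun_vs.independent ((upset_function n :: _ \<Rightarrow> 'f mat \<Rightarrow> 'k) ` arc_diagrams n (- {0}))" for n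
    by (rule independent_upset_functions)
  show "fun_vs.span (upset_function n ` arc_diagrams n (- {0})) = hcomp ?H n" for n
    by (simp add: span_upset_functions)
  show "F i = 0" if "\<And>n. F n \<in> hcomp ?H n" "(\<Sum>n<N. F n) = 0" "i < N" for F N i
    using class_functions_USL_direct[of F N i] that by simp
  show "hprod ?H (upset_function m S) (upset_function n T) =
      upset_function (m + n) (S \<union> relabel_arcs (\<lambda>i. i + m) T)"
    if "S \<in> arc_diagrams m (- {0})" "T \<in> arc_diagrams n (- {0})" for m n S T
    using USL_prod_upset_functions[OF that] by simp
  show "hcoprod ?H (upset_function n T) = (\<Sum>A | A \<subseteq> {..<n} \<and> splits A T.
      upset_function (card A) (std_arcs A T) \<boxtimes> upset_function (card ({..<n} - A)) (std_arcs ({..<n} - A) T))"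
    if "T \<in> arc_diagrams n (- {0})" for n T
    using USL_coprod_upset_function[OF that] by simp
  show "hone ?H = upset_function 0 {}" by (simp add: upset_function_def fun_eq_iff)
  show "hcounit ?H (upset_function n T) = (if n = 0 then 1 else 0)" if T: "T \<in> arc_diagrams n (- {0})" for n T
  proof (cases "n = 0")
    case True
    with T show ?thesis by (simp add: upset_function_def arc_diagrams_0)
  next
    case False
    have "(1\<^sub>m 0 :: 'f mat) \<notin> USL n"
    proof
      assume "(1\<^sub>m 0 :: 'f mat) \<in> USL n"
      from carrier_matD(1)[OF USL_D(1)[OF this]] False show False by simp
    qed
    with False show ?thesis by (simp add: upset_function_def)
  qed
qed (auto simp: SC_USL_def USL_prod_def USL_coprod_def Let_def plus_fun_def fscale_def fun_eq_iff
    distrib_left distrib_right sum.distrib sum_distrib_left mult_ac)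

section \<open>Symmetric labeled partitions as arc diagrams\<close>

text \<open>
  The conditions of \<open>D n\<close> over an arbitrary ground set in place of \<open>ground n\<close>, because shifting and
  restricting a partition leads to other ground sets.
\<close>

definition sym_labeled :: "int set \<Rightarrow> 'f::zero labeled_partition \<Rightarrow> bool"
  where "sym_labeled S = (\<lambda>(\<Lambda>, L). partition_on S \<Lambda> \<and> (\<forall>B\<in>\<Lambda>. uminus ` B \<in> \<Lambda>) \<and>
    (\<forall>i j c. (i, j, c) \<in> L \<longrightarrow> (i, j) \<in> arcs \<Lambda> \<and> c \<noteq> 0 \<and> (- j, - i, c) \<in> L \<and> i + j \<noteq> 0) \<and>
    (\<forall>i j. (i, j) \<in> arcs \<Lambda> \<longrightarrow> (\<exists>!c. (i, j, c) \<in> L)))"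

definition ground :: "nat \<Rightarrow> int set"
  where "ground n = {- int n..-1} \<union> {1..int n}"

text \<open>
  \<open>a\<close> comes immediately before \<open>b\<close> in \<open>B\<close> when \<open>B\<close> is ordered by absolute values.
\<close>

definition abs_pred :: "int set \<Rightarrow> int \<Rightarrow> int \<Rightarrow> bool"
  where "abs_pred B a b \<longleftrightarrow> a \<in> B \<and> b \<in> B \<and> \<bar>a\<bar> < \<bar>b\<bar> \<and> (\<forall>k\<in>B. \<bar>k\<bar> \<le> \<bar>a\<bar> \<or> \<bar>b\<bar> \<le> \<bar>k\<bar>)"

text \<open>
  Elements of \<open>ground n\<close> have absolute values from \<open>1\<close>, vertices of diagrams start at \<open>0\<close>.
\<close>

definition index :: "int \<Rightarrow> nat"
  where "index x = nat \<bar>x\<bar> - 1"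

text \<open>
  Of the two blocks \<open>B\<close> and \<open>- B\<close>, the one in which the endpoint \<open>b\<close> is positive is used.  The bit \<open>s\<close>
  says whether \<open>a\<close> and \<open>b\<close> have the same sign, and \<open>c\<close> is the label of the arc that joins \<open>b\<close> to its
  neighbour \<open>z\<close> on the side of zero.
\<close>

definition sym_arcs :: "'f labeled_partition \<Rightarrow> (nat \<times> nat \<times> bool \<times> 'f) set"
  where "sym_arcs = (\<lambda>(\<Lambda>, L). {(i, j, s, c). \<exists>a b B z. B \<in> \<Lambda> \<and> 0 < b \<and> abs_pred B a b \<and>
    (z, b, c) \<in> L \<and> \<bar>z\<bar> < b \<and> i = index a \<and> j = index b \<and> s = (0 < a)})"

lemma mem_ground_iff: "x \<in> ground n \<longleftrightarrow> x \<noteq> 0 \<and> \<bar>x\<bar> \<le> int n"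
  by (auto simp: ground_def)

lemma index_eq_iff: "x \<noteq> 0 \<Longrightarrow> y \<noteq> 0 \<Longrightarrow> index x = index y \<longleftrightarrow> \<bar>x\<bar> = \<bar>y\<bar>"
  by (auto simp: index_def)

lemma index_less_iff: "x \<noteq> 0 \<Longrightarrow> y \<noteq> 0 \<Longrightarrow> index x < index y \<longleftrightarrow> \<bar>x\<bar> < \<bar>y\<bar>"
  by (auto simp: index_def)

lemma index_less_ground: "x \<in> ground n \<Longrightarrow> index x < n"
  by (auto simp: index_def mem_ground_iff)

lemma image_uminus_uminus: "uminus ` uminus ` (B :: int set) = B"
  by (simp add: image_image)

lemma mem_D_iff: "x \<in> D n \<longleftrightarrow> sym_labeled (ground n) x"
proof -
  obtain \<Lambda> L where x: "x = (\<Lambda>, L)" by (cases x)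
  have sym: "\<Lambda> = (\<lambda>B. uminus ` B) ` \<Lambda> \<longleftrightarrow> (\<forall>B\<in>\<Lambda>. uminus ` B \<in> \<Lambda>)"
  proof
    assume "\<Lambda> = (\<lambda>B. uminus ` B) ` \<Lambda>"
    then show "\<forall>B\<in>\<Lambda>. uminus ` B \<in> \<Lambda>" by blast
  next
    assume *: "\<forall>B\<in>\<Lambda>. uminus ` B \<in> \<Lambda>"
    have "B \<in> (\<lambda>B. uminus ` B) ` \<Lambda>" if "B \<in> \<Lambda>" for B
      using * that by (intro image_eqI[of _ _ "uminus ` B"]) (simp_all add: image_uminus_uminus)
    with * show "\<Lambda> = (\<lambda>B. uminus ` B) ` \<Lambda>" by blast
  qed
  have L: "(\<forall>(i, j, c)\<in>L. (i, j) \<in> arcs \<Lambda> \<and> c \<noteq> 0) \<and> (\<forall>(i, j)\<in>arcs \<Lambda>. \<exists>!c. (i, j, c) \<in> L) \<and>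
      (\<forall>(i, j, c)\<in>L. (- j, - i, c) \<in> L \<and> i + j \<noteq> 0) \<longleftrightarrow>
    (\<forall>i j c. (i, j, c) \<in> L \<longrightarrow> (i, j) \<in> arcs \<Lambda> \<and> c \<noteq> 0 \<and> (- j, - i, c) \<in> L \<and> i + j \<noteq> 0) \<and>
    (\<forall>i j. (i, j) \<in> arcs \<Lambda> \<longrightarrow> (\<exists>!c. (i, j, c) \<in> L))"
    unfolding Ball_def split_paired_All prod.case by blast
  show ?thesis
    unfolding x D_def sym_labeled_def ground_def mem_Collect_eq prod.case sym L by (rule refl)
qed

lemma mem_arcsI:
  "B \<in> \<Lambda> \<Longrightarrow> i \<in> B \<Longrightarrow> j \<in> B \<Longrightarrow> i < j \<Longrightarrow> (\<And>k. k \<in> B \<Longrightarrow> k \<le> i \<or> j \<le> k) \<Longrightarrow> (i, j) \<in> arcs \<Lambda>"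
  unfolding arcs_def by blast

lemma mem_arcsE:
  assumes "(i, j) \<in> arcs \<Lambda>"
  obtains B where "B \<in> \<Lambda>" "i \<in> B" "j \<in> B" "i < j" "\<And>k. k \<in> B \<Longrightarrow> k \<le> i \<or> j \<le> k"
  using assms unfolding arcs_def by blast

lemma mem_sym_arcs_iff:
  "(i, j, s, c) \<in> sym_arcs (\<Lambda>, L) \<longleftrightarrow> (\<exists>a b B z. B \<in> \<Lambda> \<and> 0 < b \<and> abs_pred B a b \<and>
    (z, b, c) \<in> L \<and> \<bar>z\<bar> < b \<and> i = index a \<and> j = index b \<and> s = (0 < a))"
  by (simp add: sym_arcs_def)

lemma abs_pred_uminus: "abs_pred (uminus ` B) (- a) (- b) \<longleftrightarrow> abs_pred B a b"
  by (auto simp: abs_pred_def)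

lemma abs_pred_exists:
  assumes "finite B" "x \<in> B" "y \<in> B" "\<bar>x\<bar> < \<bar>y\<bar>"
  shows "\<exists>a. abs_pred B a y \<and> \<bar>x\<bar> \<le> \<bar>a\<bar>"
proof -
  let ?K = "{k \<in> B. \<bar>k\<bar> < \<bar>y\<bar>}"
  have K: "finite ?K" "?K \<noteq> {}" using assms by auto
  obtain a where a: "a \<in> ?K" "\<bar>a\<bar> = Max (abs ` ?K)"
    using Max_in[of "abs ` ?K"] K by (metis (no_types, lifting) finite_imageI image_is_empty imageE)
  have "\<bar>k\<bar> \<le> \<bar>a\<bar>" if "k \<in> ?K" for k
    unfolding a(2) using K(1) that by (intro Max_ge) auto
  then have "abs_pred B a y" "\<bar>x\<bar> \<le> \<bar>a\<bar>"
    using a(1) assms unfolding abs_pred_def by (auto simp: not_less[symmetric])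
  then show ?thesis by blast
qed

lemma abs_succ_exists:
  assumes "finite B" "x \<in> B" "y \<in> B" "\<bar>x\<bar> < \<bar>y\<bar>"
  shows "\<exists>b. abs_pred B x b"
proof -
  let ?K = "{k \<in> B. \<bar>x\<bar> < \<bar>k\<bar>}"
  have K: "finite ?K" "?K \<noteq> {}" using assms by auto
  obtain b where b: "b \<in> ?K" "\<bar>b\<bar> = Min (abs ` ?K)"
    using Min_in[of "abs ` ?K"] K by (metis (no_types, lifting) finite_imageI image_is_empty imageE)
  have "\<bar>b\<bar> \<le> \<bar>k\<bar>" if "k \<in> ?K" for k
    unfolding b(2) using K(1) that by (intro Min_le) auto
  then have "abs_pred B x b"
    using b(1) assms unfolding abs_pred_def by (auto simp: not_less[symmetric])
  then show ?thesis by blast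
qed

locale sym_partition =
  fixes S :: "int set" and \<Lambda> :: "int set set" and L :: "(int \<times> int \<times> 'f::zero) set"
  assumes sym_labeled: "sym_labeled S (\<Lambda>, L)" and finite_S: "finite S" and zero_S: "0 \<notin> S"
begin

lemma part: "partition_on S \<Lambda>"
  and sym: "B \<in> \<Lambda> \<Longrightarrow> uminus ` B \<in> \<Lambda>"
  and label_arc: "(i, j, c) \<in> L \<Longrightarrow> (i, j) \<in> arcs \<Lambda>"
  and label_nonzero: "(i, j, c) \<in> L \<Longrightarrow> c \<noteq> 0"
  and label_sym: "(i, j, c) \<in> L \<Longrightarrow> (- j, - i, c) \<in> L"
  and label_sum: "(i, j, c) \<in> L \<Longrightarrow> i + j \<noteq> 0"
  and label_exists: "(i, j) \<in> arcs \<Lambda> \<Longrightarrow> \<exists>c. (i, j, c) \<in> L"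
  and label_unique: "(i, j, c) \<in> L \<Longrightarrow> (i, j, c') \<in> L \<Longrightarrow> c' = c"
  using sym_labeled unfolding sym_labeled_def prod.case by blast+

lemma block_subset: "B \<in> \<Lambda> \<Longrightarrow> B \<subseteq> S"
  and block_nonempty: "B \<in> \<Lambda> \<Longrightarrow> B \<noteq> {}"
  and block_cover: "x \<in> S \<Longrightarrow> \<exists>B\<in>\<Lambda>. x \<in> B"
  using part unfolding partition_on_def by blast+

lemma block_eq: "B \<in> \<Lambda> \<Longrightarrow> B' \<in> \<Lambda> \<Longrightarrow> x \<in> B \<Longrightarrow> x \<in> B' \<Longrightarrow> B = B'"
  using part unfolding partition_on_def disjoint_def by blast

lemma block_finite: "B \<in> \<Lambda> \<Longrightarrow> finite B"
  using block_subset finite_S finite_subset by blast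

lemma block_zero: "B \<in> \<Lambda> \<Longrightarrow> x \<in> B \<Longrightarrow> x \<noteq> 0"
  using block_subset zero_S by blast

text \<open>
  Otherwise \<open>B = - B\<close>, and the two elements of least absolute value would be joined by an arc of the
  form \<open>(- m, m)\<close>.
\<close>

lemma no_opposite:
  assumes B: "B \<in> \<Lambda>" and x: "x \<in> B"
  shows "- x \<notin> B"
proof
  assume "- x \<in> B"
  then have "x \<in> uminus ` B" by force
  with block_eq[OF B sym[OF B] x] have eq: "uminus ` B = B" by simp
  let ?m = "Min (abs ` B)"
  have fin: "finite (abs ` B)" "abs ` B \<noteq> {}" using block_finite[OF B] x by auto
  from Min_in[OF this] obtain k where k: "k \<in> B" "\<bar>k\<bar> = ?m" by force
  have "- k \<in> B" using k(1) eq by force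
  have "?m = k \<or> ?m = - k" unfolding k(2)[symmetric] by linarith
  then have m: "?m \<in> B" "- ?m \<in> B" using k(1) \<open>- k \<in> B\<close> by (metis minus_minus)+
  have pos: "0 < ?m" using block_zero[OF B k(1)] k(2) by linarith
  have "(- ?m, ?m) \<in> arcs \<Lambda>"
  proof (rule mem_arcsI[OF B m(2,1)])
    show "- ?m < ?m" using pos by linarith
    fix l assume "l \<in> B"
    then have "?m \<le> \<bar>l\<bar>" using fin(1) by (intro Min_le) auto
    then show "l \<le> - ?m \<or> ?m \<le> l" by linarith
  qed
  from label_exists[OF this] label_sum show False by force
qed

lemma abs_eq_imp_eq: "B \<in> \<Lambda> \<Longrightarrow> x \<in> B \<Longrightarrow> y \<in> B \<Longrightarrow> \<bar>x\<bar> = \<bar>y\<bar> \<Longrightarrow> x = y"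
  using no_opposite[of B x] by (auto simp: abs_eq_iff)

lemma abs_pred_unique:
  assumes B: "B \<in> \<Lambda>" and "abs_pred B a b" "abs_pred B a' b"
  shows "a = a'"
proof -
  have ab: "a \<in> B" "\<bar>a\<bar> < \<bar>b\<bar>" "\<And>k. k \<in> B \<Longrightarrow> \<bar>k\<bar> \<le> \<bar>a\<bar> \<or> \<bar>b\<bar> \<le> \<bar>k\<bar>"
    and ab': "a' \<in> B" "\<bar>a'\<bar> < \<bar>b\<bar>" "\<And>k. k \<in> B \<Longrightarrow> \<bar>k\<bar> \<le> \<bar>a'\<bar> \<or> \<bar>b\<bar> \<le> \<bar>k\<bar>"
    using assms(2,3) unfolding abs_pred_def by blast+
  have "\<bar>a\<bar> = \<bar>a'\<bar>" using ab(3)[OF ab'(1)] ab'(3)[OF ab(1)] ab(2) ab'(2) by linarith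
  then show ?thesis using abs_eq_imp_eq[OF B] assms(2,3) unfolding abs_pred_def by blast
qed

lemma abs_succ_unique:
  assumes B: "B \<in> \<Lambda>" and "abs_pred B a b" "abs_pred B a b'"
  shows "b = b'"
proof -
  have ab: "b \<in> B" "\<bar>a\<bar> < \<bar>b\<bar>" "\<And>k. k \<in> B \<Longrightarrow> \<bar>k\<bar> \<le> \<bar>a\<bar> \<or> \<bar>b\<bar> \<le> \<bar>k\<bar>"
    and ab': "b' \<in> B" "\<bar>a\<bar> < \<bar>b'\<bar>" "\<And>k. k \<in> B \<Longrightarrow> \<bar>k\<bar> \<le> \<bar>a\<bar> \<or> \<bar>b'\<bar> \<le> \<bar>k\<bar>"
    using assms(2,3) unfolding abs_pred_def by blast+
  have "\<bar>b\<bar> = \<bar>b'\<bar>" using ab(3)[OF ab'(1)] ab'(3)[OF ab(1)] ab(2) ab'(2) by linarith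
  then show ?thesis using abs_eq_imp_eq[OF B] assms(2,3) unfolding abs_pred_def by blast
qed

lemma label_block:
  assumes "(z, b, c) \<in> L" "B \<in> \<Lambda>" "b \<in> B"
  shows "z \<in> B" "z < b" "k \<in> B \<Longrightarrow> k \<le> z \<or> b \<le> k"
proof -
  obtain B' where B': "B' \<in> \<Lambda>" "z \<in> B'" "b \<in> B'" "z < b" "\<And>k. k \<in> B' \<Longrightarrow> k \<le> z \<or> b \<le> k"
    using mem_arcsE[OF label_arc[OF assms(1)]] by blast
  have "B' = B" using block_eq[OF B'(1) assms(2) B'(3) assms(3)] .
  with B' show "z \<in> B" "z < b" "k \<in> B \<Longrightarrow> k \<le> z \<or> b \<le> k" by blast+
qed

lemma label_into_unique:
  assumes "(z, b, c) \<in> L" "(z', b, c') \<in> L"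
  shows "z' = z \<and> c' = c"
proof -
  obtain B where B: "B \<in> \<Lambda>" "b \<in> B" using mem_arcsE[OF label_arc[OF assms(1)]] by blast
  note 1 = label_block[OF assms(1) B] and 2 = label_block[OF assms(2) B]
  have "z' = z" using 1(2) 2(2) 1(3)[OF 2(1)] 2(3)[OF 1(1)] by linarith
  with assms label_unique show ?thesis by blast
qed

text \<open>
  Since \<open>a\<close> lies strictly between \<open>- b\<close> and \<open>b\<close>, so does the largest element of \<open>B\<close> below \<open>b\<close>.
\<close>

lemma label_into_exists:
  assumes B: "B \<in> \<Lambda>" and ab: "abs_pred B a b" and "0 < b"
  shows "\<exists>z c. (z, b, c) \<in> L \<and> \<bar>z\<bar> < b"
proof -
  let ?K = "{k \<in> B. k < b}"
  have a: "a \<in> ?K" "- b < a" using ab \<open>0 < b\<close> unfolding abs_pred_def by auto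
  have fin: "finite ?K" using block_finite[OF B] by simp
  have z: "Max ?K \<in> ?K" using Max_in[OF fin] a(1) by blast
  have "a \<le> Max ?K" using Max_ge[OF fin a(1)] .
  with z a(2) have "\<bar>Max ?K\<bar> < b" by auto
  moreover have "(Max ?K, b) \<in> arcs \<Lambda>"
  proof (rule mem_arcsI[OF B])
    show "k \<le> Max ?K \<or> b \<le> k" if "k \<in> B" for k
      using that Max_ge[OF fin, of k] by (cases "k < b") auto
  qed (use z ab in \<open>auto simp: abs_pred_def\<close>)
  ultimately show ?thesis using label_exists by blast
qed

lemma sym_arcs_mem:
  assumes B: "B \<in> \<Lambda>" and ab: "abs_pred B a b" and b: "0 < b"
  obtains z c where "(z, b, c) \<in> L" "\<bar>z\<bar> < b" "(index a, index b, (0 < a), c) \<in> sym_arcs (\<Lambda>, L)"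
  using label_into_exists[OF assms] assms unfolding mem_sym_arcs_iff by blast

text \<open>
  Two elements of a block are connected by steps between neighbours in the order of absolute values.
  Steps ending in a negative element are steps ending in a positive element of the opposite block.
\<close>

lemma block_chain:
  assumes B: "B \<in> \<Lambda>" and xy: "x \<in> B" "y \<in> B"
    and refl: "\<And>a. a \<in> S \<Longrightarrow> Q a a" and symQ: "\<And>a b. Q a b \<Longrightarrow> Q b a"
    and trans: "\<And>a b c. Q a b \<Longrightarrow> Q b c \<Longrightarrow> Q a c"
    and neg: "\<And>a b. Q a b \<Longrightarrow> Q (- a) (- b)"
    and step: "\<And>a b B. B \<in> \<Lambda> \<Longrightarrow> abs_pred B a b \<Longrightarrow> 0 < b \<Longrightarrow> Q a b"
  shows "Q x y"
proof -
  have step': "Q a b" if "abs_pred B a b" for a b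
  proof (cases "0 < b")
    case True
    then show ?thesis by (rule step[OF B that])
  next
    case False
    have "b \<in> B" using that unfolding abs_pred_def by blast
    with False have "0 < - b" using block_zero[OF B] by fastforce
    moreover have "abs_pred (uminus ` B) (- a) (- b)" using that by (simp only: abs_pred_uminus)
    ultimately have "Q (- a) (- b)" by (intro step[OF sym[OF B]])
    then show ?thesis using neg[of "- a" "- b"] by simp
  qed
  have less: "Q x y" if "x \<in> B" "y \<in> B" "\<bar>x\<bar> < \<bar>y\<bar>" for x y
    using that
  proof (induction "nat \<bar>y\<bar>" arbitrary: y rule: less_induct)
    case less
    obtain a where a: "abs_pred B a y" "\<bar>x\<bar> \<le> \<bar>a\<bar>"
      using abs_pred_exists[OF block_finite[OF B] less.prems] by blast
    have aB: "a \<in> B" "\<bar>a\<bar> < \<bar>y\<bar>" using a(1) unfolding abs_pred_def by auto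
    have "Q x a"
    proof (cases "\<bar>x\<bar> = \<bar>a\<bar>")
      case True
      then have "x = a" by (rule abs_eq_imp_eq[OF B less.prems(1) aB(1)])
      then show ?thesis using refl aB(1) block_subset[OF B] by blast
    next
      case False
      then have "\<bar>x\<bar> < \<bar>a\<bar>" using a(2) by simp
      then show ?thesis using aB by (intro less.hyps less.prems) simp_all
    qed
    then show ?case using trans step'[OF a(1)] by blast
  qed
  consider "\<bar>x\<bar> < \<bar>y\<bar>" | "\<bar>y\<bar> < \<bar>x\<bar>" | "x = y"
    using abs_eq_imp_eq[OF B xy] by linarith
  then show ?thesis
  proof cases
    case 3
    then show ?thesis using refl xy(1) block_subset[OF B] by blast
  qed (use less xy symQ in blast)+
qed

lemma sym_arcs_diagram:
  assumes S: "S = ground n"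
  shows "sym_arcs (\<Lambda>, L) \<in> arc_diagrams n (UNIV \<times> - {0})"
proof (rule arc_diagramsI)
  fix i j sc assume "(i, j, sc) \<in> sym_arcs (\<Lambda>, L)"
  then obtain s c a b B z where sc: "sc = (s, c)" and B: "B \<in> \<Lambda>" and ab: "0 < b" "abs_pred B a b"
    and L: "(z, b, c) \<in> L" and ij: "i = index a" "j = index b" "s = (0 < a)"
    by (cases sc) (auto simp: mem_sym_arcs_iff)
  have aB: "a \<in> B" "b \<in> B" "\<bar>a\<bar> < \<bar>b\<bar>" using ab(2) unfolding abs_pred_def by auto
  have nz: "a \<noteq> 0" "b \<noteq> 0" using block_zero[OF B] aB by blast+
  have "i < j" using index_less_iff[OF nz] aB(3) ij by simp
  moreover have "j < n" using index_less_ground[of b n] block_subset[OF B] aB(2) S ij(2) by blast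
  ultimately show "i < j \<and> j < n \<and> sc \<in> UNIV \<times> - {0}" using label_nonzero[OF L] sc by simp
  have uniq: "a' = a \<and> b' = b \<or> a' = - a \<and> b' = - b"
    if B': "B' \<in> \<Lambda>" and ab': "abs_pred B' a' b'" and eq: "index a' = index a \<or> index b' = index b"
    for a' b' B'
  proof -
    have aB': "a' \<in> B'" "b' \<in> B'" using ab' unfolding abs_pred_def by auto
    have nz': "a' \<noteq> 0" "b' \<noteq> 0" using block_zero[OF B'] aB' by blast+
    have pos: "a'' = a \<and> b'' = b" if B'': "B'' \<in> \<Lambda>" and ab'': "abs_pred B'' a'' b''" and eq: "a'' = a \<or> b'' = b"
      for a'' b'' B''
    proof -
      have "a'' \<in> B''" "b'' \<in> B''" using ab'' unfolding abs_pred_def by auto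
      with eq block_eq[OF B'' B] aB have [simp]: "B'' = B" by blast
      from eq show ?thesis using abs_succ_unique[OF B ab(2)] abs_pred_unique[OF B ab(2)] ab'' by auto
    qed
    have "\<bar>a'\<bar> = \<bar>a\<bar> \<or> \<bar>b'\<bar> = \<bar>b\<bar>" using eq index_eq_iff nz nz' by blast
    then consider "a' = a \<or> b' = b" | "- a' = a \<or> - b' = b" by (auto simp: abs_eq_iff)
    then show ?thesis
    proof cases
      case 1
      then show ?thesis using pos[OF B' ab'] by blast
    next
      case 2
      have "abs_pred (uminus ` B') (- a') (- b')" using ab' by (simp only: abs_pred_uminus)
      from pos[OF sym[OF B'] this 2] have "- a' = a" "- b' = b" by blast+
      then show ?thesis by linarith
    qed
  qed
  have uniq': "i' = i \<and> j' = j \<and> sc' = sc" if mem: "(i', j', sc') \<in> sym_arcs (\<Lambda>, L)" and eq: "i' = i \<or> j' = j" for i' j' sc'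
  proof -
    obtain s' c' a' b' B' z' where sc': "sc' = (s', c')" and B': "B' \<in> \<Lambda>" and ab': "0 < b'" "abs_pred B' a' b'"
      and L': "(z', b', c') \<in> L" and ij': "i' = index a'" "j' = index b'" "s' = (0 < a')"
      using mem by (cases sc') (auto simp: mem_sym_arcs_iff)
    have "a' = a \<and> b' = b \<or> a' = - a \<and> b' = - b" using uniq[OF B' ab'(2)] eq ij ij' by blast
    with ab(1) ab'(1) have eq: "a' = a" "b' = b" by auto
    moreover have "c' = c" using label_into_unique[OF L L'[unfolded eq(2)]] by blast
    ultimately show ?thesis using sc sc' ij ij' by simp
  qed
  show "j = j' \<and> sc = sc'" if "(i, j', sc') \<in> sym_arcs (\<Lambda>, L)" for j' sc' using uniq'[OF that] by simp
  show "i = i' \<and> sc = sc'" if "(i', j, sc') \<in> sym_arcs (\<Lambda>, L)" for i' sc' using uniq'[OF that] by simp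
qed

end

text \<open>
  By \<open>block_chain\<close>, the diagram with its bits determines which elements share a block.  The label of
  an arc is then found in the colour that belongs to its endpoint of larger absolute value, after
  replacing \<open>(i, j)\<close> by \<open>(- j, - i)\<close> if this endpoint is \<open>i\<close>.
\<close>

lemma sym_arcs_inj:
  assumes "sym_partition S \<Lambda> L" "sym_partition S \<Lambda>' L'" and eq: "sym_arcs (\<Lambda>, L) = sym_arcs (\<Lambda>', L')"
  shows "(\<Lambda>, L) = (\<Lambda>', L')"
proof -
  have arc: "abs_pred B a b \<Longrightarrow> 0 < b \<Longrightarrow> B \<in> \<Lambda> \<Longrightarrow> (z, b, c) \<in> L \<Longrightarrow> \<bar>z\<bar> < b \<Longrightarrow>
      \<exists>B'\<in>\<Lambda>'. abs_pred B' a b \<and> (\<exists>z'. (z', b, c) \<in> L')"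
    if A: "sym_partition S \<Lambda> L" and A': "sym_partition S \<Lambda>' L'" and eq: "sym_arcs (\<Lambda>, L) = sym_arcs (\<Lambda>', L')"
    for \<Lambda> L \<Lambda>' L' B a b z c
  proof -
    interpret A: sym_partition S \<Lambda> L by fact
    interpret A': sym_partition S \<Lambda>' L' by fact
    assume ab: "abs_pred B a b" "0 < b" and B: "B \<in> \<Lambda>" and z: "(z, b, c) \<in> L" "\<bar>z\<bar> < b"
    have "(index a, index b, (0 < a), c) \<in> sym_arcs (\<Lambda>', L')"
      unfolding eq[symmetric] mem_sym_arcs_iff using ab B z by blast
    then obtain a' b' B' z' where *: "B' \<in> \<Lambda>'" "0 < b'" "abs_pred B' a' b'" "(z', b', c) \<in> L'"
      "index a = index a'" "index b = index b'" "(0 < a) = (0 < a')"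
      unfolding mem_sym_arcs_iff by blast
    have "a \<noteq> 0" "b \<noteq> 0" using A.block_zero[OF B] ab(1) unfolding abs_pred_def by blast+
    moreover have "a' \<noteq> 0" "b' \<noteq> 0" using A'.block_zero[OF *(1)] *(3) unfolding abs_pred_def by blast+
    ultimately have "\<bar>a\<bar> = \<bar>a'\<bar>" "\<bar>b\<bar> = \<bar>b'\<bar>" using * index_eq_iff by blast+
    with *(2,7) ab(2) have "a = a'" "b = b'" by (auto simp: abs_eq_iff)
    with * show ?thesis by blast
  qed
  have blocks: "\<Lambda> \<subseteq> \<Lambda>'"
    if A: "sym_partition S \<Lambda> L" and A': "sym_partition S \<Lambda>' L'" and eq: "sym_arcs (\<Lambda>, L) = sym_arcs (\<Lambda>', L')"
    for \<Lambda> L \<Lambda>' L'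
  proof -
    interpret A: sym_partition S \<Lambda> L by fact
    interpret A': sym_partition S \<Lambda>' L' by fact
    have same: "\<exists>B'\<in>M'. x \<in> B' \<and> y \<in> B'"
      if M: "sym_partition S M K" and M': "sym_partition S M' K'" and eqM: "sym_arcs (M, K) = sym_arcs (M', K')"
        and xy: "B \<in> M" "x \<in> B" "y \<in> B" for B x y M K M' K'
    proof -
      interpret M: sym_partition S M K by fact
      interpret M': sym_partition S M' K' by fact
      show ?thesis
      proof (rule M.block_chain[OF xy])
        show "\<exists>B'\<in>M'. a \<in> B' \<and> a \<in> B'" if "a \<in> S" for a using M'.block_cover[OF that] by blast
        show "\<exists>B'\<in>M'. b \<in> B' \<and> a \<in> B'" if "\<exists>B'\<in>M'. a \<in> B' \<and> b \<in> B'" for a b using that by blast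
        show "\<exists>B'\<in>M'. a \<in> B' \<and> c \<in> B'" if ab: "\<exists>B'\<in>M'. a \<in> B' \<and> b \<in> B'" and bc: "\<exists>B'\<in>M'. b \<in> B' \<and> c \<in> B'"
          for a b c
        proof -
          obtain B1 B2 where *: "B1 \<in> M'" "a \<in> B1" "b \<in> B1" "B2 \<in> M'" "b \<in> B2" "c \<in> B2"
            using ab bc by blast
          with M'.block_eq[OF *(1,4,3,5)] show ?thesis by blast
        qed
        show "\<exists>B'\<in>M'. - a \<in> B' \<and> - b \<in> B'" if "\<exists>B'\<in>M'. a \<in> B' \<and> b \<in> B'" for a b
          using that M'.sym by blast
        show "\<exists>B'\<in>M'. a \<in> B' \<and> b \<in> B'" if "B \<in> M" "abs_pred B a b" "0 < b" for a b B
        proof -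
          obtain z c where zc: "(z, b, c) \<in> K" "\<bar>z\<bar> < b"
            using M.label_into_exists[OF \<open>B \<in> M\<close> \<open>abs_pred B a b\<close> \<open>0 < b\<close>] by blast
          from arc[OF M M' eqM \<open>abs_pred B a b\<close> \<open>0 < b\<close> \<open>B \<in> M\<close> zc]
          show ?thesis unfolding abs_pred_def by blast
        qed
      qed
    qed
    show "\<Lambda> \<subseteq> \<Lambda>'"
    proof
      fix B assume B: "B \<in> \<Lambda>"
      then obtain x where x: "x \<in> B" using A.block_nonempty by blast
      then obtain B' where B': "B' \<in> \<Lambda>'" "x \<in> B'" using A'.block_cover A.block_subset[OF B] by blast
      have "y \<in> B'" if y: "y \<in> B" for y
      proof -
        obtain B'' where "B'' \<in> \<Lambda>'" "x \<in> B''" "y \<in> B''" using same[OF A A' eq B x y] by blast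
        with A'.block_eq[OF B'(1) this(1) B'(2) this(2)] show ?thesis by simp
      qed
      moreover have "y \<in> B" if y: "y \<in> B'" for y
      proof -
        obtain B'' where "B'' \<in> \<Lambda>" "x \<in> B''" "y \<in> B''" using same[OF A' A eq[symmetric] B' y] by blast
        with A.block_eq[OF B this(1) x this(2)] show ?thesis by simp
      qed
      ultimately have "B = B'" by blast
      with B' show "B \<in> \<Lambda>'" by simp
    qed
  qed
  have \<Lambda>: "\<Lambda> = \<Lambda>'" using blocks[OF assms(1,2) eq] blocks[OF assms(2,1) eq[symmetric]] by blast
  have labels: "(i, j, c) \<in> L'"
    if A: "sym_partition S \<Lambda> L" and A': "sym_partition S \<Lambda> L'" and eq: "sym_arcs (\<Lambda>, L) = sym_arcs (\<Lambda>, L')"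
      and ijc: "(i, j, c) \<in> L" for \<Lambda> i j c and L L' :: "(int \<times> int \<times> 'a) set"
  proof -
    interpret A: sym_partition S \<Lambda> L by fact
    interpret A': sym_partition S \<Lambda> L' by fact
    have into: "(i, j, c) \<in> L'" if ijc: "(i, j, c) \<in> L" "\<bar>i\<bar> < \<bar>j\<bar>" for i j
    proof -
      obtain B where B: "B \<in> \<Lambda>" "i \<in> B" "j \<in> B" "i < j"
        using mem_arcsE[OF A.label_arc[OF ijc(1)]] by blast
      have j: "0 < j" using B(4) ijc(2) by linarith
      obtain a where a: "abs_pred B a j" using abs_pred_exists[OF A.block_finite[OF B(1)] B(2,3) ijc(2)] by blast
      have "\<bar>i\<bar> < j" using ijc(2) j by simp
      then obtain z' where z': "(z', j, c) \<in> L'" using arc[OF A A' eq a j B(1) ijc(1)] by blast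
      note 1 = A.label_block[OF ijc(1) B(1,3)] and 2 = A'.label_block[OF z' B(1,3)]
      have "z' = i" using 1(2) 2(2) 1(3)[OF 2(1)] 2(3)[OF 1(1)] by linarith
      with z' show ?thesis by simp
    qed
    have "i + j \<noteq> 0" by (rule A.label_sum[OF ijc])
    moreover have "i < j" using mem_arcsE[OF A.label_arc[OF ijc]] by blast
    ultimately consider "\<bar>i\<bar> < \<bar>j\<bar>" | "\<bar>- j\<bar> < \<bar>- i\<bar>" by linarith
    then show ?thesis
    proof cases
      case 1
      then show ?thesis by (rule into[OF ijc])
    next
      case 2
      from A'.label_sym[OF into[OF A.label_sym[OF ijc] 2]] show ?thesis by simp
    qed
  qed
  have "t \<in> L' \<longleftrightarrow> t \<in> L" for t
    using labels[OF assms(1) assms(2)[folded \<Lambda>] eq[folded \<Lambda>], of "fst t" "fst (snd t)" "snd (snd t)"]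
      labels[OF assms(2)[folded \<Lambda>] assms(1) eq[folded \<Lambda>, symmetric], of "fst t" "fst (snd t)" "snd (snd t)"]
    by auto
  with \<Lambda> show ?thesis by blast
qed

section \<open>Operations on symmetric labeled partitions\<close>

lemma sym_labeledI:
  assumes "partition_on S \<Lambda>" "\<And>B. B \<in> \<Lambda> \<Longrightarrow> uminus ` B \<in> \<Lambda>"
    and "\<And>i j c. (i, j, c) \<in> L \<Longrightarrow> (i, j) \<in> arcs \<Lambda> \<and> c \<noteq> 0 \<and> (- j, - i, c) \<in> L \<and> i + j \<noteq> 0"
    and "\<And>i j. (i, j) \<in> arcs \<Lambda> \<Longrightarrow> \<exists>c. (i, j, c) \<in> L"
    and "\<And>i j c c'. (i, j, c) \<in> L \<Longrightarrow> (i, j, c') \<in> L \<Longrightarrow> c = c'"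
  shows "sym_labeled S (\<Lambda>, L)"
proof -
  have "\<exists>!c. (i, j, c) \<in> L" if "(i, j) \<in> arcs \<Lambda>" for i j
    using assms(4)[OF that] assms(5)[of i j] by blast
  with assms(1-3) show ?thesis unfolding sym_labeled_def prod.case by blast
qed

definition adjacent :: "int set \<Rightarrow> int \<Rightarrow> int \<Rightarrow> bool"
  where "adjacent B i j \<longleftrightarrow> i \<in> B \<and> j \<in> B \<and> i < j \<and> (\<forall>k\<in>B. k \<le> i \<or> j \<le> k)"

lemma mem_arcs_iff: "(i, j) \<in> arcs \<Lambda> \<longleftrightarrow> (\<exists>B\<in>\<Lambda>. adjacent B i j)"
  unfolding arcs_def adjacent_def by blast

lemma adjacent_uminus: "adjacent (uminus ` B) (- j) (- i) \<longleftrightarrow> adjacent B i j"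
  by (auto simp: adjacent_def)

lemma arcs_Un: "arcs (\<Lambda> \<union> \<Lambda>') = arcs \<Lambda> \<union> arcs \<Lambda>'"
  unfolding arcs_def by blast

context sym_partition
begin

lemma arc_in_S: "(i, j) \<in> arcs \<Lambda> \<Longrightarrow> i \<in> S" "(i, j) \<in> arcs \<Lambda> \<Longrightarrow> j \<in> S"
  using block_subset unfolding arcs_def by blast+

lemma label_in_S: "(i, j, c) \<in> L \<Longrightarrow> i \<in> S" "(i, j, c) \<in> L \<Longrightarrow> j \<in> S"
  using arc_in_S label_arc by blast+

lemma S_sym: "x \<in> S \<Longrightarrow> - x \<in> S"
  using block_cover sym block_subset by blast

end

lemma sym_partition_Un:
  assumes A: "sym_partition S \<Lambda> L" and B: "sym_partition S' \<Lambda>' L'" and disj: "S \<inter> S' = {}"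
  shows "sym_partition (S \<union> S') (\<Lambda> \<union> \<Lambda>') (L \<union> L')"
    "sym_arcs (\<Lambda> \<union> \<Lambda>', L \<union> L') = sym_arcs (\<Lambda>, L) \<union> sym_arcs (\<Lambda>', L')"
proof -
  interpret A: sym_partition S \<Lambda> L by fact
  interpret B: sym_partition S' \<Lambda>' L' by fact
  have notboth: "x \<in> S \<Longrightarrow> x \<notin> S'" for x using disj by blast
  have disjB: "C \<inter> C' = {}" if "C \<in> \<Lambda>" "C' \<in> \<Lambda>'" for C C'
    using A.block_subset[OF that(1)] B.block_subset[OF that(2)] disj by blast
  show "sym_partition (S \<union> S') (\<Lambda> \<union> \<Lambda>') (L \<union> L')"
  proof
    show "sym_labeled (S \<union> S') (\<Lambda> \<union> \<Lambda>', L \<union> L')"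
    proof (rule sym_labeledI)
      show "partition_on (S \<union> S') (\<Lambda> \<union> \<Lambda>')"
      proof (rule partition_onI)
        show "\<Union>(\<Lambda> \<union> \<Lambda>') = S \<union> S'" using A.part B.part by (simp add: partition_on_def)
        show "{} \<notin> \<Lambda> \<union> \<Lambda>'" using A.block_nonempty B.block_nonempty by blast
        fix p q assume pq: "p \<in> \<Lambda> \<union> \<Lambda>'" "q \<in> \<Lambda> \<union> \<Lambda>'" "p \<noteq> q"
        have "disjnt p q" if "p \<in> \<Lambda>" "q \<in> \<Lambda>" using A.block_eq[OF that] pq(3) unfolding disjnt_def by blast
        moreover have "disjnt p q" if "p \<in> \<Lambda>'" "q \<in> \<Lambda>'" using B.block_eq[OF that] pq(3) unfolding disjnt_def by blast
        moreover have "disjnt p q" if "p \<in> \<Lambda>" "q \<in> \<Lambda>'" using disjB[OF that] unfolding disjnt_def .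
        moreover have "disjnt p q" if "p \<in> \<Lambda>'" "q \<in> \<Lambda>" using disjB[OF that(2,1)] unfolding disjnt_def by blast
        ultimately show "disjnt p q" using pq(1,2) by blast
      qed
      show "uminus ` C \<in> \<Lambda> \<union> \<Lambda>'" if "C \<in> \<Lambda> \<union> \<Lambda>'" for C using that A.sym B.sym by blast
      show "(i, j) \<in> arcs (\<Lambda> \<union> \<Lambda>') \<and> c \<noteq> 0 \<and> (- j, - i, c) \<in> L \<union> L' \<and> i + j \<noteq> 0"
        if ijc: "(i, j, c) \<in> L \<union> L'" for i j c
      proof (cases "(i, j, c) \<in> L")
        case True
        show ?thesis unfolding arcs_Un
          using A.label_arc[OF True] A.label_nonzero[OF True] A.label_sym[OF True] A.label_sum[OF True] by blast
      next
        case False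
        with ijc have L': "(i, j, c) \<in> L'" by blast
        show ?thesis unfolding arcs_Un
          using B.label_arc[OF L'] B.label_nonzero[OF L'] B.label_sym[OF L'] B.label_sum[OF L'] by blast
      qed
      show "\<exists>c. (i, j, c) \<in> L \<union> L'" if "(i, j) \<in> arcs (\<Lambda> \<union> \<Lambda>')" for i j
        using that A.label_exists B.label_exists unfolding arcs_Un by blast
      show "c = c'" if c: "(i, j, c) \<in> L \<union> L'" and c': "(i, j, c') \<in> L \<union> L'" for i j c c'
      proof (cases "(i, j, c) \<in> L")
        case True
        then have "(i, j, c') \<in> L" using c' A.label_in_S(1)[OF True] B.label_in_S(1)[of i j c'] notboth by blast
        then show ?thesis using A.label_unique True by blast
      next
        case False
        with c have L': "(i, j, c) \<in> L'" by blast
        then have "(i, j, c') \<in> L'" using c' B.label_in_S(1)[OF L'] A.label_in_S(1)[of i j c'] notboth by blast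
        then show ?thesis using B.label_unique L' by blast
      qed
    qed
    show "finite (S \<union> S')" "0 \<notin> S \<union> S'" using A.finite_S B.finite_S A.zero_S B.zero_S by simp_all
  qed
  have 1: "(z, b, c) \<in> L" if "(z, b, c) \<in> L \<union> L'" "C \<in> \<Lambda>" "abs_pred C a b" for z b c C a
    using that(1) B.label_in_S(2)[of z b c] A.block_subset[OF that(2)] that(3) notboth
    unfolding abs_pred_def by blast
  have 2: "(z, b, c) \<in> L'" if "(z, b, c) \<in> L \<union> L'" "C \<in> \<Lambda>'" "abs_pred C a b" for z b c C a
    using that(1) A.label_in_S(2)[of z b c] B.block_subset[OF that(2)] that(3) notboth
    unfolding abs_pred_def by blast
  have "(i, j, s, c) \<in> sym_arcs (\<Lambda> \<union> \<Lambda>', L \<union> L') \<longleftrightarrow>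
    (i, j, s, c) \<in> sym_arcs (\<Lambda>, L) \<or> (i, j, s, c) \<in> sym_arcs (\<Lambda>', L')" for i j s c
    unfolding mem_sym_arcs_iff using 1 2 by blast
  then show "sym_arcs (\<Lambda> \<union> \<Lambda>', L \<union> L') = sym_arcs (\<Lambda>, L) \<union> sym_arcs (\<Lambda>', L')"
    unfolding set_eq_iff split_paired_All Un_iff by blast
qed

text \<open>
  An odd increasing map respects positivity and the order of absolute values, hence everything from
  which \<open>sym_arcs\<close> is computed.
\<close>

locale sym_relabelling = sym_partition S \<Lambda> L
  for S \<Lambda> and L :: "(int \<times> int \<times> 'f::zero) set" +
  fixes \<theta> :: "int \<Rightarrow> int"
  assumes mono: "\<And>x y. x \<in> S \<Longrightarrow> y \<in> S \<Longrightarrow> x < y \<Longrightarrow> \<theta> x < \<theta> y"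
    and odd: "\<And>x. x \<in> S \<Longrightarrow> \<theta> (- x) = - \<theta> x"
begin

lemma less_iff: "x \<in> S \<Longrightarrow> y \<in> S \<Longrightarrow> \<theta> x < \<theta> y \<longleftrightarrow> x < y"
  using mono[of x y] mono[of y x] by (cases x y rule: linorder_cases) auto

lemma le_iff: "x \<in> S \<Longrightarrow> y \<in> S \<Longrightarrow> \<theta> x \<le> \<theta> y \<longleftrightarrow> x \<le> y"
  using less_iff[of y x] by (simp add: not_less[symmetric])

lemma eq_iff: "x \<in> S \<Longrightarrow> y \<in> S \<Longrightarrow> \<theta> x = \<theta> y \<longleftrightarrow> x = y"
  using le_iff[of x y] le_iff[of y x] by auto

lemma pos_iff: "x \<in> S \<Longrightarrow> 0 < \<theta> x \<longleftrightarrow> 0 < x"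
proof -
  assume x: "x \<in> S"
  have "- \<theta> x < \<theta> x \<longleftrightarrow> - x < x" using less_iff[OF S_sym[OF x] x] odd[OF x] by simp
  then show ?thesis by linarith
qed

lemma neg_iff: "x \<in> S \<Longrightarrow> \<theta> x < 0 \<longleftrightarrow> x < 0"
proof -
  assume x: "x \<in> S"
  have "\<theta> x < - \<theta> x \<longleftrightarrow> x < - x" using less_iff[OF x S_sym[OF x]] odd[OF x] by simp
  then show ?thesis by linarith
qed

lemma abs_image: "x \<in> S \<Longrightarrow> \<bar>\<theta> x\<bar> = \<theta> \<bar>x\<bar>"
proof -
  assume x: "x \<in> S"
  show ?thesis
  proof (cases "x < 0")
    case True
    then show ?thesis using neg_iff[OF x] odd[OF x] by simp
  next
    case False
    then show ?thesis using neg_iff[OF x] by simp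
  qed
qed

lemma abs_in_S: "x \<in> S \<Longrightarrow> \<bar>x\<bar> \<in> S"
  using S_sym by (simp add: abs_if)

lemma abs_less_iff: "x \<in> S \<Longrightarrow> y \<in> S \<Longrightarrow> \<bar>\<theta> x\<bar> < \<bar>\<theta> y\<bar> \<longleftrightarrow> \<bar>x\<bar> < \<bar>y\<bar>"
  using less_iff[OF abs_in_S abs_in_S] by (simp add: abs_image)

lemma abs_le_iff: "x \<in> S \<Longrightarrow> y \<in> S \<Longrightarrow> \<bar>\<theta> x\<bar> \<le> \<bar>\<theta> y\<bar> \<longleftrightarrow> \<bar>x\<bar> \<le> \<bar>y\<bar>"
  using le_iff[OF abs_in_S abs_in_S] by (simp add: abs_image)

lemma adjacent_image:
  assumes "B \<subseteq> S" "i \<in> S" "j \<in> S"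
  shows "adjacent (\<theta> ` B) (\<theta> i) (\<theta> j) \<longleftrightarrow> adjacent B i j"
proof -
  have mem: "\<theta> k \<in> \<theta> ` B \<longleftrightarrow> k \<in> B" if "k \<in> S" for k
    using assms(1) that eq_iff by blast
  have "(\<forall>k\<in>\<theta> ` B. k \<le> \<theta> i \<or> \<theta> j \<le> k) \<longleftrightarrow> (\<forall>k\<in>B. k \<le> i \<or> j \<le> k)"
    using assms le_iff by (simp add: subset_iff)
  then show ?thesis unfolding adjacent_def using mem assms less_iff by simp
qed

lemma abs_pred_image:
  assumes "B \<subseteq> S" "i \<in> S" "j \<in> S"
  shows "abs_pred (\<theta> ` B) (\<theta> i) (\<theta> j) \<longleftrightarrow> abs_pred B i j"
proof -
  have mem: "\<theta> k \<in> \<theta> ` B \<longleftrightarrow> k \<in> B" if "k \<in> S" for k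
    using assms(1) that eq_iff by blast
  have "(\<forall>k\<in>\<theta> ` B. \<bar>k\<bar> \<le> \<bar>\<theta> i\<bar> \<or> \<bar>\<theta> j\<bar> \<le> \<bar>k\<bar>) \<longleftrightarrow> (\<forall>k\<in>B. \<bar>k\<bar> \<le> \<bar>i\<bar> \<or> \<bar>j\<bar> \<le> \<bar>k\<bar>)"
    using assms abs_le_iff by (simp add: subset_iff)
  then show ?thesis unfolding abs_pred_def using mem assms abs_less_iff by simp
qed

lemma mem_relabel_labels:
  "(p, q, c) \<in> (\<lambda>(i, j, c). (\<theta> i, \<theta> j, c)) ` L \<longleftrightarrow> (\<exists>i j. (i, j, c) \<in> L \<and> p = \<theta> i \<and> q = \<theta> j)"
  by force

lemma mem_relabel_arcs_iff:
  "(p, q) \<in> arcs ((\<lambda>B. \<theta> ` B) ` \<Lambda>) \<longleftrightarrow> (\<exists>i j. (i, j) \<in> arcs \<Lambda> \<and> p = \<theta> i \<and> q = \<theta> j)"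
proof
  assume "(p, q) \<in> arcs ((\<lambda>B. \<theta> ` B) ` \<Lambda>)"
  then obtain B where B: "B \<in> \<Lambda>" "adjacent (\<theta> ` B) p q" unfolding mem_arcs_iff by blast
  then obtain i j where ij: "i \<in> B" "j \<in> B" "p = \<theta> i" "q = \<theta> j" unfolding adjacent_def by blast
  with B block_subset[OF B(1)] have "adjacent B i j" using adjacent_image[of B i j] by blast
  then show "\<exists>i j. (i, j) \<in> arcs \<Lambda> \<and> p = \<theta> i \<and> q = \<theta> j" using B(1) ij unfolding mem_arcs_iff by blast
next
  assume "\<exists>i j. (i, j) \<in> arcs \<Lambda> \<and> p = \<theta> i \<and> q = \<theta> j"
  then obtain i j B where B: "B \<in> \<Lambda>" "adjacent B i j" "p = \<theta> i" "q = \<theta> j" unfolding mem_arcs_iff by blast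
  then have "i \<in> S" "j \<in> S" using block_subset[OF B(1)] unfolding adjacent_def by blast+
  with B adjacent_image[OF block_subset[OF B(1)]] show "(p, q) \<in> arcs ((\<lambda>B. \<theta> ` B) ` \<Lambda>)"
    unfolding mem_arcs_iff by blast
qed

lemma relabelled:
  "sym_partition (\<theta> ` S) ((\<lambda>B. \<theta> ` B) ` \<Lambda>) ((\<lambda>(i, j, c). (\<theta> i, \<theta> j, c)) ` L)"
proof
  show "sym_labeled (\<theta> ` S) ((\<lambda>B. \<theta> ` B) ` \<Lambda>, (\<lambda>(i, j, c). (\<theta> i, \<theta> j, c)) ` L)"
  proof (rule sym_labeledI)
    show "partition_on (\<theta> ` S) ((\<lambda>B. \<theta> ` B) ` \<Lambda>)"
    proof (rule partition_onI)
      have "S = \<Union>\<Lambda>" using part by (simp add: partition_on_def)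
      then show "\<Union>((\<lambda>B. \<theta> ` B) ` \<Lambda>) = \<theta> ` S" by (simp add: image_Union)
      show "{} \<notin> (\<lambda>B. \<theta> ` B) ` \<Lambda>" using block_nonempty by blast
      fix p q assume "p \<in> (\<lambda>B. \<theta> ` B) ` \<Lambda>" "q \<in> (\<lambda>B. \<theta> ` B) ` \<Lambda>" "p \<noteq> q"
      then obtain B C where BC: "B \<in> \<Lambda>" "C \<in> \<Lambda>" "p = \<theta> ` B" "q = \<theta> ` C" "B \<noteq> C" by blast
      have "\<theta> x \<noteq> \<theta> y" if "x \<in> B" "y \<in> C" for x y
        using that BC block_eq[OF BC(1,2)] eq_iff block_subset by blast
      then show "disjnt p q" unfolding disjnt_def BC by blast
    qed
    show "uminus ` C \<in> (\<lambda>B. \<theta> ` B) ` \<Lambda>" if C: "C \<in> (\<lambda>B. \<theta> ` B) ` \<Lambda>" for C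
    proof -
      obtain B where B: "B \<in> \<Lambda>" "C = \<theta> ` B" using C by blast
      have "uminus ` C = \<theta> ` uminus ` B"
        unfolding B(2) image_image using odd block_subset[OF B(1)] by (intro image_cong refl) (auto simp: subset_iff)
      then show ?thesis using sym[OF B(1)] by blast
    qed
    show "(p, q) \<in> arcs ((\<lambda>B. \<theta> ` B) ` \<Lambda>) \<and> c \<noteq> 0 \<and> (- q, - p, c) \<in> (\<lambda>(i, j, c). (\<theta> i, \<theta> j, c)) ` L \<and> p + q \<noteq> 0"
      if pq: "(p, q, c) \<in> (\<lambda>(i, j, c). (\<theta> i, \<theta> j, c)) ` L" for p q c
    proof -
      obtain i j where ij: "(i, j, c) \<in> L" "p = \<theta> i" "q = \<theta> j" using pq unfolding mem_relabel_labels by blast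
      have S: "i \<in> S" "j \<in> S" using label_in_S[OF ij(1)] by auto
      have "- q = \<theta> (- j)" "- p = \<theta> (- i)" using odd S ij by simp_all
      then have "(- q, - p, c) \<in> (\<lambda>(i, j, c). (\<theta> i, \<theta> j, c)) ` L"
        unfolding mem_relabel_labels using label_sym[OF ij(1)] by blast
      moreover have "i \<noteq> - j" using label_sum[OF ij(1)] by simp
      then have "p + q \<noteq> 0" using eq_iff[OF S(1) S_sym[OF S(2)]] odd[OF S(2)] ij by (simp add: eq_neg_iff_add_eq_0)
      moreover have "(p, q) \<in> arcs ((\<lambda>B. \<theta> ` B) ` \<Lambda>)"
        unfolding mem_relabel_arcs_iff using label_arc[OF ij(1)] ij by blast
      ultimately show ?thesis using label_nonzero[OF ij(1)] by blast
    qed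
    show "\<exists>c. (p, q, c) \<in> (\<lambda>(i, j, c). (\<theta> i, \<theta> j, c)) ` L" if "(p, q) \<in> arcs ((\<lambda>B. \<theta> ` B) ` \<Lambda>)" for p q
      using that label_exists unfolding mem_relabel_arcs_iff mem_relabel_labels by blast
    show "c = c'" if c: "(p, q, c) \<in> (\<lambda>(i, j, c). (\<theta> i, \<theta> j, c)) ` L"
      and c': "(p, q, c') \<in> (\<lambda>(i, j, c). (\<theta> i, \<theta> j, c)) ` L" for p q c c'
    proof -
      obtain i j i' j' where ij: "(i, j, c) \<in> L" "p = \<theta> i" "q = \<theta> j" "(i', j', c') \<in> L" "p = \<theta> i'" "q = \<theta> j'"
        using c c' unfolding mem_relabel_labels by blast
      then have "i = i'" "j = j'" using eq_iff label_in_S by metis+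
      then show ?thesis using ij label_unique by blast
    qed
  qed
  show "finite (\<theta> ` S)" using finite_S by simp
  have "\<theta> x \<noteq> 0" if "x \<in> S" for x
  proof -
    have "x \<noteq> 0" using zero_S that by blast
    then show ?thesis using pos_iff[OF that] neg_iff[OF that] by (cases "0 < x") auto
  qed
  then show "0 \<notin> \<theta> ` S" by force
qed

lemma sym_arcs_relabelled:
  assumes \<eta>: "\<And>x. x \<in> S \<Longrightarrow> \<eta> (index x) = index (\<theta> x)"
  shows "sym_arcs (relabel \<theta> (\<Lambda>, L)) = relabel_arcs \<eta> (sym_arcs (\<Lambda>, L))"
proof -
  have "(p, q, s, c) \<in> sym_arcs ((\<lambda>B. \<theta> ` B) ` \<Lambda>, (\<lambda>(i, j, c). (\<theta> i, \<theta> j, c)) ` L) \<longleftrightarrow>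
    (p, q, s, c) \<in> relabel_arcs \<eta> (sym_arcs (\<Lambda>, L))" for p q s c
  proof
    assume "(p, q, s, c) \<in> sym_arcs ((\<lambda>B. \<theta> ` B) ` \<Lambda>, (\<lambda>(i, j, c). (\<theta> i, \<theta> j, c)) ` L)"
    then obtain a' b' B z' where B: "B \<in> \<Lambda>" and b': "0 < b'" and ab': "abs_pred (\<theta> ` B) a' b'"
      and z': "(z', b', c) \<in> (\<lambda>(i, j, c). (\<theta> i, \<theta> j, c)) ` L" "\<bar>z'\<bar> < b'"
      and pq: "p = index a'" "q = index b'" "s = (0 < a')" unfolding mem_sym_arcs_iff by blast
    obtain a b where ab: "a \<in> B" "b \<in> B" "a' = \<theta> a" "b' = \<theta> b" using ab' unfolding abs_pred_def by blast
    have S: "a \<in> S" "b \<in> S" using ab block_subset[OF B] by auto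
    obtain z y where zy: "(z, y, c) \<in> L" "z' = \<theta> z" "b' = \<theta> y" using z'(1) unfolding mem_relabel_labels by blast
    have "y = b" using eq_iff[OF label_in_S(2)[OF zy(1)] S(2)] zy(3) ab(4) by simp
    have b: "0 < b" using pos_iff[OF S(2)] b' ab by simp
    have "\<bar>\<theta> z\<bar> < \<bar>\<theta> b\<bar>" using z'(2) zy(2) ab(4) b' by simp
    then have "\<bar>z\<bar> < b" using abs_less_iff[OF label_in_S(1)[OF zy(1)] S(2)] b by simp
    moreover have "abs_pred B a b" using ab' abs_pred_image[OF block_subset[OF B] S] ab by simp
    ultimately have "(index a, index b, (0 < a), c) \<in> sym_arcs (\<Lambda>, L)"
      unfolding mem_sym_arcs_iff using B b zy(1) \<open>y = b\<close> by blast
    moreover have "p = \<eta> (index a)" "q = \<eta> (index b)" "s = (0 < a)"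
      using pq ab \<eta> S pos_iff[OF S(1)] by simp_all
    ultimately show "(p, q, s, c) \<in> relabel_arcs \<eta> (sym_arcs (\<Lambda>, L))" unfolding mem_relabel_arcs by blast
  next
    assume "(p, q, s, c) \<in> relabel_arcs \<eta> (sym_arcs (\<Lambda>, L))"
    then obtain a b B z where B: "B \<in> \<Lambda>" and b: "0 < b" and ab: "abs_pred B a b" and z: "(z, b, c) \<in> L" "\<bar>z\<bar> < b"
      and pq: "p = \<eta> (index a)" "q = \<eta> (index b)" "s = (0 < a)"
      unfolding mem_relabel_arcs mem_sym_arcs_iff by blast
    have S: "a \<in> S" "b \<in> S" "z \<in> S"
      using ab block_subset[OF B] label_in_S(1)[OF z(1)] unfolding abs_pred_def by blast+
    have "abs_pred (\<theta> ` B) (\<theta> a) (\<theta> b)" using ab abs_pred_image[OF block_subset[OF B] S(1,2)] by simp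
    moreover have "0 < \<theta> b" using b pos_iff[OF S(2)] by simp
    moreover have "\<bar>\<theta> z\<bar> < \<theta> b" using abs_less_iff[OF S(3,2)] z(2) b calculation(2) by simp
    moreover have "(\<theta> z, \<theta> b, c) \<in> (\<lambda>(i, j, c). (\<theta> i, \<theta> j, c)) ` L" unfolding mem_relabel_labels using z(1) by blast
    moreover have "p = index (\<theta> a)" "q = index (\<theta> b)" "s = (0 < \<theta> a)" using pq \<eta> S pos_iff[OF S(1)] by simp_all
    ultimately show "(p, q, s, c) \<in> sym_arcs ((\<lambda>B. \<theta> ` B) ` \<Lambda>, (\<lambda>(i, j, c). (\<theta> i, \<theta> j, c)) ` L)"
      unfolding mem_sym_arcs_iff using B by blast
  qed
  then show ?thesis unfolding relabel_def prod.case set_eq_iff split_paired_All by blast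
qed

end

lemma index_mem_image_iff:
  assumes x: "x \<noteq> 0" and A: "\<And>a. a \<in> A \<Longrightarrow> 0 < a"
  shows "index x \<in> index ` A \<longleftrightarrow> x \<in> A \<union> uminus ` A"
proof
  assume "index x \<in> index ` A"
  then obtain a where a: "a \<in> A" "index x = index a" by blast
  then have "\<bar>x\<bar> = a" using A[OF a(1)] x by (simp add: index_eq_iff)
  then have "x = a \<or> x = - a" by linarith
  then show "x \<in> A \<union> uminus ` A" using a(1) by blast
qed (auto simp: index_def)

context sym_partition
begin

text \<open>
  A block meeting \<open>A \<union> - A\<close> is contained in it, so an arc of the diagram whose end lies in \<open>A\<close> comes
  from a block that is kept.
\<close>

lemma restricted:
  assumes A: "\<And>x. x \<in> A \<Longrightarrow> 0 < x" and split: "\<And>B. B \<in> \<Lambda> \<Longrightarrow> B \<subseteq> A \<union> uminus ` A \<or> B \<inter> (A \<union> uminus ` A) = {}"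
  defines "\<Lambda>A \<equiv> {B \<in> \<Lambda>. B \<subseteq> A \<union> uminus ` A}"
  defines "LA \<equiv> {(i, j, c) \<in> L. (i, j) \<in> arcs \<Lambda>A}"
  shows "sym_partition (S \<inter> (A \<union> uminus ` A)) \<Lambda>A LA"
    "sym_arcs (\<Lambda>A, LA) = arcs_within (index ` A) (sym_arcs (\<Lambda>, L))"
proof -
  let ?K = "A \<union> uminus ` A"
  have K_neg: "- x \<in> ?K" if "x \<in> ?K" for x using that by auto
  have sub: "\<Lambda>A \<subseteq> \<Lambda>" unfolding \<Lambda>A_def by blast
  have mem: "(i, j, c) \<in> LA \<longleftrightarrow> (i, j, c) \<in> L \<and> (i, j) \<in> arcs \<Lambda>A" for i j c unfolding LA_def by simp
  have arcs_sub: "(i, j) \<in> arcs \<Lambda>" if "(i, j) \<in> arcs \<Lambda>A" for i j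
    using that sub unfolding arcs_def by blast
  have symA: "uminus ` B \<in> \<Lambda>A" if B: "B \<in> \<Lambda>A" for B
  proof -
    have "uminus ` B \<subseteq> ?K" using B K_neg unfolding \<Lambda>A_def by blast
    then show ?thesis using B sym unfolding \<Lambda>A_def by blast
  qed
  show "sym_partition (S \<inter> ?K) \<Lambda>A LA"
  proof
    show "sym_labeled (S \<inter> ?K) (\<Lambda>A, LA)"
    proof (rule sym_labeledI)
      show "partition_on (S \<inter> ?K) \<Lambda>A"
      proof (rule partition_onI)
        show "\<Union>\<Lambda>A = S \<inter> ?K"
        proof
          show "\<Union>\<Lambda>A \<subseteq> S \<inter> ?K" using block_subset unfolding \<Lambda>A_def by blast
          show "S \<inter> ?K \<subseteq> \<Union>\<Lambda>A"
          proof
            fix x assume x: "x \<in> S \<inter> ?K"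
            then obtain B where B: "B \<in> \<Lambda>" "x \<in> B" using block_cover by blast
            then have "B \<subseteq> ?K" using split[OF B(1)] x by blast
            with B show "x \<in> \<Union>\<Lambda>A" unfolding \<Lambda>A_def by blast
          qed
        qed
        show "{} \<notin> \<Lambda>A" using block_nonempty sub by blast
        show "disjnt p q" if "p \<in> \<Lambda>A" "q \<in> \<Lambda>A" "p \<noteq> q" for p q
        proof -
          have "p \<in> \<Lambda>" "q \<in> \<Lambda>" using that sub by auto
          from block_eq[OF this] that(3) show ?thesis unfolding disjnt_def by blast
        qed
      qed
      show "uminus ` B \<in> \<Lambda>A" if "B \<in> \<Lambda>A" for B by (rule symA[OF that])
      show "(i, j) \<in> arcs \<Lambda>A \<and> c \<noteq> 0 \<and> (- j, - i, c) \<in> LA \<and> i + j \<noteq> 0" if ijc: "(i, j, c) \<in> LA" for i j c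
      proof -
        have L: "(i, j, c) \<in> L" and arc: "(i, j) \<in> arcs \<Lambda>A" using ijc mem by auto
        obtain B where B: "B \<in> \<Lambda>A" "adjacent B i j" using arc unfolding mem_arcs_iff by blast
        then have "adjacent (uminus ` B) (- j) (- i)" by (simp only: adjacent_uminus)
        then have "(- j, - i) \<in> arcs \<Lambda>A" unfolding mem_arcs_iff using symA[OF B(1)] by blast
        then show ?thesis using arc label_nonzero[OF L] label_sym[OF L] label_sum[OF L] mem by blast
      qed
      show "\<exists>c. (i, j, c) \<in> LA" if "(i, j) \<in> arcs \<Lambda>A" for i j
        using label_exists[OF arcs_sub[OF that]] that mem by blast
      show "c = c'" if "(i, j, c) \<in> LA" "(i, j, c') \<in> LA" for i j c c'
        using that mem label_unique by blast
    qed
    show "finite (S \<inter> ?K)" "0 \<notin> S \<inter> ?K" using finite_S zero_S by simp_all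
  qed
  have idx: "x \<in> ?K \<longleftrightarrow> index x \<in> index ` A" if "x \<noteq> 0" for x
    by (rule index_mem_image_iff[OF that, symmetric]) (rule A)
  have "(i, j, s, c) \<in> sym_arcs (\<Lambda>A, LA) \<longleftrightarrow> (i, j, s, c) \<in> arcs_within (index ` A) (sym_arcs (\<Lambda>, L))" for i j s c
  proof
    assume "(i, j, s, c) \<in> sym_arcs (\<Lambda>A, LA)"
    then obtain a b B z where *: "B \<in> \<Lambda>A" "0 < b" "abs_pred B a b" "(z, b, c) \<in> LA" "\<bar>z\<bar> < b"
      "i = index a" "j = index b" "s = (0 < a)" unfolding mem_sym_arcs_iff by blast
    have B: "B \<in> \<Lambda>" "B \<subseteq> ?K" "a \<in> B" "b \<in> B" using *(1,3) unfolding \<Lambda>A_def abs_pred_def by blast+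
    then have "i \<in> index ` A" "j \<in> index ` A" using idx block_zero[OF B(1)] *(6,7) by blast+
    moreover have "(z, b, c) \<in> L" using *(4) mem by blast
    ultimately show "(i, j, s, c) \<in> arcs_within (index ` A) (sym_arcs (\<Lambda>, L))"
      unfolding mem_arcs_within mem_sym_arcs_iff using * B(1) by blast
  next
    assume "(i, j, s, c) \<in> arcs_within (index ` A) (sym_arcs (\<Lambda>, L))"
    then obtain a b B z where *: "B \<in> \<Lambda>" "0 < b" "abs_pred B a b" "(z, b, c) \<in> L" "\<bar>z\<bar> < b"
      "i = index a" "j = index b" "s = (0 < a)" and j: "j \<in> index ` A"
      unfolding mem_sym_arcs_iff mem_arcs_within by blast
    have b: "b \<in> B" using *(3) unfolding abs_pred_def by blast
    have "b \<in> ?K" using idx[of b] j *(2,7) by simp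
    then have BA: "B \<in> \<Lambda>A" using split[OF *(1)] b *(1) unfolding \<Lambda>A_def by blast
    have "adjacent B z b" unfolding adjacent_def using label_block[OF *(4,1) b] b by blast
    then have "(z, b, c) \<in> LA" unfolding mem mem_arcs_iff using BA *(4) by blast
    then show "(i, j, s, c) \<in> sym_arcs (\<Lambda>A, LA)" unfolding mem_sym_arcs_iff using BA * by blast
  qed
  then show "sym_arcs (\<Lambda>A, LA) = arcs_within (index ` A) (sym_arcs (\<Lambda>, L))"
    unfolding set_eq_iff split_paired_All by blast
qed

text \<open>
  If the diagram is split by \<open>A\<close>, membership in \<open>A \<union> - A\<close> is unchanged along the steps of
  \<open>block_chain\<close>, so it is constant on blocks.
\<close>

lemma splits_sym_arcs_iff:
  assumes A: "\<And>x. x \<in> A \<Longrightarrow> 0 < x"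
  shows "splits (index ` A) (sym_arcs (\<Lambda>, L)) \<longleftrightarrow>
    (\<forall>B\<in>\<Lambda>. B \<subseteq> A \<union> uminus ` A \<or> B \<inter> (A \<union> uminus ` A) = {})"
proof
  let ?K = "A \<union> uminus ` A"
  have idx: "index x \<in> index ` A \<longleftrightarrow> x \<in> ?K" if "x \<noteq> 0" for x
    by (rule index_mem_image_iff[OF that]) (rule A)
  {
    assume spl: "splits (index ` A) (sym_arcs (\<Lambda>, L))"
    show "\<forall>B\<in>\<Lambda>. B \<subseteq> ?K \<or> B \<inter> ?K = {}"
    proof
      fix B assume B: "B \<in> \<Lambda>"
      have "x \<in> ?K \<longleftrightarrow> y \<in> ?K" if xy: "x \<in> B" "y \<in> B" for x y
      proof (rule block_chain[OF B xy])
        show "(- a \<in> ?K) = (- b \<in> ?K)" if "(a \<in> ?K) = (b \<in> ?K)" for a b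
        proof -
          have "- x \<in> ?K \<longleftrightarrow> x \<in> ?K" for x by force
          with that show ?thesis by blast
        qed
        show "(a \<in> ?K) = (b \<in> ?K)" if B: "B \<in> \<Lambda>" and ab: "abs_pred B a b" and b: "0 < b" for a b B
        proof -
          obtain z c where "(index a, index b, (0 < a), c) \<in> sym_arcs (\<Lambda>, L)" using sym_arcs_mem[OF B ab b] .
          then have "index a \<in> index ` A \<longleftrightarrow> index b \<in> index ` A" using spl unfolding splits_def by blast
          moreover have "a \<noteq> 0" "b \<noteq> 0" using block_zero[OF B] ab unfolding abs_pred_def by blast+
          ultimately show ?thesis using idx by blast
        qed
      qed blast+
      then show "B \<subseteq> ?K \<or> B \<inter> ?K = {}" by blast
    qed
  next
    assume *: "\<forall>B\<in>\<Lambda>. B \<subseteq> ?K \<or> B \<inter> ?K = {}"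
    show "splits (index ` A) (sym_arcs (\<Lambda>, L))"
      unfolding splits_def
    proof (intro allI impI)
      fix i j sc assume "(i, j, sc) \<in> sym_arcs (\<Lambda>, L)"
      moreover obtain s c where "sc = (s, c)" by (cases sc)
      ultimately obtain a b B where B: "B \<in> \<Lambda>" "abs_pred B a b" and ij: "i = index a" "j = index b"
        using mem_sym_arcs_iff[of i j s c \<Lambda> L] by blast
      have ab: "a \<in> B" "b \<in> B" using B(2) unfolding abs_pred_def by blast+
      then have "a \<in> ?K \<longleftrightarrow> b \<in> ?K" using * B(1) by blast
      then show "i \<in> index ` A \<longleftrightarrow> j \<in> index ` A" unfolding ij using idx block_zero[OF B(1)] ab by blast
    qed
  }
qed

end

section \<open>Every arc diagram comes from a symmetric labeled partition\<close>

lemma adjacent_insert_greatest: "finite B \<Longrightarrow> (N :: int) \<notin> B \<Longrightarrow> B \<noteq> {} \<Longrightarrow> (\<And>k. k \<in> B \<Longrightarrow> k < N) \<Longrightarrow>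
  adjacent (insert N B) i j \<longleftrightarrow> adjacent B i j \<or> i = Max B \<and> j = N"
proof -
  assume fin: "finite B" and N: "N \<notin> B" and ne: "B \<noteq> {}" and less: "\<And>k. k \<in> B \<Longrightarrow> k < N"
  have Max: "Max B \<in> B" "\<And>k. k \<in> B \<Longrightarrow> k \<le> Max B" using Max_in[OF fin ne] Max_ge[OF fin] by blast+
  show ?thesis
  proof
    assume adj: "adjacent (insert N B) i j"
    then have *: "i \<in> insert N B" "j \<in> insert N B" "i < j" "\<And>k. k \<in> B \<Longrightarrow> k \<le> i \<or> j \<le> k"
      unfolding adjacent_def by blast+
    have "i \<in> B" using *(1-3) less[of j] by force
    show "adjacent B i j \<or> i = Max B \<and> j = N"
    proof (cases "j = N")
      case True
      have "Max B \<le> i" using *(4)[OF Max(1)] less[OF Max(1)] True by linarith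
      then show ?thesis using Max(2)[OF \<open>i \<in> B\<close>] True by simp
    next
      case False
      then show ?thesis using * \<open>i \<in> B\<close> unfolding adjacent_def by blast
    qed
  next
    assume "adjacent B i j \<or> i = Max B \<and> j = N"
    then show "adjacent (insert N B) i j"
    proof
      assume adj: "adjacent B i j"
      then have "j < N" using less unfolding adjacent_def by blast
      with adj show ?thesis unfolding adjacent_def by auto
    next
      assume "i = Max B \<and> j = N"
      then show ?thesis using Max less[OF Max(1)] unfolding adjacent_def by blast
    qed
  qed
qed

context sym_partition
begin

text \<open>
  A new largest element \<open>N\<close> is added to \<open>B\<close>, and \<open>- N\<close> to \<open>- B\<close>.  In the partition the new arc starts
  at the greatest element of \<open>B\<close>, in the diagram at the element \<open>e\<close> of greatest absolute value.
\<close>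

lemma attached:
  fixes N e :: int and c :: 'f
  assumes N_Ball: "\<forall>x\<in>S. \<bar>x\<bar> < N" and B: "B \<in> \<Lambda>" and e_Ball: "e \<in> B" "\<forall>k\<in>B. \<bar>k\<bar> \<le> \<bar>e\<bar>" and c: "c \<noteq> 0"
  defines "B1 \<equiv> insert N B"
  defines "B2 \<equiv> uminus ` insert N B"
  defines "\<Lambda>2 \<equiv> \<Lambda> - {B, uminus ` B} \<union> {B1, B2}"
  defines "L2 \<equiv> L \<union> {(Max B, N, c), (- N, - Max B, c)}"
  shows "sym_partition (insert N (insert (- N) S)) \<Lambda>2 L2"
    "sym_arcs (\<Lambda>2, L2) = insert (index e, index N, (0 < e), c) (sym_arcs (\<Lambda>, L))"
proof -
  let ?z = "Max B"
  have N: "\<bar>x\<bar> < N" if "x \<in> S" for x using N_Ball that by blast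
  have e: "e \<in> B" "k \<in> B \<Longrightarrow> \<bar>k\<bar> \<le> \<bar>e\<bar>" for k using e_Ball by blast+
  note fin = block_finite[OF B] and ne = block_nonempty[OF B]
  have BS: "k \<in> S" "k < N" "- N < k" if "k \<in> B" for k
    using that block_subset[OF B] N[of k] by (auto simp: abs_less_iff)
  have zB: "?z \<in> B" using Max_in[OF fin ne] .
  have zS: "?z \<in> S" "- ?z \<in> S" using BS(1)[OF zB] S_sym by blast+
  have N0: "0 < N" using N[OF zS(1)] by linarith
  have NS: "N \<notin> S" "- N \<notin> S" using N[of N] N[of "- N"] by auto
  have NC: "N \<notin> C" "- N \<notin> C" if "C \<in> \<Lambda>" for C using NS block_subset[OF that] by blast+
  have zN: "\<bar>?z\<bar> < N" using N[OF zS(1)] .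
  have negB: "uminus ` B \<in> \<Lambda>" by (rule sym[OF B])
  have BnegB: "B \<inter> uminus ` B = {}" using no_opposite[OF B] by auto
  have adj1: "adjacent B1 i j \<longleftrightarrow> adjacent B i j \<or> i = ?z \<and> j = N" for i j
    unfolding B1_def using fin NC(1)[OF B] ne BS(2) by (rule adjacent_insert_greatest)
  have adj2: "adjacent B2 i j \<longleftrightarrow> adjacent (uminus ` B) i j \<or> i = - N \<and> j = - ?z" for i j
  proof -
    have "adjacent B2 i j \<longleftrightarrow> adjacent B1 (- j) (- i)"
      using adjacent_uminus[of B1 "- i" "- j"] adjacent_uminus[of "insert N B" "- j" "- i"]
      unfolding B2_def B1_def by simp
    also have "\<dots> \<longleftrightarrow> adjacent B (- j) (- i) \<or> - j = ?z \<and> - i = N" by (rule adj1)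
    also have "adjacent B (- j) (- i) \<longleftrightarrow> adjacent (uminus ` B) i j"
      using adjacent_uminus[of B "- i" "- j"] by simp
    finally show ?thesis by auto
  qed
  have arcs2: "(i, j) \<in> arcs \<Lambda>2 \<longleftrightarrow> (i, j) \<in> arcs \<Lambda> \<or> i = ?z \<and> j = N \<or> i = - N \<and> j = - ?z" for i j
  proof -
    have "(i, j) \<in> arcs \<Lambda>2 \<longleftrightarrow> (\<exists>C\<in>\<Lambda> - {B, uminus ` B}. adjacent C i j) \<or> adjacent B1 i j \<or> adjacent B2 i j"
      unfolding mem_arcs_iff \<Lambda>2_def by blast
    moreover have "(i, j) \<in> arcs \<Lambda> \<longleftrightarrow> (\<exists>C\<in>\<Lambda> - {B, uminus ` B}. adjacent C i j) \<or> adjacent B i j \<or> adjacent (uminus ` B) i j"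
      unfolding mem_arcs_iff using B negB by blast
    ultimately show ?thesis unfolding adj1 adj2 by blast
  qed
  have mem2: "(i, j, d) \<in> L2 \<longleftrightarrow> (i, j, d) \<in> L \<or> (i = ?z \<and> j = N \<and> d = c) \<or> (i = - N \<and> j = - ?z \<and> d = c)" for i j d
    unfolding L2_def by blast
  show "sym_partition (insert N (insert (- N) S)) \<Lambda>2 L2"
  proof
    show "sym_labeled (insert N (insert (- N) S)) (\<Lambda>2, L2)"
    proof (rule sym_labeledI)
      show "partition_on (insert N (insert (- N) S)) \<Lambda>2"
      proof (rule partition_onI)
        have "\<Union>\<Lambda> = S" using part by (simp add: partition_on_def)
        moreover have "\<Union>\<Lambda> = \<Union>(\<Lambda> - {B, uminus ` B}) \<union> B \<union> uminus ` B" using B negB by blast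
        moreover have "\<Union>\<Lambda>2 = \<Union>(\<Lambda> - {B, uminus ` B}) \<union> insert N B \<union> insert (- N) (uminus ` B)"
          unfolding \<Lambda>2_def B1_def B2_def by auto
        ultimately show "\<Union>\<Lambda>2 = insert N (insert (- N) S)" by auto
        show "{} \<notin> \<Lambda>2" using block_nonempty unfolding \<Lambda>2_def B1_def B2_def by blast
        have d12: "B1 \<inter> B2 = {}"
        proof -
          have "x \<noteq> - y" if "x \<in> insert N B" "y \<in> insert N B" for x y
          proof
            assume x: "x = - y"
            from that consider "x = N" "y = N" | "x = N" "y \<in> B" | "x \<in> B" "y = N" | "x \<in> B" "y \<in> B" by blast
            then show False
            proof cases
              case 1
              then show ?thesis using x N0 by simp
            next
              case 2
              then show ?thesis using x BS(3)[OF 2(2)] by simp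
            next
              case 3
              then show ?thesis using x BS(3)[OF 3(1)] by simp
            next
              case 4
              then show ?thesis using x no_opposite[OF B 4(2)] by simp
            qed
          qed
          then show ?thesis unfolding B1_def B2_def by blast
        qed
        have d1: "C \<inter> B1 = {}" if "C \<in> \<Lambda>" "C \<noteq> B" for C
          using block_eq[OF that(1) B] that(2) NC(1)[OF that(1)] unfolding B1_def by blast
        have d2: "C \<inter> B2 = {}" if "C \<in> \<Lambda>" "C \<noteq> uminus ` B" for C
          using block_eq[OF that(1) negB] that(2) NC(2)[OF that(1)] unfolding B2_def by blast
        have d0: "C \<inter> C' = {}" if "C \<in> \<Lambda>" "C' \<in> \<Lambda>" "C \<noteq> C'" for C C'
          using block_eq[OF that(1,2)] that(3) by blast
        show "disjnt p q" if pq: "p \<in> \<Lambda>2" "q \<in> \<Lambda>2" "p \<noteq> q" for p q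
        proof -
          have p: "p \<in> \<Lambda> \<and> p \<noteq> B \<and> p \<noteq> uminus ` B \<or> p = B1 \<or> p = B2" using pq(1) unfolding \<Lambda>2_def by blast
          have q: "q \<in> \<Lambda> \<and> q \<noteq> B \<and> q \<noteq> uminus ` B \<or> q = B1 \<or> q = B2" using pq(2) unfolding \<Lambda>2_def by blast
          have "p \<inter> q = {}"
            using p
          proof (elim disjE)
            assume p: "p \<in> \<Lambda> \<and> p \<noteq> B \<and> p \<noteq> uminus ` B"
            show ?thesis using q d0[of p q] d1[of p] d2[of p] p pq(3) by blast
          next
            assume p: "p = B1"
            show ?thesis using q d1[of q] d12 p pq(3) by blast
          next
            assume p: "p = B2"
            show ?thesis using q d2[of q] d12 p pq(3) by blast
          qed
          then show ?thesis unfolding disjnt_def .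
        qed
      qed
      show "uminus ` C \<in> \<Lambda>2" if C: "C \<in> \<Lambda>2" for C
      proof -
        consider "C \<in> \<Lambda>" "C \<noteq> B" "C \<noteq> uminus ` B" | "C = B1" | "C = B2" using C unfolding \<Lambda>2_def by blast
        then show ?thesis
        proof cases
          case 1
          have "uminus ` C \<noteq> B" using 1(3) image_uminus_uminus[of C] by auto
          moreover have "uminus ` C \<noteq> uminus ` B" using 1(2) image_uminus_uminus[of C] image_uminus_uminus[of B] by metis
          ultimately show ?thesis using sym[OF 1(1)] unfolding \<Lambda>2_def by blast
        next
          case 2
          then have "uminus ` C = B2" unfolding B1_def B2_def by simp
          then show ?thesis unfolding \<Lambda>2_def by blast
        next
          case 3
          then have "uminus ` C = B1" unfolding B1_def B2_def by (simp only: image_uminus_uminus)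
          then show ?thesis unfolding \<Lambda>2_def by blast
        qed
      qed
      show "(i, j) \<in> arcs \<Lambda>2 \<and> d \<noteq> 0 \<and> (- j, - i, d) \<in> L2 \<and> i + j \<noteq> 0" if ijd: "(i, j, d) \<in> L2" for i j d
      proof -
        consider (old) "(i, j, d) \<in> L" | (new) "i = ?z" "j = N" "d = c" | (neg) "i = - N" "j = - ?z" "d = c"
          using ijd unfolding mem2 by blast
        then show ?thesis
        proof cases
          case old
          show ?thesis unfolding arcs2 mem2
            using label_arc[OF old] label_nonzero[OF old] label_sym[OF old] label_sum[OF old] by blast
        next
          case new
          have "i + j \<noteq> 0" using new zN by linarith
          moreover have "- j = - N" "- i = - ?z" using new by simp_all
          ultimately show ?thesis unfolding arcs2 mem2 using new c by blast
        next
          case neg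
          have "i + j \<noteq> 0" using neg zN by linarith
          moreover have "- j = ?z" "- i = N" using neg by simp_all
          ultimately show ?thesis unfolding arcs2 mem2 using neg c by blast
        qed
      qed
      show "\<exists>d. (i, j, d) \<in> L2" if "(i, j) \<in> arcs \<Lambda>2" for i j
        using that label_exists unfolding arcs2 mem2 by blast
      show "d = d'" if d: "(i, j, d) \<in> L2" and d': "(i, j, d') \<in> L2" for i j d d'
      proof (cases "(i, j, d) \<in> L")
        case True
        have "j \<noteq> N" "i \<noteq> - N" using label_in_S[OF True] NS by blast+
        then show ?thesis using d' True label_unique[OF True] unfolding mem2 by blast
      next
        case False
        with d have "j = N \<or> i = - N" "d = c" unfolding mem2 by blast+
        then show ?thesis using d' label_in_S[of i j d'] NS unfolding mem2 by blast
      qed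
    qed
    show "finite (insert N (insert (- N) S))" using finite_S by simp
    show "0 \<notin> insert N (insert (- N) S)" using zero_S N0 by simp
  qed
  have pred1: "abs_pred B1 a b \<longleftrightarrow> abs_pred B a b" if "\<bar>b\<bar> < N" for a b
  proof -
    have "\<bar>a\<bar> < \<bar>b\<bar> \<Longrightarrow> a \<noteq> N" "b \<noteq> N" using that by auto
    moreover have "\<bar>b\<bar> \<le> \<bar>N\<bar>" using that by simp
    ultimately show ?thesis unfolding abs_pred_def B1_def by blast
  qed
  have pred2: "abs_pred B2 a b \<longleftrightarrow> abs_pred (uminus ` B) a b" if "\<bar>b\<bar> < N" for a b
    using pred1[of "- b" "- a"] that abs_pred_uminus[of B1 "- a" "- b"] abs_pred_uminus[of B "- a" "- b"]
    unfolding B1_def B2_def by simp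
  have predN: "abs_pred B1 a N \<longleftrightarrow> a = e" for a
  proof
    assume a: "abs_pred B1 a N"
    then have a': "a \<in> B" "\<bar>a\<bar> < \<bar>N\<bar>" unfolding abs_pred_def B1_def by auto
    have "\<bar>e\<bar> \<le> \<bar>a\<bar> \<or> \<bar>N\<bar> \<le> \<bar>e\<bar>" using a e(1) unfolding abs_pred_def B1_def by blast
    then have "\<bar>e\<bar> \<le> \<bar>a\<bar>" using N[OF BS(1)[OF e(1)]] by linarith
    then show "a = e" using e(2)[OF a'(1)] by (intro abs_eq_imp_eq[OF B a'(1) e(1)]) simp
  next
    assume [simp]: "a = e"
    have "\<bar>e\<bar> < \<bar>N\<bar>" using N[OF BS(1)[OF e(1)]] by linarith
    then show "abs_pred B1 a N" using e unfolding abs_pred_def B1_def by auto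
  qed
  have "(i, j, s, d) \<in> sym_arcs (\<Lambda>2, L2) \<longleftrightarrow>
    (i, j, s, d) \<in> sym_arcs (\<Lambda>, L) \<or> i = index e \<and> j = index N \<and> s = (0 < e) \<and> d = c" for i j s d
  proof
    assume "(i, j, s, d) \<in> sym_arcs (\<Lambda>2, L2)"
    then obtain a b C y where *: "C \<in> \<Lambda>2" "0 < b" "abs_pred C a b" "(y, b, d) \<in> L2" "\<bar>y\<bar> < b"
      "i = index a" "j = index b" "s = (0 < a)" unfolding mem_sym_arcs_iff by blast
    have bC: "b \<in> C" using *(3) unfolding abs_pred_def by blast
    show "(i, j, s, d) \<in> sym_arcs (\<Lambda>, L) \<or> i = index e \<and> j = index N \<and> s = (0 < e) \<and> d = c"
    proof (cases "b = N")
      case True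
      have "C = B1"
      proof -
        have "N \<in> uminus ` insert N B \<longleftrightarrow> - N \<in> insert N B" by force
        then have "N \<notin> uminus ` insert N B" using NC(2)[OF B] N0 by simp
        then show ?thesis using *(1) bC True NC(1) unfolding \<Lambda>2_def B2_def by blast
      qed
      then have "a = e" using *(3) predN True by simp
      moreover have "d = c"
      proof -
        have "N \<noteq> - ?z" using zN by linarith
        then show ?thesis using *(4) True label_in_S(2)[of y N d] NS(1) unfolding mem2 by blast
      qed
      ultimately show ?thesis using * True by blast
    next
      case False
      have bS: "b \<in> S"
        using *(1) bC False block_subset *(2) N0 BS(1) negB unfolding \<Lambda>2_def B1_def B2_def
        by (auto dest: S_sym)
      have bN: "\<bar>b\<bar> < N" using N[OF bS] .
      have "(y, b, d) \<in> L" using *(4) False *(5) bN unfolding mem2 by auto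
      moreover have "\<exists>C\<in>\<Lambda>. abs_pred C a b"
        using *(1,3) pred1[OF bN] pred2[OF bN] B negB unfolding \<Lambda>2_def by blast
      ultimately show ?thesis unfolding mem_sym_arcs_iff using * by blast
    qed
  next
    assume "(i, j, s, d) \<in> sym_arcs (\<Lambda>, L) \<or> i = index e \<and> j = index N \<and> s = (0 < e) \<and> d = c"
    then show "(i, j, s, d) \<in> sym_arcs (\<Lambda>2, L2)"
    proof
      assume "(i, j, s, d) \<in> sym_arcs (\<Lambda>, L)"
      then obtain a b C y where *: "C \<in> \<Lambda>" "0 < b" "abs_pred C a b" "(y, b, d) \<in> L" "\<bar>y\<bar> < b"
        "i = index a" "j = index b" "s = (0 < a)" unfolding mem_sym_arcs_iff by blast
      have bN: "\<bar>b\<bar> < N" using N[OF label_in_S(2)[OF *(4)]] .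
      have "\<exists>C\<in>\<Lambda>2. abs_pred C a b"
        using *(1,3) pred1[OF bN] pred2[OF bN] unfolding \<Lambda>2_def by blast
      moreover have "(y, b, d) \<in> L2" using *(4) unfolding mem2 by blast
      ultimately show ?thesis unfolding mem_sym_arcs_iff using * by blast
    next
      assume *: "i = index e \<and> j = index N \<and> s = (0 < e) \<and> d = c"
      have "B1 \<in> \<Lambda>2" unfolding \<Lambda>2_def by blast
      moreover have "abs_pred B1 e N" using predN by simp
      moreover have "(?z, N, c) \<in> L2" unfolding mem2 by blast
      ultimately show ?thesis unfolding mem_sym_arcs_iff using * N0 zN by blast
    qed
  qed
  then show "sym_arcs (\<Lambda>2, L2) = insert (index e, index N, (0 < e), c) (sym_arcs (\<Lambda>, L))"
    unfolding set_eq_iff split_paired_All insert_iff prod.inject by blast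
qed

end

lemma sym_partition_ground: "sym_labeled (ground n) (\<Lambda>, L) \<longleftrightarrow> sym_partition (ground n) \<Lambda> L"
proof -
  have "finite (ground n)" "0 \<notin> ground n" by (auto simp: ground_def)
  then show ?thesis unfolding sym_partition_def by blast
qed

lemma ground_Suc: "ground (Suc n) = insert (int (Suc n)) (insert (- int (Suc n)) (ground n))"
  by (auto simp: ground_def)

text \<open>
  By induction on \<open>n\<close>: if no arc ends at the last vertex, then \<open>n + 1\<close> and \<open>- (n + 1)\<close> are added as
  singletons, and otherwise they are attached to the two blocks through the start of that arc.  The
  bit of its colour decides which of the two receives \<open>n + 1\<close>.
\<close>

lemma sym_arcs_surj:
  assumes "T \<in> arc_diagrams n (UNIV \<times> - {0 :: 'f::zero})"
  shows "\<exists>\<Lambda> L. sym_partition (ground n) \<Lambda> L \<and> sym_arcs (\<Lambda>, L) = T"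
  using assms
proof (induction n arbitrary: T)
  case 0
  have "sym_partition (ground 0) {} ({} :: (int \<times> int \<times> 'f) set)"
    by unfold_locales (simp_all add: sym_labeled_def ground_def partition_on_def arcs_def)
  moreover have "sym_arcs ({}, {} :: (int \<times> int \<times> 'f) set) = {}" by (simp add: sym_arcs_def)
  ultimately show ?case using 0 unfolding arc_diagrams_0 by blast
next
  case (Suc n)
  define T' where "T' = {(i, j, c). (i, j, c) \<in> T \<and> j < n}"
  have memT': "(i, j, c) \<in> T' \<longleftrightarrow> (i, j, c) \<in> T \<and> j < n" for i j c by (simp add: T'_def)
  have "T' \<in> arc_diagrams n (UNIV \<times> - {0})"
  proof (rule arc_diagramsI)
    fix i j sc assume ij: "(i, j, sc) \<in> T'"
    then have T: "(i, j, sc) \<in> T" "j < n" using memT' by auto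
    show "i < j \<and> j < n \<and> sc \<in> UNIV \<times> - {0}" using arc_diagramsD(1,3)[OF Suc.prems T(1)] T(2) by blast
    show "j = j' \<and> sc = sc'" if "(i, j', sc') \<in> T'" for j' sc'
      using arc_diagramsD(4)[OF Suc.prems T(1), of j' sc'] that memT' by blast
    show "i = i' \<and> sc = sc'" if "(i', j, sc') \<in> T'" for i' sc'
      using arc_diagramsD(5)[OF Suc.prems T(1), of i' sc'] that memT' by blast
  qed
  from Suc.IH[OF this] obtain \<Lambda> and L :: "(int \<times> int \<times> 'f) set"
    where \<Lambda>: "sym_partition (ground n) \<Lambda> L" and T': "sym_arcs (\<Lambda>, L) = T'" by blast
  interpret sym_partition "ground n" \<Lambda> L by fact
  let ?N = "int (Suc n)"
  have N: "\<bar>x\<bar> < ?N" if "x \<in> ground n" for x using that by (simp add: mem_ground_iff)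
  have idxN: "index ?N = n" by (simp add: index_def)
  show ?case
  proof (cases "\<exists>i sc. (i, n, sc) \<in> T")
    case False
    have "T = T'"
    proof -
      have "(i, j, c) \<in> T' \<longleftrightarrow> (i, j, c) \<in> T" for i j c
        using memT' False arc_diagramsD(2)[OF Suc.prems, of i j c] less_antisym by blast
      then show ?thesis unfolding set_eq_iff split_paired_All by blast
    qed
    let ?X = "{{?N}, {- ?N}}"
    have noarc: "arcs ?X = {}" unfolding arcs_def by auto
    have X: "sym_partition {?N, - ?N} ?X ({} :: (int \<times> int \<times> 'f) set)"
    proof
      show "sym_labeled {?N, - ?N} (?X, {} :: (int \<times> int \<times> 'f) set)"
        unfolding sym_labeled_def prod.case noarc by (auto simp: partition_on_def disjoint_def)
    qed simp_all
    have disj: "ground n \<inter> {?N, - ?N} = {}" using N[of ?N] N[of "- ?N"] by auto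
    have "sym_arcs (?X, {} :: (int \<times> int \<times> 'f) set) = {}" by (simp add: sym_arcs_def)
    with sym_partition_Un[OF \<Lambda> X disj] T' \<open>T = T'\<close>
    have "sym_partition (ground n \<union> {?N, - ?N}) (\<Lambda> \<union> ?X) (L \<union> {})" "sym_arcs (\<Lambda> \<union> ?X, L \<union> {}) = T" by simp_all
    moreover have "ground n \<union> {?N, - ?N} = ground (Suc n)" unfolding ground_Suc by blast
    ultimately show ?thesis by metis
  next
    case True
    then obtain i s c where arc: "(i, n, s, c) \<in> T" by auto
    have i: "i < n" and c: "c \<noteq> 0" using arc_diagramsD(1,3)[OF Suc.prems arc] by auto
    define e where "e = (if s then int i + 1 else - (int i + 1))"
    have e: "e \<in> ground n" "index e = i" "(0 < e) = s" using i by (auto simp: e_def mem_ground_iff index_def)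
    obtain B where B: "B \<in> \<Lambda>" "e \<in> B" using block_cover[OF e(1)] by blast
    \<comment> \<open>a larger element of \<open>B\<close> would give a second arc of \<open>T\<close> starting at \<open>i\<close>\<close>
    have emax: "\<bar>k\<bar> \<le> \<bar>e\<bar>" if k: "k \<in> B" for k
    proof (rule ccontr)
      assume "\<not> \<bar>k\<bar> \<le> \<bar>e\<bar>"
      then obtain f where f: "abs_pred B e f" using abs_succ_exists[OF block_finite[OF B(1)] B(2) k] by auto
      have "\<exists>j sc. (i, j, sc) \<in> T'"
      proof (cases "0 < f")
        case True
        then obtain z d where "(index e, index f, (0 < e), d) \<in> sym_arcs (\<Lambda>, L)" using sym_arcs_mem[OF B(1) f] by blast
        then show ?thesis unfolding T' e(2) by blast
      next
        case False
        have "f \<in> B" using f unfolding abs_pred_def by blast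
        with False have "0 < - f" using block_zero[OF B(1)] by fastforce
        moreover have "abs_pred (uminus ` B) (- e) (- f)" using f by (simp only: abs_pred_uminus)
        ultimately obtain z d where "(index (- e), index (- f), (0 < - e), d) \<in> sym_arcs (\<Lambda>, L)"
          using sym_arcs_mem[OF sym[OF B(1)]] by blast
        moreover have "index (- e) = i" using e(2) by (simp add: index_def)
        ultimately show ?thesis unfolding T' by auto
      qed
      then obtain j sc where "(i, j, sc) \<in> T" "j < n" using memT' by blast
      then show False using arc_diagramsD(4)[OF Suc.prems arc, of j sc] by simp
    qed
    have "T = insert (i, n, s, c) T'"
    proof -
      have "(i', j, sc) \<in> T \<longleftrightarrow> (i', j, sc) \<in> insert (i, n, s, c) T'" for i' j sc
      proof
        assume mem: "(i', j, sc) \<in> T"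
        show "(i', j, sc) \<in> insert (i, n, s, c) T'"
        proof (cases "j = n")
          case True
          with arc_diagramsD(5)[OF Suc.prems arc, of i' sc] mem show ?thesis by blast
        next
          case False
          then have "j < n" using arc_diagramsD(2)[OF Suc.prems mem] by simp
          then show ?thesis using mem memT' by blast
        qed
      next
        assume "(i', j, sc) \<in> insert (i, n, s, c) T'"
        then show "(i', j, sc) \<in> T" using arc memT' by blast
      qed
      then show ?thesis unfolding set_eq_iff split_paired_All by blast
    qed
    moreover have N_Ball: "\<forall>x\<in>ground n. \<bar>x\<bar> < ?N" and e_Ball: "\<forall>k\<in>B. \<bar>k\<bar> \<le> \<bar>e\<bar>" using N emax by blast+
    note att = attached[OF N_Ball B e_Ball c]
    ultimately show ?thesis
      using att(1) att(2)[unfolded e(2,3) idxN T'] unfolding ground_Suc by metis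
  qed
qed

lemma bij_sym_arcs: "bij_betw sym_arcs (D n) (arc_diagrams n (UNIV \<times> - {0 :: 'f::field}))"
proof (rule bij_betw_imageI)
  show "inj_on sym_arcs (D n :: 'f labeled_partition set)"
  proof (rule inj_onI)
    fix x y :: "'f labeled_partition" assume "x \<in> D n" "y \<in> D n" and eq: "sym_arcs x = sym_arcs y"
    obtain \<Lambda> L \<Lambda>' L' where xy: "x = (\<Lambda>, L)" "y = (\<Lambda>', L')" by (cases x, cases y)
    have "sym_partition (ground n) \<Lambda> L" "sym_partition (ground n) \<Lambda>' L'"
      using \<open>x \<in> D n\<close> \<open>y \<in> D n\<close> unfolding xy mem_D_iff sym_partition_ground by blast+
    from sym_arcs_inj[OF this eq[unfolded xy]] show "x = y" unfolding xy .
  qed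
  show "sym_arcs ` D n = arc_diagrams n (UNIV \<times> - {0 :: 'f})"
  proof
    show "sym_arcs ` D n \<subseteq> arc_diagrams n (UNIV \<times> - {0 :: 'f})"
    proof (rule image_subsetI)
      fix x :: "'f labeled_partition" assume "x \<in> D n"
      obtain \<Lambda> L where x: "x = (\<Lambda>, L)" by (cases x)
      have "sym_partition (ground n) \<Lambda> L" using \<open>x \<in> D n\<close> unfolding x mem_D_iff sym_partition_ground .
      from sym_partition.sym_arcs_diagram[OF this refl] show "sym_arcs x \<in> arc_diagrams n (UNIV \<times> - {0})"
        unfolding x .
    qed
    show "arc_diagrams n (UNIV \<times> - {0 :: 'f}) \<subseteq> sym_arcs ` D n"
    proof
      fix T :: "(nat \<times> nat \<times> bool \<times> 'f) set" assume "T \<in> arc_diagrams n (UNIV \<times> - {0})"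
      from sym_arcs_surj[OF this] obtain \<Lambda> L where "sym_partition (ground n) \<Lambda> L" "sym_arcs (\<Lambda>, L) = T" by blast
      then have "(\<Lambda>, L) \<in> D n" unfolding mem_D_iff sym_partition_ground by blast
      with \<open>sym_arcs (\<Lambda>, L) = T\<close> show "T \<in> sym_arcs ` D n" by blast
    qed
  qed
qed

section \<open>Superclass functions on even orthogonal groups\<close>

lemma mem_D_sym_partition: "(\<Lambda>, L) \<in> D n \<longleftrightarrow> sym_partition (ground n) \<Lambda> L"
  unfolding mem_D_iff sym_partition_ground by (rule refl)

lemma lp_union_shift:
  fixes x y :: "'f::field labeled_partition"
  assumes x: "x \<in> D m" and y: "y \<in> D n"
  shows "lp_union x (shift m y) \<in> D (m + n)"
    "sym_arcs (lp_union x (shift m y)) = sym_arcs x \<union> relabel_arcs (\<lambda>i. i + m) (sym_arcs y)"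
proof -
  obtain \<Lambda> L \<Lambda>' L' where xy: "x = (\<Lambda>, L)" "y = (\<Lambda>', L')" by (cases x, cases y)
  have X: "sym_partition (ground m) \<Lambda> L" and Y: "sym_partition (ground n) \<Lambda>' L'"
    using x y unfolding xy mem_D_sym_partition .
  let ?\<theta> = "\<lambda>i :: int. i + sgn i * int m"
  interpret Y: sym_relabelling "ground n" \<Lambda>' L' ?\<theta>
  proof (intro sym_relabelling.intro Y sym_relabelling_axioms.intro)
    show "?\<theta> a < ?\<theta> b" if "a < b" for a b using that by (simp add: sgn_if)
    show "?\<theta> (- a) = - ?\<theta> a" for a by (simp add: sgn_minus)
  qed
  let ?\<Lambda>'' = "(\<lambda>B. ?\<theta> ` B) ` \<Lambda>'" and ?L'' = "(\<lambda>(i, j, c). (?\<theta> i, ?\<theta> j, c)) ` L'"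
  have shift: "shift m y = (?\<Lambda>'', ?L'')" unfolding shift_def relabel_def xy by simp
  have abs: "\<bar>?\<theta> a\<bar> = \<bar>a\<bar> + int m" if "a \<noteq> 0" for a using that by (simp add: sgn_if)
  have disj: "ground m \<inter> ?\<theta> ` ground n = {}"
    using abs by (fastforce simp: mem_ground_iff)
  have un: "ground m \<union> ?\<theta> ` ground n = ground (m + n)"
  proof
    show "ground m \<union> ?\<theta> ` ground n \<subseteq> ground (m + n)"
      using abs by (auto simp: mem_ground_iff sgn_if)
    show "ground (m + n) \<subseteq> ground m \<union> ?\<theta> ` ground n"
    proof
      fix a assume a: "a \<in> ground (m + n)"
      show "a \<in> ground m \<union> ?\<theta> ` ground n"
      proof (cases "\<bar>a\<bar> \<le> int m")
        case True
        then show ?thesis using a by (simp add: mem_ground_iff)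
      next
        case False
        define b where "b = a - sgn a * int m"
        have "b \<in> ground n" "a = ?\<theta> b" using a False by (auto simp: b_def mem_ground_iff sgn_if)
        then show ?thesis by blast
      qed
    qed
  qed
  have union: "lp_union x (shift m y) = (\<Lambda> \<union> ?\<Lambda>'', L \<union> ?L'')" unfolding lp_union_def shift unfolding xy by simp
  note * = sym_partition_Un[OF X Y.relabelled disj]
  show "lp_union x (shift m y) \<in> D (m + n)" using *(1) unfolding union un mem_D_sym_partition .
  have "index a + m = index (?\<theta> a)" if "a \<in> ground n" for a
    using abs[of a] that by (auto simp: index_def mem_ground_iff)
  from Y.sym_arcs_relabelled[of "\<lambda>i. i + m", OF this]
  have arcs: "sym_arcs (?\<Lambda>'', ?L'') = relabel_arcs (\<lambda>i. i + m) (sym_arcs y)"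
    unfolding shift[symmetric] shift_def xy .
  show "sym_arcs (lp_union x (shift m y)) = sym_arcs x \<union> relabel_arcs (\<lambda>i. i + m) (sym_arcs y)"
    unfolding union *(2) arcs unfolding xy by (rule refl)
qed

lemma inj_on_index: "(\<And>x. x \<in> A \<Longrightarrow> 0 < x) \<Longrightarrow> inj_on index A"
proof (rule inj_onI)
  fix x y assume pos: "\<And>x. x \<in> A \<Longrightarrow> 0 < x" and xy: "x \<in> A" "y \<in> A" "index x = index y"
  have "0 < x" "0 < y" using pos xy(1,2) by blast+
  then show "x = y" using index_eq_iff[of x y] xy(3) by simp
qed

lemma index_sgn_mult: "a \<noteq> 0 \<Longrightarrow> index (sgn a * (int k + 1)) = k"
  by (simp add: index_def abs_mult abs_sgn_eq nat_add_distrib)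

lemma card_le_eq_pos_in_index:
  assumes A: "finite A" "\<And>x. x \<in> A \<Longrightarrow> 0 < x" and x: "\<bar>x\<bar> \<in> A"
  shows "card {b \<in> A. b \<le> \<bar>x\<bar>} = Suc (pos_in (index ` A) (index x))"
proof -
  have "{b \<in> A. b \<le> \<bar>x\<bar>} = insert \<bar>x\<bar> {b \<in> A. b < \<bar>x\<bar>}" using x by auto
  then have "card {b \<in> A. b \<le> \<bar>x\<bar>} = Suc (card {b \<in> A. b < \<bar>x\<bar>})" using A(1) by simp
  also have "card {b \<in> A. b < \<bar>x\<bar>} = card (index ` {b \<in> A. b < \<bar>x\<bar>})"
    using A(2) by (intro card_image[symmetric] inj_on_index) simp
  also have "index ` {b \<in> A. b < \<bar>x\<bar>} = {l \<in> index ` A. l < index x}"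
  proof -
    have "x \<noteq> 0" using A(2)[OF x] by simp
    have "index b < index x \<longleftrightarrow> b < \<bar>x\<bar>" if "b \<in> A" for b
      using index_less_iff[of b x] \<open>x \<noteq> 0\<close> A(2)[OF that] by simp
    then show ?thesis by blast
  qed
  finally show ?thesis unfolding pos_in_def .
qed

text \<open>
  On the elements of \<open>A \<union> - A\<close>, standardization is an odd increasing map, whose effect on vertices is
  \<open>pos_in (index ` A)\<close>.
\<close>

lemma standardize_restrict:
  fixes x :: "'f::field labeled_partition"
  assumes x: "x \<in> D n" and A: "A \<subseteq> {1..int n}"
    and split: "\<forall>B\<in>fst x. B \<subseteq> A \<union> uminus ` A \<or> B \<inter> (A \<union> uminus ` A) = {}"
  shows "standardize A (lp_restrict A x) \<in> D (card A)"
    "sym_arcs (standardize A (lp_restrict A x)) = std_arcs (index ` A) (sym_arcs x)"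
proof -
  obtain \<Lambda> L where x_eq: "x = (\<Lambda>, L)" by (cases x)
  interpret X: sym_partition "ground n" \<Lambda> L using x unfolding x_eq mem_D_sym_partition .
  let ?K = "A \<union> uminus ` A" and ?p = "\<lambda>x. pos_in (index ` A) (index x)"
  define \<Lambda>A where "\<Lambda>A = {B \<in> \<Lambda>. B \<subseteq> ?K}"
  define LA where "LA = {(i, j, c) \<in> L. (i, j) \<in> arcs \<Lambda>A}"
  define \<theta> where "\<theta> = (\<lambda>i. sgn i * int (card {b \<in> A. b \<le> \<bar>i\<bar>}))"
  have finA: "finite A" using A finite_subset by blast
  have posA: "0 < a" if "a \<in> A" for a using that A by auto
  have split': "B \<subseteq> ?K \<or> B \<inter> ?K = {}" if "B \<in> \<Lambda>" for B using split that unfolding x_eq by simp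
  have R1: "sym_partition (ground n \<inter> ?K) \<Lambda>A LA"
    unfolding LA_def \<Lambda>A_def by (rule X.restricted(1)) (use posA split' in blast)+
  have R2: "sym_arcs (\<Lambda>A, LA) = arcs_within (index ` A) (sym_arcs (\<Lambda>, L))"
    unfolding LA_def \<Lambda>A_def by (rule X.restricted(2)) (use posA split' in blast)+
  have K: "ground n \<inter> ?K = ?K" using A by (auto simp: mem_ground_iff)
  have absK: "\<bar>a\<bar> \<in> A" "a \<noteq> 0" if "a \<in> ?K" for a using that posA by force+
  have \<theta>: "\<theta> a = sgn a * (int (?p a) + 1)" if "a \<in> ?K" for a
  proof -
    have "card {b \<in> A. b \<le> \<bar>a\<bar>} = Suc (?p a)"
      by (rule card_le_eq_pos_in_index) (use finA posA absK(1)[OF that] in blast)+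
    then show ?thesis unfolding \<theta>_def by simp
  qed
  have fin': "finite (index ` A)" using finA by simp
  have idxK: "index a \<in> index ` A" if "a \<in> ?K" for a
  proof -
    have "index a = index \<bar>a\<bar>" by (simp add: index_def)
    then show ?thesis using absK(1)[OF that] by blast
  qed
  have p_less: "?p a < ?p b" if ab: "a \<in> ?K" "b \<in> ?K" "\<bar>a\<bar> < \<bar>b\<bar>" for a b
    using strict_mono_onD[OF strict_mono_pos_in[OF fin'] idxK[OF ab(1)] idxK[OF ab(2)]]
      index_less_iff[OF absK(2)[OF ab(1)] absK(2)[OF ab(2)]] ab(3) by simp
  interpret R: sym_relabelling ?K \<Lambda>A LA \<theta>
  proof (intro sym_relabelling.intro R1[unfolded K] sym_relabelling_axioms.intro)
    fix a b assume ab: "a \<in> ?K" "b \<in> ?K" "a < b"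
    have nz: "a \<noteq> 0" "b \<noteq> 0" using absK(2) ab by auto
    consider "0 < a" | "a < 0" "0 < b" | "b < 0" using nz by linarith
    then show "\<theta> a < \<theta> b"
    proof cases
      case 1
      then have "?p a < ?p b" using ab by (intro p_less) auto
      then show ?thesis using 1 ab(3) unfolding \<theta>[OF ab(1)] \<theta>[OF ab(2)] by simp
    next
      case 2
      then show ?thesis unfolding \<theta>[OF ab(1)] \<theta>[OF ab(2)] by simp
    next
      case 3
      then have "?p b < ?p a" using ab by (intro p_less) auto
      then show ?thesis using 3 ab(3) unfolding \<theta>[OF ab(1)] \<theta>[OF ab(2)] by simp
    qed
  next
    show "\<theta> (- a) = - \<theta> a" for a unfolding \<theta>_def by (simp add: sgn_minus)
  qed
  have card: "card (index ` A) = card A" using posA by (intro card_image inj_on_index)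
  have image: "\<theta> ` ?K = ground (card A)"
  proof
    show "\<theta> ` ?K \<subseteq> ground (card A)"
    proof (rule image_subsetI)
      fix a assume a: "a \<in> ?K"
      have "?p a < card A" using pos_in_less[OF fin' idxK[OF a]] card by simp
      moreover have "a \<noteq> 0" using absK(2)[OF a] .
      ultimately show "\<theta> a \<in> ground (card A)"
        unfolding \<theta>[OF a] mem_ground_iff by (auto simp: sgn_if)
    qed
    show "ground (card A) \<subseteq> \<theta> ` ?K"
    proof
      fix r assume r: "r \<in> ground (card A)"
      then have "index r < card (index ` A)" using index_less_ground[OF r] card by simp
      then obtain l where l: "l \<in> index ` A" "pos_in (index ` A) l = index r"
        using bij_pos_in[OF fin'] unfolding bij_betw_def by (metis imageE lessThan_iff)
      then obtain a where a: "a \<in> A" "l = index a" by blast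
      have r0: "r \<noteq> 0" using r by (simp add: mem_ground_iff)
      have a0: "0 < a" using posA[OF a(1)] .
      define b where "b = sgn r * a"
      have b: "b \<in> ?K" "sgn b = sgn r" "index b = l"
        using a a0 r0 unfolding b_def by (auto simp: sgn_if index_def)
      have "\<theta> b = sgn r * (int (index r) + 1)" using \<theta>[OF b(1)] b(2,3) l(2) by simp
      also have "\<dots> = r" using r0 by (simp add: index_def sgn_if)
      finally show "r \<in> \<theta> ` ?K" using b(1) by blast
    qed
  qed
  have std: "standardize A (lp_restrict A x) = relabel \<theta> (\<Lambda>A, LA)"
    unfolding standardize_def lp_restrict_def x_eq \<theta>_def \<Lambda>A_def LA_def Let_def by simp
  show "standardize A (lp_restrict A x) \<in> D (card A)"
    using R.relabelled unfolding std image relabel_def prod.case mem_D_sym_partition .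
  have idx: "?p a = index (\<theta> a)" if "a \<in> ?K" for a
    unfolding \<theta>[OF that] using index_sgn_mult[OF absK(2)[OF that]] by simp
  have arcs: "sym_arcs (relabel \<theta> (\<Lambda>A, LA)) = relabel_arcs (pos_in (index ` A)) (sym_arcs (\<Lambda>A, LA))"
    by (rule R.sym_arcs_relabelled) (rule idx)
  show "sym_arcs (standardize A (lp_restrict A x)) = std_arcs (index ` A) (sym_arcs x)"
    unfolding std arcs R2 std_arcs_def unfolding x_eq by (rule refl)
qed

lemma index_image: "index ` {1..int n} = {..<n}"
proof
  show "index ` {1..int n} \<subseteq> {..<n}" by (auto simp: index_def)
  show "{..<n} \<subseteq> index ` {1..int n}"
  proof
    fix k assume "k \<in> {..<n}"
    then have "k = index (int k + 1)" "int k + 1 \<in> {1..int n}" by (auto simp: index_def)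
    then show "k \<in> index ` {1..int n}" by blast
  qed
qed

lemma bij_index_image:
  assumes "\<And>A. A \<subseteq> {1..int n} \<Longrightarrow> R (index ` A) \<longleftrightarrow> Q A"
  shows "bij_betw (\<lambda>A. index ` A) {A. A \<subseteq> {1..int n} \<and> Q A} {A'. A' \<subseteq> {..<n} \<and> R A'}"
proof (rule bij_betw_imageI)
  have inj: "inj_on index {1..int n}" by (rule inj_on_index) simp
  show "inj_on (\<lambda>A. index ` A) {A. A \<subseteq> {1..int n} \<and> Q A}"
    using inj_on_image_eq_iff[OF inj] by (intro inj_onI) blast
  note img = index_image[of n]
  show "(\<lambda>A. index ` A) ` {A. A \<subseteq> {1..int n} \<and> Q A} = {A'. A' \<subseteq> {..<n} \<and> R A'}"
  proof
    show "(\<lambda>A. index ` A) ` {A. A \<subseteq> {1..int n} \<and> Q A} \<subseteq> {A'. A' \<subseteq> {..<n} \<and> R A'}"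
      using assms img by blast
    show "{A'. A' \<subseteq> {..<n} \<and> R A'} \<subseteq> (\<lambda>A. index ` A) ` {A. A \<subseteq> {1..int n} \<and> Q A}"
    proof
      fix A' assume A': "A' \<in> {A'. A' \<subseteq> {..<n} \<and> R A'}"
      then have "A' \<subseteq> index ` {1..int n}" using img by simp
      then obtain A where A: "A \<subseteq> {1..int n}" "A' = index ` A" unfolding subset_image_iff by blast
      with A' assms[OF A(1)] show "A' \<in> (\<lambda>A. index ` A) ` {A. A \<subseteq> {1..int n} \<and> Q A}" by blast
    qed
  qed
qed

text \<open>
  The given basis \<open>P\<close> is indexed by diagrams through the inverse of \<open>sym_arcs\<close>, which carries the
  operations on partitions to those on diagrams.
\<close>

theorem diagram_hopf_algebra_SC_UO:
  fixes H :: "('g::field mat, 'k::field) graded_hopf"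
  assumes "is_SC_UO H"
  shows "\<exists>P. diagram_hopf_algebra H (UNIV \<times> - {0} :: (bool \<times> 'g) set) P"
proof -
  interpret graded_connected_hopf_algebra H using assms unfolding is_SC_UO_def by blast
  obtain P where P: "is_SC_UO_basis H P" using assms unfolding is_SC_UO_def by blast
  have P_inj: "inj_on P (D n)" and P_ind: "fun_vs.independent (P ` D n)" and P_span: "fun_vs.span (P ` D n) = hcomp H n"
    for n using P unfolding is_SC_UO_basis_def by blast+
  have P_prod: "hprod H (P x) (P y) = P (lp_union x (shift m y))" if "x \<in> D m" "y \<in> D n" for m n x y
    using P that unfolding is_SC_UO_basis_def by blast
  have P_coprod: "hcoprod H (P x) =
      (\<Sum>A | A \<subseteq> {1..int n} \<and> (\<forall>B\<in>fst x. B \<subseteq> A \<union> uminus ` A \<or>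
                B \<subseteq> ({1..int n} - A) \<union> uminus ` ({1..int n} - A)).
         P (standardize A (lp_restrict A x)) \<boxtimes>
         P (standardize ({1..int n} - A) (lp_restrict ({1..int n} - A) x)))" if "x \<in> D n" for n x
    using P that unfolding is_SC_UO_basis_def by blast
  let ?C = "UNIV \<times> - {0 :: 'g} :: (bool \<times> 'g) set"
  define I where "I = (\<lambda>n. inv_into (D n) (sym_arcs :: 'g labeled_partition \<Rightarrow> _))"
  have I_bij: "bij_betw (I n) (arc_diagrams n ?C) (D n)" for n
    unfolding I_def by (rule bij_betw_inv_into[OF bij_sym_arcs])
  have I_D: "I n T \<in> D n" if "T \<in> arc_diagrams n ?C" for n T
    using bij_betwE[OF I_bij] that by blast
  have I_left: "I n (sym_arcs x) = x" if "x \<in> D n" for n x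
    unfolding I_def by (rule bij_betw_inv_into_left[OF bij_sym_arcs that])
  have I_right: "sym_arcs (I n T) = T" if "T \<in> arc_diagrams n ?C" for n T
    unfolding I_def by (rule bij_betw_inv_into_right[OF bij_sym_arcs that])
  have I_img: "(\<lambda>T. P (I n T)) ` arc_diagrams n ?C = P ` D n" for n
    using I_bij[of n] unfolding bij_betw_def image_image[symmetric] by simp
  have one: "hone H = P (I 0 {})"
  proof -
    let ?e = "I 0 {}"
    have e: "?e \<in> D 0" by (rule I_D) simp
    have hone: "hone H \<in> hspace H"
      unfolding hspace_def using connected(2) fun_vs.span_base[of "hone H" "{hone H}"]
      by (intro fun_vs.span_base) blast
    \<comment> \<open>in degree \<open>0\<close> the basis vector is an idempotent multiple of the unit, hence the unit\<close>
    have "sym_arcs (lp_union ?e (shift 0 ?e)) = {}"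
      using lp_union_shift(2)[OF e e] I_right[of "{}" 0] by (simp add: relabel_arcs_def)
    moreover have "lp_union ?e (shift 0 ?e) \<in> D 0" using lp_union_shift(1)[OF e e] by simp
    ultimately have "lp_union ?e (shift 0 ?e) = ?e" using I_left[of "lp_union ?e (shift 0 ?e)" 0] by simp
    then have idem: "hprod H (P ?e) (P ?e) = P ?e" using P_prod[OF e e] by simp
    have "P ?e \<in> fun_vs.span {hone H}"
      unfolding connected(2)[symmetric] P_span[symmetric] using e by (intro fun_vs.span_base) blast
    then obtain c where c: "P ?e = c *\<^sub>f hone H" unfolding fun_vs.span_singleton by blast
    have "0 \<notin> P ` D 0" using P_ind[of 0] fun_vs.dependent_zero by blast
    then have "P ?e \<noteq> 0" using e by (metis image_eqI)
    then have "c \<noteq> 0" using c fun_vs.scale_zero_left by metis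
    have "hprod H (P ?e) (P ?e) = c *\<^sub>f hprod H (hone H) (c *\<^sub>f hone H)"
      unfolding c by (rule prod_scale_left[OF hone])
        (simp add: hspace_def fun_vs.span_scale[OF hone[unfolded hspace_def]])
    also have "\<dots> = c *\<^sub>f c *\<^sub>f hone H"
      using prod_scale_right[OF hone hone] prod_one(1)[OF hone] by simp
    finally have "c *\<^sub>f c *\<^sub>f hone H = c *\<^sub>f hone H" using idem c by simp
    then have "c *\<^sub>f hone H = hone H"
      using \<open>c \<noteq> 0\<close> by (simp add: fun_vs.scale_left_imp_eq)
    then show ?thesis using c by simp
  qed
  have "diagram_hopf_algebra H ?C (\<lambda>n T. P (I n T))"
  proof unfold_locales
    show "inj_on (\<lambda>T. P (I n T)) (arc_diagrams n ?C)" for n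
      using comp_inj_on[of "I n" "arc_diagrams n ?C" P] I_bij[of n] P_inj[of n]
      by (simp add: bij_betw_def comp_def)
    show "fun_vs.independent ((\<lambda>T. P (I n T)) ` arc_diagrams n ?C)" for n
      unfolding I_img by (rule P_ind)
    show "fun_vs.span ((\<lambda>T. P (I n T)) ` arc_diagrams n ?C) = hcomp H n" for n
      unfolding I_img by (rule P_span)
    show "hprod H (P (I m S)) (P (I n T)) = P (I (m + n) (S \<union> relabel_arcs (\<lambda>i. i + m) T))"
      if S: "S \<in> arc_diagrams m ?C" and T: "T \<in> arc_diagrams n ?C" for m n S T
    proof -
      have "sym_arcs (lp_union (I m S) (shift m (I n T))) = S \<union> relabel_arcs (\<lambda>i. i + m) T"
        using lp_union_shift(2)[OF I_D[OF S] I_D[OF T]] I_right[OF S] I_right[OF T] by simp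
      then have "I (m + n) (S \<union> relabel_arcs (\<lambda>i. i + m) T) = lp_union (I m S) (shift m (I n T))"
        using I_left[OF lp_union_shift(1)[OF I_D[OF S] I_D[OF T]]] by simp
      then show ?thesis using P_prod[OF I_D[OF S] I_D[OF T]] by simp
    qed
    show "hcoprod H (P (I n T)) = (\<Sum>A | A \<subseteq> {..<n} \<and> splits A T.
        P (I (card A) (std_arcs A T)) \<boxtimes> P (I (card ({..<n} - A)) (std_arcs ({..<n} - A) T)))"
      if T: "T \<in> arc_diagrams n ?C" for n T
    proof -
      define x where "x = I n T"
      have x: "x \<in> D n" and xT: "sym_arcs x = T" using I_D[OF T] I_right[OF T] by (simp_all add: x_def)
      obtain \<Lambda> L where x_eq: "x = (\<Lambda>, L)" by (cases x)
      interpret X: sym_partition "ground n" \<Lambda> L using x unfolding x_eq mem_D_sym_partition .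
      define Q where "Q = (\<lambda>A. \<forall>B\<in>fst x. B \<subseteq> A \<union> uminus ` A \<or> B \<inter> (A \<union> uminus ` A) = {})"
      have compl: "B \<subseteq> ({1..int n} - A) \<union> uminus ` ({1..int n} - A) \<longleftrightarrow> B \<inter> (A \<union> uminus ` A) = {}"
        if "A \<subseteq> {1..int n}" "B \<subseteq> ground n" for A B
      proof -
        have "b \<in> ({1..int n} - A) \<union> uminus ` ({1..int n} - A) \<longleftrightarrow> b \<notin> A \<union> uminus ` A" if b: "b \<in> ground n" for b
        proof -
          have neg: "b \<in> uminus ` X \<longleftrightarrow> - b \<in> X" for X by force
          consider "b \<in> {1..int n}" "- b \<notin> {1..int n}" | "- b \<in> {1..int n}" "b \<notin> {1..int n}"
            using b unfolding ground_def by force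
          then show ?thesis
          proof cases
            case 1
            then have "- b \<notin> A" using \<open>A \<subseteq> {1..int n}\<close> by blast
            with 1 show ?thesis unfolding Un_iff neg Diff_iff by simp
          next
            case 2
            then have "b \<notin> A" using \<open>A \<subseteq> {1..int n}\<close> by blast
            with 2 show ?thesis unfolding Un_iff neg Diff_iff by simp
          qed
        qed
        then have "(\<forall>b\<in>B. b \<in> ({1..int n} - A) \<union> uminus ` ({1..int n} - A)) \<longleftrightarrow> (\<forall>b\<in>B. b \<notin> A \<union> uminus ` A)"
          using \<open>B \<subseteq> ground n\<close> by (intro ball_cong refl) blast
        then show ?thesis unfolding subset_eq disjoint_iff Ball_def .
      qed
      have Q_iff: "(\<forall>B\<in>fst x. B \<subseteq> A \<union> uminus ` A \<or> B \<subseteq> ({1..int n} - A) \<union> uminus ` ({1..int n} - A)) \<longleftrightarrow> Q A"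
        if "A \<subseteq> {1..int n}" for A
        unfolding Q_def
      proof (rule ball_cong[OF refl])
        fix B assume "B \<in> fst x"
        then have "B \<subseteq> ground n" unfolding x_eq fst_conv by (rule X.block_subset)
        from compl[OF that this]
        show "(B \<subseteq> A \<union> uminus ` A \<or> B \<subseteq> ({1..int n} - A) \<union> uminus ` ({1..int n} - A)) \<longleftrightarrow>
          (B \<subseteq> A \<union> uminus ` A \<or> B \<inter> (A \<union> uminus ` A) = {})" by (simp only:)
      qed
      have Q_splits: "splits (index ` A) T \<longleftrightarrow> Q A" if "A \<subseteq> {1..int n}" for A
      proof -
        have "0 < a" if "a \<in> A" for a using \<open>A \<subseteq> {1..int n}\<close> that by auto
        from X.splits_sym_arcs_iff[of A, OF this] show ?thesis
          unfolding Q_def xT[symmetric] x_eq fst_conv .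
      qed
      have Q_compl: "Q ({1..int n} - A)" if A: "A \<subseteq> {1..int n}" and QA: "Q A" for A
      proof -
        have "{1..int n} - ({1..int n} - A) = A" using A by blast
        moreover have "\<forall>B\<in>fst x. B \<subseteq> A \<union> uminus ` A \<or> B \<subseteq> ({1..int n} - A) \<union> uminus ` ({1..int n} - A)"
          using QA Q_iff[OF A] by blast
        ultimately show ?thesis using Q_iff[of "{1..int n} - A"] by auto
      qed
      have std: "P (standardize A (lp_restrict A x)) = P (I (card (index ` A)) (std_arcs (index ` A) T))"
        if A: "A \<subseteq> {1..int n}" and QA: "Q A" for A
      proof -
        have "inj_on index A" using A by (intro inj_on_index) auto
        then have "card (index ` A) = card A" by (rule card_image)
        then show ?thesis
          using standardize_restrict[OF x A QA[unfolded Q_def]] I_left[of _ "card A"] xT by metis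
      qed
      have idx_compl: "index ` ({1..int n} - A) = {..<n} - index ` A" if A: "A \<subseteq> {1..int n}" for A
      proof -
        have inj: "inj_on index {1..int n}" by (rule inj_on_index) simp
        show ?thesis using inj_on_image_set_diff[OF inj _ A, of "{1..int n}"] index_image[of n] by simp
      qed
      let ?g = "\<lambda>A. P (I (card A) (std_arcs A T)) \<boxtimes> P (I (card ({..<n} - A)) (std_arcs ({..<n} - A) T))"
      have "hcoprod H (P x) = (\<Sum>A | A \<subseteq> {1..int n} \<and> Q A. ?g (index ` A))"
        unfolding P_coprod[OF x]
      proof (rule sum.cong)
        show "{A. A \<subseteq> {1..int n} \<and> (\<forall>B\<in>fst x. B \<subseteq> A \<union> uminus ` A \<or>
            B \<subseteq> ({1..int n} - A) \<union> uminus ` ({1..int n} - A))} = {A. A \<subseteq> {1..int n} \<and> Q A}"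
          using Q_iff by blast
        fix A assume "A \<in> {A. A \<subseteq> {1..int n} \<and> Q A}"
        then have A: "A \<subseteq> {1..int n}" "Q A" by simp_all
        have A': "{1..int n} - A \<subseteq> {1..int n}" by blast
        show "P (standardize A (lp_restrict A x)) \<boxtimes>
            P (standardize ({1..int n} - A) (lp_restrict ({1..int n} - A) x)) = ?g (index ` A)"
          unfolding std[OF A] std[OF A' Q_compl[OF A]] idx_compl[OF A(1)] by (rule refl)
      qed
      also have "\<dots> = (\<Sum>A | A \<subseteq> {..<n} \<and> splits A T. ?g A)"
      proof (rule sum.reindex_bij_betw)
        show "bij_betw (\<lambda>A. index ` A) {A. A \<subseteq> {1..int n} \<and> Q A} {A. A \<subseteq> {..<n} \<and> splits A T}"
          by (rule bij_index_image) (rule Q_splits)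
      qed
      finally show ?thesis unfolding x_def .
    qed
    show "hone H = P (I 0 {})" by (rule one)
    show "hcounit H (P (I n T)) = (if n = 0 then 1 else 0)" if T: "T \<in> arc_diagrams n ?C" for n T
    proof (cases "n = 0")
      case True
      with T one counit_one show ?thesis by (simp add: arc_diagrams_0)
    next
      case False
      have "P (I n T) \<in> hcomp H n" unfolding P_span[symmetric] using I_D[OF T] by (intro fun_vs.span_base) blast
      with False counit_graded show ?thesis by simp
    qed
    show "F i = 0" if "\<And>n. F n \<in> hcomp H n" "(\<Sum>n<N. F n) = 0" "i < N" for F N i
      using that by (rule comp_direct)
  qed (rule prod_add_left prod_add_right prod_scale_left prod_scale_right coprod_add coprod_scale
      counit_add counit_scale; assumption)+
  then show ?thesis by blast
qed

section \<open>The isomorphism criterion\<close>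

theorem theorem5p8:
  fixes SC_UO :: "('g::{field, finite} mat, 'k::field_char_0) graded_hopf"
  assumes "odd CARD('g)"
    and "is_SC_UO SC_UO"
  shows "graded_hopf_isomorphic (SC_USL :: ('f::{field, finite} mat, 'k) graded_hopf) SC_UO
           \<longleftrightarrow> CARD('f) = 2 * CARD('g) - 1"
proof -
  obtain P where UO: "diagram_hopf_algebra SC_UO (UNIV \<times> - {0} :: (bool \<times> 'g) set) P"
    using diagram_hopf_algebra_SC_UO[OF assms(2)] by blast
  have "graded_hopf_isomorphic (SC_USL :: ('f mat, 'k) graded_hopf) SC_UO \<longleftrightarrow>
    card (- {0 :: 'f}) = card (UNIV \<times> - {0} :: (bool \<times> 'g) set)"
    by (rule diagram_hopf_algebras_isomorphic_iff[OF diagram_hopf_algebra_SC_USL UO]) simp_all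
  also have "card (- {0 :: 'f}) = CARD('f) - 1"
    by (simp add: Compl_eq_Diff_UNIV card_Diff_singleton)
  also have "card (UNIV \<times> - {0} :: (bool \<times> 'g) set) = 2 * (CARD('g) - 1)"
    by (simp add: card_cartesian_product Compl_eq_Diff_UNIV card_Diff_singleton)
  also have "CARD('f) - 1 = 2 * (CARD('g) - 1) \<longleftrightarrow> CARD('f) = 2 * CARD('g) - 1"
  proof -
    have "0 < CARD('f)" "0 < CARD('g)" by simp_all
    then show ?thesis by arith
  qed
  finally show ?thesis .
qed

end
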